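(* Let $\mathcal{A}$ be an arrangement of $n\geq 4$ pseudolines in $\mathbb{P}^2(\mathbb{R})$ whose characteristic polynomial $\chi(\mathcal{A},t)$ has only real roots. Then $$t_2 \geq 3 + \frac{(n-5)^2-4}{4m(\mathcal{A})-8}.$$
   Context: An arrangement of pseudolines is a finite set $\mathcal{A}=\{\ell_1,\dots,\ell_n\}$ of $n\geq 3$ smooth closed curves in $\mathbb{P}^2(\mathbb{R})$ that do not intersect themselves, any two distinct of which meet transversally in exactly one point, and which do not all pass through a common point. The weight of a point is the number of pseudolines through it; $t_i$ is the number of points of weight exactly $i$; the multiplicity $m(\mathcal{A})$ is the largest $j$ with $t_j>0$. The intersection lattice $L$ consists of $\emptyset$ (rank $0$), the singletons $\{i\}$ (rank $1$), the sets $I_v=\{i: v\in\ell_i\}$ for points $v$ with $|I_v|\ge 2$ (rank $2$), and $\{1,\dots,n\}$ (rank $3$), ordered by inclusion; $\chi(\mathcal{A},t)=\sum_{X\in L}\mu(\emptyset,X)\,t^{3-\operatorname{rank}(X)}$ with $\mu$ the Möbius function of $L$. *)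

theory Defs
  imports
    "HOL-Analysis.Analysis"
    "HOL-Computational_Algebra.Polynomial"
begin

section \<open>Smooth closed curves in the real projective plane\<close>

definition RP2 :: "(real^3) set set" where
  "RP2 = {p. subspace p \<and> dim p = 1}"

abbreviation proj_pt :: "real^3 \<Rightarrow> (real^3) set" where
  "proj_pt x \<equiv> span {x}"

abbreviation velocity :: "(real \<Rightarrow> 'a::real_normed_vector) \<Rightarrow> real \<Rightarrow> 'a" where
  "velocity g t \<equiv> vector_derivative g (at t)"

definition smooth_map :: "(real \<Rightarrow> 'a::real_normed_vector) \<Rightarrow> bool" where
  "smooth_map g \<longleftrightarrow> (\<forall>k t. (velocity ^^ k) g differentiable (at t))"

text \<open>
  A curve in the projective plane is given in homogeneous coordinates, as
  \<open>t \<mapsto> proj_pt (g t)\<close> with \<open>g\<close> smooth and nowhere zero; every smooth map from the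
  real line to the projective plane lifts in this way. The curve is closed with period 1
  (only the projective point has to recur, so \<open>g\<close> itself may come back as a multiple).
  Since the tangent space of the projective plane at a point \<open>p\<close> is \<open>Hom(p, \<real>\<^sup>3/p)\<close>,
  the curve has nonzero velocity at \<open>t\<close>, i.e. is immersed, iff \<open>g' t \<notin> span {g t}\<close>.
\<close>

definition simple_closed_param :: "(real \<Rightarrow> real^3) \<Rightarrow> (real^3) set set \<Rightarrow> bool" where
  "simple_closed_param g C \<longleftrightarrow>
     smooth_map g \<and>
     (\<forall>t. g t \<noteq> 0) \<and>
     (\<forall>t. velocity g t \<notin> span {g t}) \<and>
     (\<forall>t. proj_pt (g (t + 1)) = proj_pt (g t)) \<and>
     inj_on (\<lambda>t. proj_pt (g t)) {0..<1} \<and>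
     C = range (\<lambda>t. proj_pt (g t))"

definition smooth_simple_closed_curve :: "(real^3) set set \<Rightarrow> bool" where
  "smooth_simple_closed_curve C \<longleftrightarrow> (\<exists>g. simple_closed_param g C)"

text \<open>
  The tangent line at \<open>p = proj_pt (g s)\<close> corresponds to the plane \<open>span {g s, g' s}\<close>
  containing \<open>p\<close>; it does not depend on the parametrization. Two tangent lines together span
  the tangent space of the projective plane at \<open>p\<close> iff the two planes together span
  \<open>\<real>\<^sup>3\<close>.
\<close>

definition transversal_at ::
    "(real^3) set set \<Rightarrow> (real^3) set set \<Rightarrow> (real^3) set \<Rightarrow> bool" where
  "transversal_at C D p \<longleftrightarrow>
     (\<forall>g h s t. simple_closed_param g C \<and> simple_closed_param h D \<and>
        proj_pt (g s) = p \<and> proj_pt (h t) = p \<longrightarrow>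
        span {g s, velocity g s, h t, velocity h t} = UNIV)"


section \<open>Arrangements of pseudolines\<close>

definition pseudoline_arrangement :: "(real^3) set set set \<Rightarrow> bool" where
  "pseudoline_arrangement A \<longleftrightarrow>
     finite A \<and> card A \<ge> 3 \<and>
     (\<forall>C\<in>A. smooth_simple_closed_curve C) \<and>
     (\<forall>C\<in>A. \<forall>D\<in>A. C \<noteq> D \<longrightarrow> (\<exists>p. C \<inter> D = {p} \<and> transversal_at C D p)) \<and>
     \<not> (\<exists>p. \<forall>C\<in>A. p \<in> C)"

definition lines_through :: "(real^3) set set set \<Rightarrow> (real^3) set \<Rightarrow> (real^3) set set set" where
  "lines_through A v = {C \<in> A. v \<in> C}"

definition weight :: "(real^3) set set set \<Rightarrow> (real^3) set \<Rightarrow> nat" where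
  "weight A v = card (lines_through A v)"

text \<open>
  For \<open>i \<ge> 2\<close> these sets of points are finite. The points of weight 0 or 1 are
  infinite in number, so that \<open>card\<close> gives 0 for them; this does not affect
  \<open>arrangement_multiplicity\<close>, as an arrangement always has a point of weight at least 2.
\<close>

definition num_points :: "(real^3) set set set \<Rightarrow> nat \<Rightarrow> nat" where
  "num_points A i = card {v \<in> RP2. weight A v = i}"

definition arrangement_multiplicity :: "(real^3) set set set \<Rightarrow> nat" where
  "arrangement_multiplicity A = Max {j. num_points A j > 0}"


section \<open>Intersection lattice and characteristic polynomial\<close>

text \<open>
  The pseudolines serve as their own indices: lattice elements are subsets of \<open>A\<close>
  instead of subsets of \<open>{1..n}\<close>.
\<close>

definition intersection_lattice :: "(real^3) set set set \<Rightarrow> (real^3) set set set set" where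
  "intersection_lattice A =
     {{}} \<union> {{C} | C. C \<in> A} \<union>
     {lines_through A v | v. v \<in> RP2 \<and> weight A v \<ge> 2} \<union> {A}"

definition lattice_rank :: "(real^3) set set set \<Rightarrow> (real^3) set set set \<Rightarrow> nat" where
  "lattice_rank A X =
     (if X = {} then 0 else if is_singleton X then 1 else if X = A then 3 else 2)"

text \<open>The Moebius function of a family \<open>L\<close> of finite sets, ordered by inclusion.\<close>

function poset_moebius :: "'a set set \<Rightarrow> 'a set \<Rightarrow> 'a set \<Rightarrow> int" where
  "poset_moebius L X Y =
     (if finite Y \<and> X \<subseteq> Y
      then if X = Y then 1 else - (\<Sum>Z\<in>{Z \<in> L. X \<subseteq> Z \<and> Z \<subset> Y}. poset_moebius L X Z)
      else 0)"
  by pat_completeness auto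
termination
  by (relation "Wellfounded.measure (\<lambda>(L, X, Y). card Y)") (auto intro: psubset_card_mono)

declare poset_moebius.simps [simp del]

definition characteristic_poly :: "(real^3) set set set \<Rightarrow> int poly" where
  "characteristic_poly A =
     (\<Sum>X\<in>intersection_lattice A.
        monom (poset_moebius (intersection_lattice A) {} X) (3 - lattice_rank A X))"

definition only_real_roots :: "int poly \<Rightarrow> bool" where
  "only_real_roots P \<longleftrightarrow> (\<forall>z::complex. poly (map_poly of_int P) z = 0 \<longrightarrow> z \<in> \<real>)"

end

theory Submission
  imports Defs
begin

text \<open>
  Since two pseudolines cross exactly once, each of them lifts to a closed curve \<open>c\<close> on the unit
  sphere with \<open>c (t + 1) = - c t\<close>, and by the Jordan curve theorem its complement consists of two
  antipodal sides. So every point off the curves has a sign vector (tope). Inserting the curves one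
  at a time, each new curve splits exactly as many topes as it has edges, which gives at least
  \<open>2 (1 + \<Sum>(w - 1))\<close> topes, the sum being over the vertices of the arrangement and \<open>w\<close> denoting
  their weights. By Janiszewski's theorem two edges cannot bound a tope, so each tope has at least
  three walls; the sphere has \<open>2 \<Sum>w\<close> edges, and counting incidences yields Melchior's inequality
  \<open>\<Sum>(3 - w) \<ge> 3\<close> without any recourse to Euler's formula. Real-rootedness means that the
  discriminant of \<open>\<chi> / (t - 1)\<close> is nonnegative, i.e. \<open>4 \<Sum>(w - 1) \<le> n\<^sup>2 + 2 n - 3\<close>; together
  with \<open>\<Sum>w (w - 1) = n (n - 1)\<close> and \<open>w \<le> m\<close> this gives the bound.
\<close>

section \<open>Closed curves on the sphere\<close>

text \<open>The definition of a pseudoline does not say that the curve is one-sided: a priori its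
  lift could close up and form, with its negative, two disjoint Jordan curves. A single transversal
  crossing with another pseudoline excludes this, and a crossing also shows that the antipodal map
  exchanges the two sides of the lift. This is the only place where derivatives enter. Afterwards
  everything is read off from parities of integer parts: along one lift, the crossings with another
  lie at the parameters \<tau> + k with integer k, and each of them changes the side.

  Regions of the complement are replaced by sign vectors. A sign vector might belong to several
  components, but this question can stay open: Melchior's inequality follows from a lower bound on
  the number of sign vectors and from three walls for each of them, so only inequalities are needed.

  In the final estimate Melchior's inequality is weighted by \<open>m - 1\<close>, because a vertex
  of weight \<open>w \<ge> 3\<close> then leaves the nonnegative remainder
  \<open>(m - w) (w - 3)\<close>.\<close>

lemma periodic_of_int:
  fixes f :: "real \<Rightarrow> 'a"
  assumes "\<And>t. f (t + T) = f t"
  shows "f (t + T * of_int k) = f t"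
proof -
  have *: "f (t + T * real n) = f t" for t n
  proof (induction n)
    case (Suc n)
    have "f (t + T * real (Suc n)) = f ((t + T * real n) + T)" by (simp add: algebra_simps)
    then show ?case using assms Suc by simp
  qed simp
  show ?thesis
  proof (cases "k \<ge> 0")
    case True then show ?thesis using *[of t "nat k"] by simp
  next
    case False then show ?thesis using *[of "t + T * of_int k" "nat (-k)"]
      by (simp add: algebra_simps)
  qed
qed

lemma antiperiodic_of_int:
  fixes f :: "real \<Rightarrow> 'a::group_add"
  assumes "\<And>t. f (t + 1) = - f t"
  shows "f (t + of_int k) = (if even k then f t else - f t)"
proof -
  have "f (t + 2) = f t" for t
  proof -
    have "t + 2 = (t + 1) + 1" by simp
    then show ?thesis by (metis assms minus_minus)
  qed
  note per = periodic_of_int[of f 2, OF this]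
  show ?thesis
  proof (cases "even k")
    case True
    then obtain m where "k = 2 * m" by blast
    then show ?thesis using per[of t m] by simp
  next
    case False
    then obtain m where "k = 2 * m + 1" by (auto elim: oddE)
    then have "t + of_int k = (t + 2 * of_int m) + 1" by simp
    then show ?thesis using assms[of "t + 2 * of_int m"] per[of t m] False by (simp add: ac_simps)
  qed
qed

text \<open>Stereographic projection from \<open>q\<close>. It carries the Jordan curve theorem and
  Janiszewski's theorem, which concern the plane \<open>complex\<close>, over to the sphere as soon
  as a point \<open>q\<close> off the curves is at hand.\<close>

lemma sphere_chart:
  fixes q :: "real^3"
  assumes "norm q = 1"
  obtains f f' where "homeomorphism (sphere 0 1 - {q}) (UNIV::complex set) f f'"
proof -
  have "q \<noteq> 0" using assms by auto
  have "(sphere 0 1 - {q}) homeomorphic {x. q \<bullet> x = 0}"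
    using assms \<open>q \<noteq> 0\<close> by (intro homeomorphic_punctured_sphere_hyperplane) auto
  also have "{x. q \<bullet> x = 0} homeomorphic (UNIV :: complex set)"
    using \<open>q \<noteq> 0\<close>
    by (intro homeomorphic_affine_sets) (auto simp: affine_hyperplane aff_dim_hyperplane)
  finally show ?thesis
    using that unfolding homeomorphic_def by blast
qed

text \<open>The point \<open>q\<close> off the curve is the pole of a planar chart in which the
  curve becomes a Jordan curve. The inside and the outside, the latter completed by
  \<open>q\<close>, are pulled back and blown up to cones, so that the sides are open sets of
  \<open>real^3\<close> and can be tested on curves that are not normalized.\<close>

lemma Jordan_cones:
  fixes c :: "real \<Rightarrow> real^3"
  assumes cont: "continuous_on UNIV c" and T: "T > 0" and c1: "\<And>t. norm (c t) = 1"
    and per: "\<And>t. c (t + T) = c t" and inj: "inj_on c {0..<T}"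
    and q: "norm q = 1" "q \<notin> range c"
  obtains H1 H2 where "open H1" "open H2" "connected H1" "connected H2" "H1 \<inter> H2 = {}"
    "H1 \<union> H2 = {x. x \<noteq> 0 \<and> sgn x \<notin> range c}"
    "\<And>x r. x \<in> H1 \<Longrightarrow> r > 0 \<Longrightarrow> r *\<^sub>R x \<in> H1" "\<And>x r. x \<in> H2 \<Longrightarrow> r > 0 \<Longrightarrow> r *\<^sub>R x \<in> H2"
    "\<And>t. c t \<in> closure H1" "\<And>t. c t \<in> closure H2"
proof -
  obtain f f' where hom: "homeomorphism (sphere 0 1 - {q}) (UNIV::complex set) f f'"
    using sphere_chart q by blast
  have ff': "f (f' z) = z" and f'1: "norm (f' z) = 1" and f'q: "f' z \<noteq> q" for z
    using hom by (auto simp: homeomorphism_def set_eq_iff)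
  have f'f: "f' (f x) = x" if "norm x = 1" "x \<noteq> q" for x
    using hom that by (auto simp: homeomorphism_def)
  have cf: "continuous_on (sphere 0 1 - {q}) f" and cf': "continuous_on S f'" for S
    using hom continuous_on_subset by (auto simp: homeomorphism_def)
  define K where "K = range c"
  define \<gamma> where "\<gamma> = (\<lambda>x. f (c (T * x)))"
  have cS: "c t \<in> sphere 0 1 - {q}" for t using c1 q by auto
  have red: "\<exists>x\<in>{0..<1}. c t = c (T * x)" for t
  proof
    show "c t = c (T * frac (t / T))"
      using periodic_of_int[of c T, OF per, of t "- \<lfloor>t / T\<rfloor>"] T by (simp add: frac_def algebra_simps)
  qed (auto simp: frac_lt_1)
  have "path \<gamma>"
    unfolding path_def \<gamma>_def
    by (rule continuous_on_compose2[OF cf]) (use cS cont in \<open>auto intro!: continuous_on_compose2[OF cont] continuous_intros\<close>)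
  have finj: "f (c s) = f (c t) \<Longrightarrow> c s = c t" for s t
    using cS f'f by (metis DiffE insertI1 c1)
  have loop: "pathfinish \<gamma> = pathstart \<gamma>"
    using per[of 0] by (simp add: \<gamma>_def pathfinish_def pathstart_def)
  have "simple_path \<gamma>"
    unfolding simple_path_def loop_free_def
  proof (intro conjI ballI impI \<open>path \<gamma>\<close>)
    fix x y :: real assume xy: "x \<in> {0..1}" "y \<in> {0..1}" "\<gamma> x = \<gamma> y"
    then have eq: "c (T * x) = c (T * y)" using finj by (auto simp: \<gamma>_def)
    have c1: "c (T * 1) = c (T * 0)" using per[of 0] by simp
    have main: "u = v" if "c (T * u) = c (T * v)" "u \<in> {0..<1}" "v \<in> {0..<1}" for u v
      using inj_onD[OF inj that(1)] that T by (auto simp: mult_less_cancel_left1)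
    consider "x < 1" "y < 1" | "x = 1" "y < 1" | "x < 1" "y = 1" | "x = 1" "y = 1"
      using xy by fastforce
    then show "x = y \<or> x = 0 \<and> y = 1 \<or> x = 1 \<and> y = 0"
    proof cases
      case 1 then show ?thesis using main[of x y] eq xy by auto
    next
      case 2 then show ?thesis using main[of 0 y] eq xy c1 by auto
    next
      case 3 then show ?thesis using main[of x 0] eq xy c1 by auto
    qed auto
  qed
  have im: "path_image \<gamma> = f ` K"
  proof (intro equalityI subsetI)
    fix z assume "z \<in> f ` K"
    then obtain t where "z = f (c t)" by (auto simp: K_def)
    moreover obtain x where "x \<in> {0..<1}" "c t = c (T * x)" using red by blast
    ultimately show "z \<in> path_image \<gamma>" by (auto simp: path_image_def \<gamma>_def)
  qed (auto simp: path_image_def \<gamma>_def K_def)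
  let ?in = "inside (path_image \<gamma>)" and ?out = "outside (path_image \<gamma>)"
  note J = Jordan_inside_outside[OF \<open>simple_path \<gamma>\<close> loop]
  \<comment> \<open>Compact, since the inside is bounded. Taking \<open>H2\<close> as the cone over
    the complement of \<open>M\<close>, rather than over the image of the outside, puts
    \<open>q\<close> on that side and makes openness immediate.\<close>
  define M where "M = f' ` (?in \<union> path_image \<gamma>)"
  have KM: "f' ` path_image \<gamma> = K"
    unfolding im image_image K_def using f'f cS by auto
  have "closure ?in = ?in \<union> path_image \<gamma>"
    using J closure_Un_frontier by metis
  then have "compact (?in \<union> path_image \<gamma>)"
    using J by (metis compact_closure)
  then have "compact M" unfolding M_def using cf' compact_continuous_image by blast
  then have "closed M" by (rule compact_imp_closed)
  have csgn: "continuous_on (-{0::real^3}) sgn"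
    by (auto intro!: continuous_on_sgn[OF continuous_on_id])
  define H1 where "H1 = {x. x \<noteq> 0 \<and> sgn x \<in> f' ` ?in}"
  define H2 where "H2 = {x. x \<noteq> 0 \<and> sgn x \<notin> M}"
  define cone where "cone = (\<lambda>S. (\<lambda>(r,x). r *\<^sub>R x) ` ({0<..} \<times> S) :: (real^3) set)"
  have cone: "{x. x \<noteq> 0 \<and> sgn x \<in> S} = cone S" if "S \<subseteq> sphere 0 1" for S :: "(real^3) set"
  proof (intro set_eqI iffI)
    fix x assume "x \<in> {x. x \<noteq> 0 \<and> sgn x \<in> S}"
    then show "x \<in> cone S"
      unfolding cone_def by (intro image_eqI[of _ _ "(norm x, sgn x)"]) (auto simp: sgn_div_norm)
  next
    fix x assume "x \<in> cone S"
    then obtain r y where "r > 0" "y \<in> S" "x = r *\<^sub>R y" by (auto simp: cone_def)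
    moreover from this that have "norm y = 1" by auto
    ultimately show "x \<in> {x. x \<noteq> 0 \<and> sgn x \<in> S}" by (auto simp: sgn_scaleR sgn_div_norm)
  qed
  have conn: "connected (cone S)" if "connected S" for S
    unfolding cone_def
    by (rule connected_continuous_image)
       (auto intro!: continuous_intros connected_Times that simp: case_prod_unfold)
  have "f' ` ?in = (sphere 0 1 - {q}) \<inter> f -` ?in"
    using ff' f'1 f'q f'f by (auto simp: image_iff) metis
  then have H1': "H1 = {x \<in> -{0} - sgn -` {q}. f (sgn x) \<in> ?in}"
    by (auto simp: H1_def norm_sgn)
  have opq: "open (-{0} - sgn -` {q} :: (real^3) set)"
  proof -
    have "open (-{0} \<inter> sgn -` (-{q}))"
      by (rule continuous_open_preimage[OF csgn]) auto
    moreover have "-{0} \<inter> sgn -` (-{q}) = -{0} - sgn -` {q}" by auto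
    ultimately show ?thesis by simp
  qed
  have "open ((-{0} - sgn -` {q}) \<inter> (\<lambda>x. f (sgn x)) -` ?in)"
  proof (rule continuous_open_preimage)
    show "continuous_on (- {0} - sgn -` {q}) (\<lambda>x. f (sgn x))"
      by (rule continuous_on_compose2[OF cf continuous_on_subset[OF csgn]]) (auto simp: norm_sgn)
  qed (use opq J in auto)
  moreover have "(-{0} - sgn -` {q}) \<inter> (\<lambda>x. f (sgn x)) -` ?in = H1" using H1' by auto
  ultimately have oH1: "open H1" by simp
  have "open (-{0} \<inter> sgn -` (-M))"
    by (rule continuous_open_preimage[OF csgn]) (use \<open>closed M\<close> in auto)
  moreover have "-{0} \<inter> sgn -` (-M) = H2" by (auto simp: H2_def)
  ultimately have oH2: "open H2" by simp
  have "connected (f' ` ?in)" using J cf' connected_continuous_image by blast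
  then have cH1: "connected H1" unfolding H1_def by (subst cone) (auto intro!: conn simp: f'1)
  \<comment> \<open>The pole is a limit of the outside: otherwise the outside would lie in the image
    of a compact part of the punctured sphere, although it is unbounded. Adding \<open>q\<close> to
    the image of the outside therefore keeps it connected.\<close>
  have qcl: "q \<in> closure (f' ` ?out)"
  proof (rule ccontr)
    assume "q \<notin> closure (f' ` ?out)"
    then obtain e where e: "e > 0" "\<forall>y\<in>f' ` ?out. e \<le> dist y q"
      by (meson closure_approachable not_le)
    define N where "N = sphere 0 1 - ball q e"
    have "compact N" unfolding N_def by (intro compact_diff) auto
    moreover have "N \<subseteq> sphere 0 1 - {q}" using e by (auto simp: N_def)
    ultimately have "compact (f ` N)" using cf compact_continuous_image continuous_on_subset by blast
    moreover have "?out \<subseteq> f ` N"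
    proof
      fix z assume "z \<in> ?out"
      then have "f' z \<in> N" using e f'1 by (auto simp: N_def dist_commute)
      then show "z \<in> f ` N" using ff' by (metis image_eqI)
    qed
    ultimately have "bounded ?out" using bounded_subset compact_imp_bounded by blast
    then show False using J by simp
  qed
  have nM: "{x. norm x = 1 \<and> x \<notin> M} = insert q (f' ` ?out)"
  proof (intro set_eqI iffI)
    fix x assume x: "x \<in> {x. norm x = 1 \<and> x \<notin> M}"
    show "x \<in> insert q (f' ` ?out)"
    proof (cases "x = q")
      case False
      then have "f x \<notin> ?in \<union> path_image \<gamma>"
        using x f'f unfolding M_def by (metis (mono_tags, lifting) image_eqI mem_Collect_eq)
      then have "f x \<in> ?out" by (metis ComplI Un_iff inside_Un_outside)
      then show ?thesis using f'f x False by (metis (mono_tags, lifting) image_eqI insertCI mem_Collect_eq)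
    qed auto
  next
    fix x assume x: "x \<in> insert q (f' ` ?out)"
    have "f' z \<notin> M" if "z \<in> ?out" for z
    proof
      assume "f' z \<in> M"
      then have "z \<in> ?in \<union> path_image \<gamma>" unfolding M_def using ff' by (metis imageE)
      then show False using that J outside_no_overlap by blast
    qed
    moreover have "q \<notin> M" using f'q by (auto simp: M_def)
    ultimately show "x \<in> {x. norm x = 1 \<and> x \<notin> M}" using x q f'1 by auto
  qed
  have "connected (insert q (f' ` ?out))"
  proof (rule connected_intermediate_closure)
    show "connected (f' ` ?out)" using J cf' connected_continuous_image by blast
    show "insert q (f' ` ?out) \<subseteq> closure (f' ` ?out)" by (simp add: qcl closure_subset)
  qed auto
  then have "connected (cone {x. norm x = 1 \<and> x \<notin> M})" unfolding nM by (rule conn)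
  moreover have "cone {x. norm x = 1 \<and> x \<notin> M} = H2"
    unfolding H2_def by (subst cone[symmetric]) (auto simp: norm_sgn)
  ultimately have cH2: "connected H2" by simp
  have disj: "H1 \<inter> H2 = {}" by (auto simp: H1_def H2_def M_def)
  have un: "H1 \<union> H2 = {x. x \<noteq> 0 \<and> sgn x \<notin> range c}"
  proof -
    have "x \<in> M \<longleftrightarrow> x \<in> f' ` ?in \<or> x \<in> K" for x unfolding M_def image_Un KM by auto
    moreover have "f' ` ?in \<inter> K = {}"
    proof -
      have "inj f'" using ff' by (metis injI)
      then show ?thesis unfolding KM[symmetric]
        using inside_no_overlap[of "path_image \<gamma>"] by (simp add: image_Int[symmetric])
    qed
    ultimately show ?thesis by (auto simp: H1_def H2_def K_def)
  qed
  have cl: "c t \<in> closure (f' ` S)" if "frontier S = path_image \<gamma>" for t S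
  proof -
    have "f (c t) \<in> closure S" using that im closure_Un_frontier[of S] by (auto simp: K_def)
    then have "f' (f (c t)) \<in> f' ` closure S" by blast
    also have "\<dots> \<subseteq> closure (f' ` S)"
      by (rule image_closure_subset[OF cf']) (simp_all add: closure_subset)
    finally show ?thesis using f'f cS by auto
  qed
  have s: "sgn x = x" if "norm x = 1" for x :: "real^3" using that by (simp add: sgn_div_norm)
  have cc: "c t \<in> closure H" if "frontier S = path_image \<gamma>" "f' ` S \<subseteq> H" for t S H
    using cl[OF that(1)] closure_mono[OF that(2)] by blast
  have "f' ` ?in \<subseteq> H1"
  proof
    fix x assume x: "x \<in> f' ` ?in"
    then have "norm x = 1" using f'1 by auto
    then show "x \<in> H1" using s x by (auto simp: H1_def)
  qed
  then have c1': "c t \<in> closure H1" for t by (rule cc[rotated]) (use J in simp)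
  have "f' ` ?out \<subseteq> H2"
  proof
    fix x assume "x \<in> f' ` ?out"
    then have "norm x = 1" "x \<notin> M" using nM by auto
    then show "x \<in> H2" using s by (auto simp: H2_def)
  qed
  then have c2': "c t \<in> closure H2" for t by (rule cc[rotated]) (use J in simp)
  have cone1: "r *\<^sub>R x \<in> H1" if "x \<in> H1" "r > 0" for x r
    using that by (auto simp: H1_def sgn_scaleR)
  have cone2: "r *\<^sub>R x \<in> H2" if "x \<in> H2" "r > 0" for x r
    using that by (auto simp: H2_def sgn_scaleR)
  show ?thesis using that[OF oH1 oH2 cH1 cH2 disj un cone1 cone2 c1' c2'] .
qed

section \<open>Transversal crossings change sides\<close>

lemma dual_basis3:
  fixes p v w :: "real^3"
  assumes "span {p, v, w} = UNIV"
  obtains \<alpha> \<beta> \<gamma> :: "real^3 \<Rightarrow> real" where "linear \<alpha>" "linear \<beta>" "linear \<gamma>"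
    "\<alpha> p = 1" "\<alpha> v = 0" "\<alpha> w = 0" "\<beta> p = 0" "\<beta> v = 1" "\<beta> w = 0" "\<gamma> p = 0" "\<gamma> v = 0" "\<gamma> w = 1"
    "\<And>z. z = \<alpha> z *\<^sub>R p + \<beta> z *\<^sub>R v + \<gamma> z *\<^sub>R w"
proof -
  have "dim (UNIV :: (real^3) set) = 3" by simp
  then have d3: "dim {p, v, w} = 3" using assms by (metis dim_span)
  then have c: "card {p, v, w} = 3"
    using dim_le_card'[of "{p,v,w}"] card_insert_le_m1[of 3 "{v,w}" p] card_insert_le_m1[of 2 "{w}" v]
    by auto
  then have ind: "independent {p, v, w}"
    using card_le_dim_spanning[of "{p, v, w}" UNIV] assms by simp
  have ne: "p \<noteq> v" "p \<noteq> w" "v \<noteq> w" using c by (auto simp: card_insert_if split: if_splits)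
  have ex: "\<exists>f::real^3 \<Rightarrow> real. linear f \<and> f p = a \<and> f v = b \<and> f w = c" for a b c
    using linear_independent_extend[OF ind, of "\<lambda>x. if x = p then a else if x = v then b else c"] ne
    by auto
  obtain \<alpha> :: "real^3 \<Rightarrow> real" where \<alpha>: "linear \<alpha>" "\<alpha> p = 1" "\<alpha> v = 0" "\<alpha> w = 0" using ex by blast
  obtain \<beta> :: "real^3 \<Rightarrow> real" where \<beta>: "linear \<beta>" "\<beta> p = 0" "\<beta> v = 1" "\<beta> w = 0" using ex by blast
  obtain \<gamma> :: "real^3 \<Rightarrow> real" where \<gamma>: "linear \<gamma>" "\<gamma> p = 0" "\<gamma> v = 0" "\<gamma> w = 1" using ex by blast
  have "id z = \<alpha> z *\<^sub>R p + \<beta> z *\<^sub>R v + \<gamma> z *\<^sub>R w" for z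
  proof (rule linear_eq_on_span[of id _ "{p, v, w}"])
    show "linear (\<lambda>z. \<alpha> z *\<^sub>R p + \<beta> z *\<^sub>R v + \<gamma> z *\<^sub>R w)"
      using \<alpha>(1) \<beta>(1) \<gamma>(1)
      by (auto intro!: linear_compose_add simp: linear_iff algebra_simps)
  qed (use \<alpha> \<beta> \<gamma> assms in \<open>auto simp: linear_id\<close>)
  then show ?thesis using that \<alpha> \<beta> \<gamma> by auto
qed

lemma DERIV_pos_sign:
  fixes f :: "real \<Rightarrow> real"
  assumes "(f has_real_derivative l) (at b)" "l > 0" "f b = 0"
  obtains d where "d > 0" "\<And>t. b < t \<Longrightarrow> t < b + d \<Longrightarrow> f t > 0" "\<And>t. b - d < t \<Longrightarrow> t < b \<Longrightarrow> f t < 0"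
proof -
  obtain d1 where d1: "d1 > 0" "\<And>h. h > 0 \<Longrightarrow> h < d1 \<Longrightarrow> f b < f (b + h)"
    using DERIV_pos_inc_right[OF assms(1,2)] by blast
  obtain d2 where d2: "d2 > 0" "\<And>h. h > 0 \<Longrightarrow> h < d2 \<Longrightarrow> f (b - h) < f b"
    using DERIV_pos_inc_left[OF assms(1,2)] by blast
  show ?thesis
  proof (rule that[of "min d1 d2"])
    show "f t > 0" if "b < t" "t < b + min d1 d2" for t using d1(2)[of "t - b"] that assms by auto
    show "f t < 0" if "b - min d1 d2 < t" "t < b" for t using d2(2)[of "b - t"] that assms by auto
  qed (use d1 d2 in auto)
qed

lemma continuous_DERIV_pos_strict_mono:
  fixes f f' :: "real \<Rightarrow> real"
  assumes "open S" "a \<in> S" "\<And>x. x \<in> S \<Longrightarrow> (f has_real_derivative f' x) (at x)"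
    "continuous_on S f'" "f' a > 0"
  obtains d where "d > 0" "cball a d \<subseteq> S" "\<And>x y. a - d \<le> x \<Longrightarrow> x < y \<Longrightarrow> y \<le> a + d \<Longrightarrow> f x < f y"
proof -
  have "open (S \<inter> f' -` {0<..})" by (rule continuous_open_preimage) (use assms in auto)
  moreover have "a \<in> S \<inter> f' -` {0<..}" using assms by auto
  ultimately obtain d where d: "d > 0" "cball a d \<subseteq> S \<inter> f' -` {0<..}"
    using open_contains_cball by blast
  show ?thesis
  proof (rule that[of d])
    fix x y assume xy: "a - d \<le> x" "x < y" "y \<le> a + d"
    show "f x < f y"
    proof (rule DERIV_pos_imp_increasing[OF xy(2)])
      fix z assume "x \<le> z" "z \<le> y"
      then have "z \<in> cball a d" using xy by (auto simp: dist_real_def)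
      then have "z \<in> S" "f' z > 0" using d(2) by auto
      then show "\<exists>y. DERIV f z :> y \<and> y > 0" using assms(3) by blast
    qed
  qed (use d in auto)
qed

text \<open>
  In the affine chart \<open>\<alpha> = 1\<close> around \<open>g a\<close>, with the basis dual to \<open>g a, g' a, h'\<close>, the curve \<open>g\<close> is
  near \<open>a\<close> the graph of a function with slope in \<open>[-1, 1]\<close>, and moving off \<open>g\<close> in direction \<open>h'\<close> (the
  map \<open>\<Psi>\<close>) parametrizes a neighbourhood. The two halves of that neighbourhood lie in different
  components because \<open>g a\<close> is in the closure of both, while \<open>h\<close> has slope outside \<open>[-1, 1]\<close>.
\<close>

lemma crossing:
  fixes g h :: "real \<Rightarrow> real^3"
  assumes H: "\<And>x r. x \<in> H1 \<Longrightarrow> r > 0 \<Longrightarrow> r *\<^sub>R x \<in> H1" "\<And>x r. x \<in> H2 \<Longrightarrow> r > 0 \<Longrightarrow> r *\<^sub>R x \<in> H2"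
      "open H1" "open H2" "H1 \<inter> H2 = {}" "H1 \<union> H2 = {x. x \<noteq> 0 \<and> sgn x \<notin> range (\<lambda>t. sgn (g t))}"
      "g a \<in> closure H1" "g a \<in> closure H2"
    and g0: "\<And>t. g t \<noteq> 0" and T: "T > 0" and per: "\<And>t. sgn (g (t + T)) = sgn (g t)"
    and inj: "\<And>t. a < t \<Longrightarrow> t < a + T \<Longrightarrow> sgn (g t) \<noteq> sgn (g a)"
    and g': "\<And>t. (g has_vector_derivative g' t) (at t)" and cg': "continuous_on UNIV g'"
    and h': "(h has_vector_derivative h') (at b)"
    and hb: "h b = k *\<^sub>R g a" "k > 0"
    and span: "span {g a, g' a, h'} = UNIV"
  obtains G1 G2 d where "{G1, G2} = {H1, H2}" "d > 0"
    "\<And>t. b < t \<Longrightarrow> t < b + d \<Longrightarrow> h t \<in> G1" "\<And>t. b - d < t \<Longrightarrow> t < b \<Longrightarrow> h t \<in> G2"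
proof -
  define p where "p = g a"
  obtain \<alpha> \<beta> \<gamma> where lin: "linear \<alpha>" "linear \<beta>" "linear \<gamma>" and
    val: "\<alpha> p = 1" "\<alpha> (g' a) = 0" "\<alpha> h' = 0" "\<beta> p = 0" "\<beta> (g' a) = 1" "\<beta> h' = 0"
    "\<gamma> p = 0" "\<gamma> (g' a) = 0" "\<gamma> h' = 1"
    and rep: "\<And>z. z = \<alpha> z *\<^sub>R p + \<beta> z *\<^sub>R g' a + \<gamma> z *\<^sub>R h'"
    using dual_basis3[of p "g' a" h'] span unfolding p_def by metis
  note bl = lin[THEN linear_conv_bounded_linear[THEN iffD1]]
  have cl: "continuous_on S (\<lambda>x. \<alpha> (f x))" "continuous_on S (\<lambda>x. \<beta> (f x))" "continuous_on S (\<lambda>x. \<gamma> (f x))"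
    if "continuous_on S f" for S and f :: "'c::topological_space \<Rightarrow> real^3"
    using bl that by (auto intro: bounded_linear.continuous_on)
  have dl: "((\<lambda>x. \<phi> (f x)) has_real_derivative \<phi> f') (at t)"
    if "(f has_vector_derivative f') (at t)" "linear \<phi>" for f f' t and \<phi> :: "real^3 \<Rightarrow> real"
    using bounded_linear.has_vector_derivative[OF _ that(1), of \<phi>] that(2)
    by (simp add: has_real_derivative_iff_has_vector_derivative linear_conv_bounded_linear)
  have add: "\<alpha> (x + y) = \<alpha> x + \<alpha> y" "\<beta> (x + y) = \<beta> x + \<beta> y" "\<gamma> (x + y) = \<gamma> x + \<gamma> y" for x y
    using lin by (auto simp: linear_add)
  have sc: "\<alpha> (r *\<^sub>R y) = r * \<alpha> y" "\<beta> (r *\<^sub>R y) = r * \<beta> y" "\<gamma> (r *\<^sub>R y) = r * \<gamma> y" for r y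
    using lin by (auto simp: linear_scale)
  have uniq: "x = y" if "\<alpha> x = \<alpha> y" "\<beta> x = \<beta> y" "\<gamma> x = \<gamma> y" for x y
    using that rep by metis
  have cg: "continuous_on S g" for S
    using g' by (meson continuous_at_imp_continuous_on has_vector_derivative_continuous)
  define X where "X = (\<lambda>x. \<beta> (g x) / \<alpha> (g x))"
  define Y where "Y = (\<lambda>x. \<gamma> (g x) / \<alpha> (g x))"
  define S where "S = {x. \<alpha> (g x) > 0}"
  have oS: "open S" unfolding S_def using cl(1)[OF cg] by (intro open_Collect_less) auto
  have aS: "a \<in> S" using val by (simp add: S_def p_def)
  define X' where "X' = (\<lambda>x. (\<beta> (g' x) * \<alpha> (g x) - \<beta> (g x) * \<alpha> (g' x)) / (\<alpha> (g x) * \<alpha> (g x)))"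
  define Y' where "Y' = (\<lambda>x. (\<gamma> (g' x) * \<alpha> (g x) - \<gamma> (g x) * \<alpha> (g' x)) / (\<alpha> (g x) * \<alpha> (g x)))"
  have DX: "(X has_real_derivative X' x) (at x)" "(Y has_real_derivative Y' x) (at x)" if "x \<in> S" for x
    unfolding X_def X'_def Y_def Y'_def using that
    by (auto intro!: DERIV_divide dl[OF g'] lin simp: S_def)
  have cX': "continuous_on S X'" "continuous_on S Y'"
    unfolding X'_def Y'_def
    by (auto intro!: continuous_intros cl cg continuous_on_subset[OF cg'] simp: S_def)
  have at_a: "X' a = 1" "Y' a = 0" "X a = 0" "Y a = 0"
    using val by (auto simp: X'_def Y'_def X_def Y_def p_def)
  \<comment> \<open>Both \<open>X + Y\<close> and \<open>X - Y\<close> have derivative 1 at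
    \<open>a\<close>, so both increase nearby. Together this makes \<open>X\<close> increasing and
    bounds |Y| by |X|.\<close>
  obtain d1 where d1: "d1 > 0" "cball a d1 \<subseteq> S"
    and m1: "\<And>x y. a - d1 \<le> x \<Longrightarrow> x < y \<Longrightarrow> y \<le> a + d1 \<Longrightarrow> X x + Y x < X y + Y y"
    by (rule continuous_DERIV_pos_strict_mono[OF oS aS, of "\<lambda>x. X x + Y x" "\<lambda>x. X' x + Y' x"])
       (use DX cX' at_a in \<open>auto intro!: derivative_intros continuous_intros\<close>)
  obtain d2 where d2: "d2 > 0"
    and m2: "\<And>x y. a - d2 \<le> x \<Longrightarrow> x < y \<Longrightarrow> y \<le> a + d2 \<Longrightarrow> X x - Y x < X y - Y y"
    by (rule continuous_DERIV_pos_strict_mono[OF oS aS, of "\<lambda>x. X x - Y x" "\<lambda>x. X' x - Y' x"])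
       (use DX cX' at_a in \<open>auto intro!: derivative_intros continuous_intros\<close>)
  define e where "e = min (min d1 d2) (T/3)"
  have e: "e > 0" "e \<le> d1" "e \<le> d2" "e < T / 2" using d1 d2 T by (auto simp: e_def)
  have m: "X x < X y" if "a - e \<le> x" "x < y" "y \<le> a + e" for x y
    using m1[of x y] m2[of x y] that e by auto
  have YX: "\<bar>Y x\<bar> \<le> \<bar>X x\<bar>" if "a - e \<le> x" "x \<le> a + e" for x
  proof -
    consider "x < a" | "x = a" | "x > a" by linarith
    then show ?thesis
    proof cases
      case 1 then show ?thesis using m1[of x a] m2[of x a] that e at_a by auto
    next
      case 3 then show ?thesis using m1[of a x] m2[of a x] that e at_a by auto
    qed (use at_a in auto)
  qed
  have \<alpha>g: "\<alpha> (g x) > 0" if "a - e \<le> x" "x \<le> a + e" for x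
    using that e d1(2) by (auto simp: S_def dist_real_def subset_iff)
  \<comment> \<open>The part of the curve away from \<open>a\<close>, over one period. It is compact
    and misses the direction of \<open>p\<close>, so in a small ball around \<open>p\<close> only
    the arc over \<open>[a - e, a + e]\<close> can be met.\<close>
  define L where "L = (\<lambda>t. sgn (g t)) ` {a + e..a + T - e}"
  have "compact L" unfolding L_def
    by (intro compact_continuous_image) (auto simp: sgn_div_norm g0 intro!: continuous_intros cg)
  then have "closed L" by (rule compact_imp_closed)
  have "p \<noteq> 0" using g0 by (simp add: p_def)
  have "sgn p \<notin> L"
  proof
    assume "sgn p \<in> L"
    then obtain t where "a + e \<le> t" "t \<le> a + T - e" "sgn (g t) = sgn (g a)" by (auto simp: L_def p_def)
    then show False using inj[of t] e by auto
  qed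
  have csgn: "continuous_on (-{0::real^3}) sgn"
    by (auto intro!: continuous_on_sgn[OF continuous_on_id])
  have "open (-{0} \<inter> sgn -` (-L))"
    by (rule continuous_open_preimage[OF csgn]) (use \<open>closed L\<close> in auto)
  moreover have "p \<in> -{0} \<inter> sgn -` (-L)" using \<open>p \<noteq> 0\<close> \<open>sgn p \<notin> L\<close> by auto
  ultimately obtain \<rho> where \<rho>: "\<rho> > 0" "ball p \<rho> \<subseteq> -{0} \<inter> sgn -` (-L)"
    using openE by blast
  define \<Psi> where "\<Psi> = (\<lambda>(x,y). (1 / \<alpha> (g x)) *\<^sub>R g x + y *\<^sub>R h')"
  have \<Psi>c: "\<alpha> (\<Psi> (x,y)) = 1" "\<beta> (\<Psi> (x,y)) = X x" "\<gamma> (\<Psi> (x,y)) = Y x + y"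
    if "a - e \<le> x" "x \<le> a + e" for x y
    using \<alpha>g[OF that] by (auto simp: \<Psi>_def add sc val X_def Y_def)
  have c\<Psi>: "continuous_on ({a-e..a+e} \<times> UNIV) \<Psi>"
    unfolding \<Psi>_def case_prod_unfold
    by (auto intro!: continuous_intros cl continuous_on_compose2[OF cg[of UNIV]]) (metis \<alpha>g less_irrefl)+
  have "\<Psi> (a, 0) = p" using val by (simp add: \<Psi>_def p_def)
  then obtain d where d: "d > 0" "d \<le> e"
    "\<And>x y. \<bar>x - a\<bar> < d \<Longrightarrow> \<bar>y\<bar> < d \<Longrightarrow> \<Psi> (x,y) \<in> ball p \<rho>"
  proof -
    have "(a, 0::real) \<in> {a-e..a+e} \<times> UNIV" using e by auto
    then obtain d0 where d0: "d0 > 0"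
      "\<And>z. z \<in> {a-e..a+e} \<times> UNIV \<Longrightarrow> dist z (a,0) < d0 \<Longrightarrow> dist (\<Psi> z) (\<Psi> (a,0)) < \<rho>"
      using c\<Psi>[unfolded continuous_on_iff] \<rho>(1) by blast
    show ?thesis
    proof (rule that[of "min e (d0/2)"])
      fix x y :: real assume xy: "\<bar>x - a\<bar> < min e (d0/2)" "\<bar>y\<bar> < min e (d0/2)"
      have "dist (x,y) (a,0) \<le> \<bar>x - a\<bar> + \<bar>y\<bar>"
        unfolding dist_Pair_Pair dist_real_def using sqrt_sum_squares_le_sum_abs[of "\<bar>x-a\<bar>" "\<bar>y\<bar>"] by auto
      also have "\<dots> < d0" using xy by auto
      finally have "dist (\<Psi> (x,y)) (\<Psi> (a,0)) < \<rho>" using xy by (intro d0(2)) auto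
      then show "\<Psi> (x,y) \<in> ball p \<rho>" using \<open>\<Psi> (a, 0) = p\<close> by (simp add: dist_commute)
    qed (use e d0 in auto)
  qed
  have perk: "sgn (g (t + T * of_int k)) = sgn (g t)" for t k
    by (rule periodic_of_int[of "\<lambda>t. sgn (g t)", OF per])
  have nK: "sgn (\<Psi> (x,y)) \<notin> range (\<lambda>t. sgn (g t))" if "\<bar>x - a\<bar> < d" "\<bar>y\<bar> < d" "y \<noteq> 0" for x y
  proof
    assume "sgn (\<Psi> (x,y)) \<in> range (\<lambda>t. sgn (g t))"
    then obtain t where t: "sgn (\<Psi> (x,y)) = sgn (g t)" by blast
    define u where "u = t + T * real_of_int (- \<lfloor>(t - (a - e)) / T\<rfloor>)"
    have su: "sgn (\<Psi> (x,y)) = sgn (g u)" unfolding u_def perk using t by simp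
    have "T * ((t - (a - e)) / T) = t - (a - e)" using T by simp
    then have "u = a - e + T * frac ((t - (a - e)) / T)"
      unfolding u_def frac_def right_diff_distrib of_int_minus by linarith
    then have "a - e \<le> u" "u < a - e + T"
      using T frac_ge_0[of "(t - (a - e)) / T"] frac_lt_1[of "(t - (a - e)) / T"] by (auto simp: mult_less_cancel_left1)
    moreover have "sgn (g u) \<notin> L" using d(3)[OF that(1,2)] \<rho>(2) su by auto
    then have "u \<notin> {a + e..a + T - e}" by (auto simp: L_def)
    ultimately have u: "a - e \<le> u" "u \<le> a + e" by auto
    have x: "a - e \<le> x" "x \<le> a + e" using that d by auto
    have "\<Psi> (x,y) = norm (\<Psi> (x,y)) *\<^sub>R sgn (g u)" unfolding su[symmetric]
      by (cases "\<Psi> (x,y) = 0") (auto simp: sgn_div_norm)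
    then obtain r where r: "\<Psi> (x,y) = r *\<^sub>R g u" by (auto simp: sgn_div_norm)
    have "r * \<alpha> (g u) = 1" using \<Psi>c(1)[OF x, of y] r by (simp add: sc)
    then have r': "r = 1 / \<alpha> (g u)" using \<alpha>g[OF u] by (simp add: field_simps)
    have "X x = X u" using \<Psi>c(2)[OF x, of y] unfolding r by (simp add: sc r' X_def)
    then have "x = u" using m[of x u] m[of u x] x u by linarith
    moreover have "Y x + y = Y u" using \<Psi>c(3)[OF x, of y] unfolding r by (simp add: sc r' Y_def)
    ultimately show False using that by simp
  qed
  define P where "P = \<Psi> ` ({a-d<..<a+d} \<times> {0<..<d})"
  define N where "N = \<Psi> ` ({a-d<..<a+d} \<times> {-d<..<0})"
  have conn: "connected P" "connected N" unfolding P_def N_def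
    using d by (auto intro!: connected_continuous_image continuous_on_subset[OF c\<Psi>] connected_Times)
  have sub: "P \<subseteq> H1 \<union> H2" "N \<subseteq> H1 \<union> H2"
  proof -
    have *: "\<Psi> (x,y) \<in> H1 \<union> H2" if "\<bar>x - a\<bar> < d" "\<bar>y\<bar> < d" "y \<noteq> 0" for x y
      unfolding H(6) using nK[OF that] d(3)[OF that(1,2)] \<rho>(2) by auto
    have **: "\<Psi> ` Z \<subseteq> H1 \<union> H2" if "\<And>x y. (x,y) \<in> Z \<Longrightarrow> \<bar>x - a\<bar> < d \<and> \<bar>y\<bar> < d \<and> y \<noteq> 0" for Z
    proof (rule image_subsetI)
      fix z assume "z \<in> Z"
      moreover obtain x y where "z = (x,y)" by fastforce
      ultimately show "\<Psi> z \<in> H1 \<union> H2" using *[of x y] that[of x y] by blast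
    qed
    show "P \<subseteq> H1 \<union> H2" unfolding P_def by (rule **) (auto simp: abs_less_iff)
    show "N \<subseteq> H1 \<union> H2" unfolding N_def by (rule **) (auto simp: abs_less_iff)
  qed
  have or: "Z \<subseteq> H1 \<or> Z \<subseteq> H2" if "connected Z" "Z \<subseteq> H1 \<union> H2" for Z
    using connectedD[OF that(1) H(3,4)] that(2) H(5) by blast
  \<comment> \<open>Small enough for points with |\<beta>/\<alpha>| and |\<gamma>/\<alpha>| below
    \<eta> to be positive multiples of values of \<Psi>: the intermediate value theorem solves
    \<open>X x = \<beta> z / \<alpha> z\<close>, and then
    \<open>y = \<gamma> z / \<alpha> z - Y x\<close> is below \<open>2 * \<eta> \<le> d\<close> in
    absolute value.\<close>
  define \<eta> where "\<eta> = Min {- X (a - d/2), X (a + d/2), d/2}"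
  have \<eta>: "\<eta> > 0" "X (a - d/2) \<le> -\<eta>" "\<eta> \<le> X (a + d/2)" "\<eta> \<le> d/2"
    using m[of "a - d/2" a] m[of a "a + d/2"] at_a d e by (auto simp: \<eta>_def)
  have cX: "continuous_on {a - d/2..a + d/2} X"
    unfolding X_def using d by (intro continuous_intros cl cg ballI less_imp_neq[THEN not_sym] \<alpha>g) auto
  have near: "\<exists>x y. \<bar>x - a\<bar> < d \<and> \<bar>y\<bar> < d \<and> z = \<alpha> z *\<^sub>R \<Psi> (x,y) \<and> X x = \<beta> z / \<alpha> z \<and> y = \<gamma> z / \<alpha> z - Y x \<and> \<bar>Y x\<bar> \<le> \<bar>X x\<bar>"
    if z: "\<alpha> z > 0" "\<bar>\<beta> z / \<alpha> z\<bar> < \<eta>" "\<bar>\<gamma> z / \<alpha> z\<bar> < \<eta>" for z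
  proof -
    obtain x where x: "a - d/2 \<le> x" "x \<le> a + d/2" "X x = \<beta> z / \<alpha> z"
    proof -
      have "X (a - d/2) \<le> \<beta> z / \<alpha> z" "\<beta> z / \<alpha> z \<le> X (a + d/2)"
        using z(2) \<eta>(2,3) by linarith+
      then show ?thesis using IVT'[of X "a - d/2" "\<beta> z / \<alpha> z" "a + d/2"] cX d(1) that by auto
    qed
    have x': "a - e \<le> x" "x \<le> a + e" using x d by auto
    define y where "y = \<gamma> z / \<alpha> z - Y x"
    have "\<bar>Y x\<bar> \<le> \<bar>X x\<bar>" using YX[OF x'] .
    then have "\<bar>y\<bar> < d" using z(2,3) x(3) \<eta>(4) unfolding y_def by linarith
    moreover have "z = \<alpha> z *\<^sub>R \<Psi> (x,y)"
      using \<Psi>c[OF x'] z x by (intro uniq) (auto simp: sc y_def)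
    moreover have "\<bar>x - a\<bar> < d" using x d by auto
    ultimately show ?thesis using x y_def \<open>\<bar>Y x\<bar> \<le> \<bar>X x\<bar>\<close> by blast
  qed
  have PN: "\<Psi> (x,y) \<in> P" if "\<bar>x - a\<bar> < d" "0 < y" "y < d" for x y
    unfolding P_def using that by (intro imageI) (auto simp: abs_less_iff)
  have NN: "\<Psi> (x,y) \<in> N" if "\<bar>x - a\<bar> < d" "y < 0" "-d < y" for x y
    unfolding N_def using that by (intro imageI) (auto simp: abs_less_iff)
  define U where "U = {z. \<alpha> z > 0 \<and> \<bar>\<beta> z\<bar> < \<eta> * \<alpha> z \<and> \<bar>\<gamma> z\<bar> < \<eta> * \<alpha> z}"
  have oU: "open U" unfolding U_def
    by (intro open_Collect_conj open_Collect_less continuous_intros cl)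
  have pU: "p \<in> U" using val \<eta> by (auto simp: U_def)
  have Ud: "\<alpha> z > 0" "\<bar>\<beta> z / \<alpha> z\<bar> < \<eta>" "\<bar>\<gamma> z / \<alpha> z\<bar> < \<eta>" if "z \<in> U" for z
    using that by (auto simp: U_def field_simps)
  have meets: "\<exists>z\<in>H. z \<in> U" if "H = H1 \<or> H = H2" for H
    proof -
    have "p \<in> U \<inter> closure H" using that H(7,8) pU p_def by auto
    then have "U \<inter> H \<noteq> {}" using open_Int_closure_eq_empty[OF oU, of H] by auto
    then show ?thesis by auto
  qed
  \<comment> \<open>If one side contained both half-neighbourhoods, it would contain all points of
    \<open>U\<close> off the curve, and the other side could not have \<open>p\<close> in its
    closure.\<close>
  have PorN: "z \<in> Q" if z: "z \<in> U" "z \<in> H1 \<union> H2" and Q: "P \<subseteq> Q" "N \<subseteq> Q" "Q = H1 \<or> Q = H2" for z Q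
  proof -
    obtain x y where xy: "\<bar>x - a\<bar> < d" "\<bar>y\<bar> < d" "z = \<alpha> z *\<^sub>R \<Psi> (x,y)" using near Ud[OF z(1)] by blast
    have "y \<noteq> 0"
    proof
      assume "y = 0"
      then have "z = (\<alpha> z / \<alpha> (g x)) *\<^sub>R g x" using xy(3) by (simp add: \<Psi>_def)
      moreover have "\<alpha> z / \<alpha> (g x) > 0" using Ud[OF z(1)] \<alpha>g[of x] xy d by auto
      ultimately have "sgn z = sgn (g x)" by (metis sgn_scaleR sgn_pos scaleR_one)
      then show False using z H(6) by auto
    qed
    then have "\<Psi> (x,y) \<in> Q" using PN[of x y] NN[of x y] xy Q by (cases "y > 0") auto
    then show ?thesis using Q(3) H(1,2) xy(3) Ud(1)[OF z(1)] by metis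
  qed
  have "\<not> (P \<subseteq> H1 \<and> N \<subseteq> H1)" using PorN[of _ H1] meets[of H2] H(5) by blast
  moreover have "\<not> (P \<subseteq> H2 \<and> N \<subseteq> H2)" using PorN[of _ H2] meets[of H1] H(5) by blast
  ultimately obtain G1 G2 where G: "{G1, G2} = {H1, H2}" "P \<subseteq> G1" "N \<subseteq> G2"
    using or[OF conn(1) sub(1)] or[OF conn(2) sub(2)] by blast
  have Gc: "r *\<^sub>R x \<in> G1" if "x \<in> G1" "r > 0" for x r using that G(1) H(1,2) by (metis doubleton_eq_iff)
  have Gc2: "r *\<^sub>R x \<in> G2" if "x \<in> G2" "r > 0" for x r using that G(1) H(1,2) by (metis doubleton_eq_iff)
  have hbv: "\<alpha> (h b) = k" "\<beta> (h b) = 0" "\<gamma> (h b) = 0" using hb val by (auto simp: sc p_def)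
  \<comment> \<open>Along \<open>h\<close>, both \<gamma> + \<beta> and \<gamma> - \<beta> have
    derivative 1 at \<open>b\<close>. So they have a common sign on either side of \<open>b\<close>,
    and |\<gamma>| exceeds |\<beta>| there. As |Y x| is at most |\<beta>/\<alpha>|, the sign of
    \<open>y = \<gamma> / \<alpha> - Y x\<close> is that of \<gamma>, which decides the
    half.\<close>
  obtain e1 where e1: "e1 > 0" "\<And>t. b < t \<Longrightarrow> t < b + e1 \<Longrightarrow> \<gamma> (h t) + \<beta> (h t) > 0"
    "\<And>t. b - e1 < t \<Longrightarrow> t < b \<Longrightarrow> \<gamma> (h t) + \<beta> (h t) < 0"
    by (rule DERIV_pos_sign[of "\<lambda>t. \<gamma> (h t) + \<beta> (h t)" 1 b])
       (use hbv val DERIV_add[OF dl[OF h' lin(3)] dl[OF h' lin(2)]] in auto)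
  obtain e2 where e2: "e2 > 0" "\<And>t. b < t \<Longrightarrow> t < b + e2 \<Longrightarrow> \<gamma> (h t) - \<beta> (h t) > 0"
    "\<And>t. b - e2 < t \<Longrightarrow> t < b \<Longrightarrow> \<gamma> (h t) - \<beta> (h t) < 0"
    by (rule DERIV_pos_sign[of "\<lambda>t. \<gamma> (h t) - \<beta> (h t)" 1 b])
       (use hbv val DERIV_diff[OF dl[OF h' lin(3)] dl[OF h' lin(2)]] in auto)
  have "h b \<in> U" using hbv hb \<eta> by (auto simp: U_def)
  moreover have "isCont h b" using h' has_vector_derivative_continuous by blast
  ultimately obtain Sb where "open Sb" "b \<in> Sb" and Sb: "\<And>t. t \<in> Sb \<Longrightarrow> h t \<in> U"
    using oU continuous_at_open by metis
  then obtain e3 where "e3 > 0" "ball b e3 \<subseteq> Sb" using openE by blast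
  then have e3: "e3 > 0" "\<And>t. \<bar>t - b\<bar> < e3 \<Longrightarrow> h t \<in> U"
    using Sb by (auto simp: dist_real_def subset_iff)
  define E where "E = min e1 (min e2 e3)"
  have key: "(0 < \<gamma> (h t) \<longrightarrow> h t \<in> G1) \<and> (\<gamma> (h t) < 0 \<longrightarrow> h t \<in> G2)"
    if t: "\<bar>t - b\<bar> < e3" "\<bar>\<beta> (h t)\<bar> < \<bar>\<gamma> (h t)\<bar>" for t
  proof -
    note U = Ud[OF e3(2)[OF t(1)]]
    obtain x y where xy: "\<bar>x - a\<bar> < d" "\<bar>y\<bar> < d" "h t = \<alpha> (h t) *\<^sub>R \<Psi> (x,y)" "X x = \<beta> (h t) / \<alpha> (h t)"
      "y = \<gamma> (h t) / \<alpha> (h t) - Y x" "\<bar>Y x\<bar> \<le> \<bar>X x\<bar>"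
      using near[OF U] by blast
    have lt: "\<bar>Y x\<bar> < \<bar>\<gamma> (h t) / \<alpha> (h t)\<bar>"
    proof -
      have "\<bar>\<beta> (h t)\<bar> / \<alpha> (h t) < \<bar>\<gamma> (h t)\<bar> / \<alpha> (h t)"
        using t(2) U(1) by (rule divide_strict_right_mono)
      then show ?thesis using xy(4,6) U(1) by simp
    qed
    have "y > 0" if "\<gamma> (h t) > 0"
    proof -
      have "\<gamma> (h t) / \<alpha> (h t) > 0" using that U(1) by simp
      then show ?thesis using lt xy(5) by linarith
    qed
    moreover have "y < 0" if "\<gamma> (h t) < 0"
    proof -
      have "\<gamma> (h t) / \<alpha> (h t) < 0" using that U(1) by (simp add: divide_neg_pos)
      then show ?thesis using lt xy(5) by linarith
    qed
    ultimately show ?thesis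
      using PN[of x y] NN[of x y] xy(1,2) G(2,3) Gc Gc2 U(1) xy(3) by (metis abs_less_iff minus_less_iff subsetD)
  qed
  show ?thesis
  proof (rule that[OF G(1), of E])
    show "E > 0" using e1 e2 e3 by (simp add: E_def)
    show "h t \<in> G1" if "b < t" "t < b + E" for t
    proof -
      have "t < b + e1" "t < b + e2" "\<bar>t - b\<bar> < e3" using that by (auto simp: E_def abs_less_iff)
      then show ?thesis using key[of t] e1(2)[of t] e2(2)[of t] that by linarith
    qed
    show "h t \<in> G2" if "b - E < t" "t < b" for t
    proof -
      have "b - e1 < t" "b - e2 < t" "\<bar>t - b\<bar> < e3" using that by (auto simp: E_def abs_less_iff)
      then show ?thesis using key[of t] e1(3)[of t] e2(3)[of t] that by linarith
    qed
  qed
qed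

section \<open>Antipodal closed curves crossing pairwise once\<close>

lemma mem_uminus_image: "x \<in> uminus ` S \<longleftrightarrow> - x \<in> S" for x :: "'a::group_add"
  by (metis image_iff minus_minus)

text \<open>The combinatorial content of an arrangement. \<open>H i\<close> is an open cone, one of
  the two sides of \<open>c i\<close>; the other is its negative. That a crossing changes the side
  follows from \<open>anti\<close>: one unit further along \<open>c i\<close> the point is the
  antipode of the former one and lies on the other side. \<open>meet\<close> is the single
  projective intersection point seen on the double cover, where it becomes one coset of the
  integers.\<close>

locale pseudocircles =
  fixes A :: "'i set" and c :: "'i \<Rightarrow> real \<Rightarrow> real^3" and H :: "'i \<Rightarrow> (real^3) set"
  assumes fin: "finite A"
    and cont: "i \<in> A \<Longrightarrow> continuous_on UNIV (c i)"
    and norm_c: "i \<in> A \<Longrightarrow> norm (c i t) = 1"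
    and anti: "i \<in> A \<Longrightarrow> c i (t + 1) = - c i t"
    and inj: "i \<in> A \<Longrightarrow> c i t = c i u \<Longrightarrow> \<exists>k::int. u = t + 2 * of_int k"
    and openH: "i \<in> A \<Longrightarrow> open (H i)"
    and coneH: "i \<in> A \<Longrightarrow> x \<in> H i \<Longrightarrow> r > 0 \<Longrightarrow> r *\<^sub>R x \<in> H i"
    and cover: "i \<in> A \<Longrightarrow> x \<noteq> 0 \<Longrightarrow> x \<in> H i \<or> - x \<in> H i \<longleftrightarrow> sgn x \<notin> range (c i)"
    and disj: "i \<in> A \<Longrightarrow> x \<in> H i \<Longrightarrow> - x \<notin> H i"
    and closureH: "i \<in> A \<Longrightarrow> c i t \<in> closure (H i)"
    and meet: "i \<in> A \<Longrightarrow> j \<in> A \<Longrightarrow> i \<noteq> j \<Longrightarrow> \<exists>t. \<forall>u. c i u \<in> range (c j) \<longleftrightarrow> u - t \<in> \<int>"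
begin

lemma sgn_c: "i \<in> A \<Longrightarrow> sgn (c i t) = c i t"
  by (simp add: sgn_div_norm norm_c)

lemma c_nz: "i \<in> A \<Longrightarrow> c i t \<noteq> 0"
  using norm_c[of i t] by auto

lemma zero_notin: "i \<in> A \<Longrightarrow> 0 \<notin> H i"
  using disj[of i 0] by auto

lemma c_cover: "i \<in> A \<Longrightarrow> j \<in> A \<Longrightarrow> c i t \<in> H j \<or> - c i t \<in> H j \<longleftrightarrow> c i t \<notin> range (c j)"
  using cover[of j "c i t"] by (simp add: c_nz sgn_c)

lemma shift:
  assumes "i \<in> A"
  shows "c i (t + of_int k) = (if even k then c i t else - c i t)"
  by (rule antiperiodic_of_int[of "c i", OF anti[OF assms]])

text \<open>Between consecutive crossings \<open>c i\<close> is connected and stays on one side of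
  \<open>c j\<close>; by \<open>anti\<close> the sides alternate from one unit interval to the next.
  If the interval starting at the given crossing is on the wrong side, the start is moved by
  1.\<close>

lemma ex_side:
  assumes "i \<in> A" "j \<in> A" "i \<noteq> j"
  shows "\<exists>\<tau>. (\<forall>u. c i u \<in> range (c j) \<longleftrightarrow> u - \<tau> \<in> \<int>) \<and>
             (\<forall>u. c i u \<in> H j \<longleftrightarrow> u - \<tau> \<notin> \<int> \<and> even \<lfloor>u - \<tau>\<rfloor>)"
proof -
  obtain t where t: "\<And>u. c i u \<in> range (c j) \<longleftrightarrow> u - t \<in> \<int>" using meet[OF assms] by blast
  have nint: "x \<notin> \<int>" if "0 < x" "x < 1" for x :: real
    using that frac_eq[of x] frac_eq_0_iff[of x] by auto
  have two: "(\<forall>u. s < u \<and> u < s + 1 \<longrightarrow> c i u \<in> H j) \<or> (\<forall>u. s < u \<and> u < s + 1 \<longrightarrow> - c i u \<in> H j)"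
    if s: "\<And>u. c i u \<in> range (c j) \<longleftrightarrow> u - s \<in> \<int>" for s
  proof -
    have "connected (c i ` {s<..<s+1})"
      by (intro connected_continuous_image continuous_on_subset[OF cont[OF assms(1)]]) auto
    moreover have "open (H j)" "open (uminus ` H j)" using openH[OF assms(2)] by (auto simp: open_negations)
    moreover have "c i ` {s<..<s+1} \<subseteq> H j \<union> uminus ` H j"
    proof
      fix z assume "z \<in> c i ` {s<..<s+1}"
      then obtain u where u: "z = c i u" "0 < u - s" "u - s < 1" by auto
      then show "z \<in> H j \<union> uminus ` H j" using c_cover[OF assms(1,2), of u] s nint by (simp add: mem_uminus_image)
    qed
    moreover have "H j \<inter> uminus ` H j = {}" using disj[OF assms(2)] by auto
    ultimately have "H j \<inter> c i ` {s<..<s+1} = {} \<or> uminus ` H j \<inter> c i ` {s<..<s+1} = {}"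
      by (intro connectedD) auto
    then have "c i ` {s<..<s+1} \<subseteq> uminus ` H j \<or> c i ` {s<..<s+1} \<subseteq> H j"
      using \<open>c i ` {s<..<s+1} \<subseteq> H j \<union> uminus ` H j\<close> by blast
    then show ?thesis by (auto simp: image_subset_iff mem_uminus_image)
  qed
  obtain \<tau> where \<tau>: "\<And>u. c i u \<in> range (c j) \<longleftrightarrow> u - \<tau> \<in> \<int>" "\<And>u. \<tau> < u \<and> u < \<tau> + 1 \<Longrightarrow> c i u \<in> H j"
  proof (cases "\<forall>u. t < u \<and> u < t + 1 \<longrightarrow> c i u \<in> H j")
    case True then show ?thesis using that[of t] t by blast
  next
    case False
    then have F: "\<forall>u. t < u \<and> u < t + 1 \<longrightarrow> - c i u \<in> H j" using two[OF t] by blast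
    show ?thesis
    proof (rule that[of "t + 1"])
      show "c i u \<in> range (c j) \<longleftrightarrow> u - (t + 1) \<in> \<int>" for u
        unfolding t using Ints_diff[OF _ Ints_1, of "u - t"] Ints_add[OF _ Ints_1, of "u - (t+1)"]
        by (auto simp: algebra_simps)
      show "c i u \<in> H j" if "t + 1 < u \<and> u < t + 1 + 1" for u
        using F[rule_format, of "u - 1"] anti[OF assms(1), of "u - 1"] that by simp
    qed
  qed
  have "c i u \<in> H j \<longleftrightarrow> u - \<tau> \<notin> \<int> \<and> even \<lfloor>u - \<tau>\<rfloor>" for u
  proof (cases "u - \<tau> \<in> \<int>")
    case True then show ?thesis using \<tau>(1) c_cover[OF assms(1,2)] by blast
  next
    case False
    define k where "k = \<lfloor>u - \<tau>\<rfloor>"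
    have "u - \<tau> \<noteq> of_int k" using False by auto
    then have "\<tau> < u - of_int k \<and> u - of_int k < \<tau> + 1" unfolding k_def by linarith
    then have "c i (u - of_int k) \<in> H j" using \<tau>(2) by blast
    moreover from this have "- c i (u - of_int k) \<notin> H j" using disj assms by blast
    ultimately show ?thesis
      using shift[OF assms(1), of "u - of_int k" k] False by (simp add: k_def[symmetric])
  qed
  then show ?thesis using \<tau>(1) by blast
qed

text \<open>
  A parameter at which \<open>c i\<close> enters the side \<open>H j\<close>; the sides of \<open>c j\<close> along \<open>c i\<close> are then read off
  from the parity of \<open>\<lfloor>u - cr i j\<rfloor>\<close>.
\<close>

definition cr :: "'i \<Rightarrow> 'i \<Rightarrow> real" where
  "cr i j = (SOME \<tau>. (\<forall>u. c i u \<in> range (c j) \<longleftrightarrow> u - \<tau> \<in> \<int>) \<and>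
                     (\<forall>u. c i u \<in> H j \<longleftrightarrow> u - \<tau> \<notin> \<int> \<and> even \<lfloor>u - \<tau>\<rfloor>))"

lemma cr:
  assumes "i \<in> A" "j \<in> A" "i \<noteq> j"
  shows "c i u \<in> range (c j) \<longleftrightarrow> u - cr i j \<in> \<int>"
    and "c i u \<in> H j \<longleftrightarrow> u - cr i j \<notin> \<int> \<and> even \<lfloor>u - cr i j\<rfloor>"
    and "- c i u \<in> H j \<longleftrightarrow> u - cr i j \<notin> \<int> \<and> odd \<lfloor>u - cr i j\<rfloor>"
proof -
  note * = someI_ex[OF ex_side[OF assms], folded cr_def]
  show 1: "c i u \<in> range (c j) \<longleftrightarrow> u - cr i j \<in> \<int>" and 2: "c i u \<in> H j \<longleftrightarrow> u - cr i j \<notin> \<int> \<and> even \<lfloor>u - cr i j\<rfloor>"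
    using * by blast+
  show "- c i u \<in> H j \<longleftrightarrow> u - cr i j \<notin> \<int> \<and> odd \<lfloor>u - cr i j\<rfloor>"
    using 1 2 c_cover[OF assms(1,2), of u] disj[OF assms(2), of "c i u"] by blast
qed

text \<open>Sign vectors without zero entry are represented by the set of their positive entries.\<close>

definition topes :: "'i set \<Rightarrow> 'i set set" where
  "topes J = {{j\<in>J. x \<in> H j} |x. \<forall>j\<in>J. x \<in> H j \<or> - x \<in> H j}"

text \<open>For nonempty \<open>J\<close>, \<open>card_edges\<close> shows that these sign vectors
  correspond to the arcs into which the other curves cut \<open>c i\<close>. For empty
  \<open>J\<close> there is just the empty sign vector, standing for the uncut curve.\<close>

definition edges :: "'i \<Rightarrow> 'i set \<Rightarrow> 'i set set" where
  "edges i J = {{j\<in>J. c i t \<in> H j} |t. \<forall>j\<in>J. c i t \<in> H j \<or> - c i t \<in> H j}"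

section \<open>Splitting of sign vectors by a new curve\<close>

lemma finite_topes: "finite J \<Longrightarrow> finite (topes J)"
  unfolding topes_def by (rule finite_subset[of _ "Pow J"]) auto

lemma finite_edges: "finite J \<Longrightarrow> finite (edges i J)"
  unfolding edges_def by (rule finite_subset[of _ "Pow J"]) auto

lemma topes_empty: "topes {} = {{}}"
  by (auto simp: topes_def)

text \<open>The curve lies in the closure of \<open>H i\<close>, and the finitely many conditions on
  the other curves are open, so they survive a small step off the curve into
  \<open>H i\<close>.\<close>

lemma perturb:
  assumes "i \<in> A" "J \<subseteq> A" "\<forall>j\<in>J. c i t \<in> H j \<or> - c i t \<in> H j"
  obtains y where "y \<in> H i" "\<And>j. j \<in> J \<Longrightarrow> y \<in> H j \<longleftrightarrow> c i t \<in> H j" "\<And>j. j \<in> J \<Longrightarrow> - y \<in> H j \<longleftrightarrow> - c i t \<in> H j"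
proof -
  define W where "W = (\<Inter>j\<in>J. if c i t \<in> H j then H j else uminus ` H j)"
  have "finite J" using assms fin finite_subset by blast
  then have "open W" unfolding W_def using openH assms(2)
    by (intro open_INT) (auto simp: open_negations)
  moreover have "c i t \<in> W" using assms(3) by (auto simp: W_def mem_uminus_image)
  ultimately have "W \<inter> H i \<noteq> {}" using closureH[OF assms(1)] open_Int_closure_eq_empty by blast
  then obtain y where y: "y \<in> W" "y \<in> H i" by blast
  have "y \<in> H j \<and> c i t \<in> H j \<and> - y \<notin> H j \<and> - c i t \<notin> H j \<or>
        y \<notin> H j \<and> c i t \<notin> H j \<and> - y \<in> H j \<and> - c i t \<in> H j" if "j \<in> J" for j
  proof -
    have Wj: "y \<in> (if c i t \<in> H j then H j else uminus ` H j)" using y(1) that unfolding W_def by blast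
    show ?thesis
    proof (cases "c i t \<in> H j")
    case True
    then have "y \<in> H j" using Wj by simp
    then show ?thesis using True disj assms(2) that by blast
  next
    case False
    then have "- y \<in> H j" "- c i t \<in> H j" using Wj assms(3) that by (auto simp: mem_uminus_image)
    then show ?thesis using False disj[of j "-y"] assms(2) that by auto
    qed
  qed
  then show ?thesis using that[of y] y by blast
qed

text \<open>The step to the other side, obtained at the antipodal parameter \<open>t + 1\<close> and
  then negated.\<close>

lemma perturb':
  assumes "i \<in> A" "J \<subseteq> A" "\<forall>j\<in>J. c i t \<in> H j \<or> - c i t \<in> H j"
  obtains y where "- y \<in> H i" "\<And>j. j \<in> J \<Longrightarrow> y \<in> H j \<longleftrightarrow> c i t \<in> H j" "\<And>j. j \<in> J \<Longrightarrow> - y \<in> H j \<longleftrightarrow> - c i t \<in> H j"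
proof -
  obtain y where "y \<in> H i" "\<And>j. j \<in> J \<Longrightarrow> y \<in> H j \<longleftrightarrow> c i (t + 1) \<in> H j"
    "\<And>j. j \<in> J \<Longrightarrow> - y \<in> H j \<longleftrightarrow> - c i (t + 1) \<in> H j"
    using perturb[OF assms(1,2), of "t + 1"] assms(3) anti[OF assms(1), of t] by auto
  then show ?thesis using that[of "- y"] anti[OF assms(1), of t] by auto
qed

lemma edge_extends:
  assumes i: "i \<in> A" "i \<notin> J" and J: "J \<subseteq> A" and S: "S \<in> edges i J"
  shows "S \<in> topes (insert i J)" "insert i S \<in> topes (insert i J)"
proof -
  obtain t where t: "S = {j\<in>J. c i t \<in> H j}" "\<forall>j\<in>J. c i t \<in> H j \<or> - c i t \<in> H j"
    using S by (auto simp: edges_def)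
  obtain y where y: "y \<in> H i" "\<And>j. j \<in> J \<Longrightarrow> y \<in> H j \<longleftrightarrow> c i t \<in> H j" "\<And>j. j \<in> J \<Longrightarrow> - y \<in> H j \<longleftrightarrow> - c i t \<in> H j"
    using perturb[OF i(1) J t(2)] by metis
  have "insert i S = {j \<in> insert i J. y \<in> H j}" "\<forall>j\<in>insert i J. y \<in> H j \<or> - y \<in> H j"
    using y t by auto
  then show "insert i S \<in> topes (insert i J)" unfolding topes_def by blast
  obtain y where y: "- y \<in> H i" "\<And>j. j \<in> J \<Longrightarrow> y \<in> H j \<longleftrightarrow> c i t \<in> H j" "\<And>j. j \<in> J \<Longrightarrow> - y \<in> H j \<longleftrightarrow> - c i t \<in> H j"
    using perturb'[OF i(1) J t(2)] by metis
  have "S = {j \<in> insert i J. y \<in> H j}" "\<forall>j\<in>insert i J. y \<in> H j \<or> - y \<in> H j"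
    using y t disj[OF i(1), of "-y"] by auto
  then show "S \<in> topes (insert i J)" unfolding topes_def by blast
qed

text \<open>As in deletion and restriction: the sign vectors on \<open>insert i J\<close> are split
  by their entry at \<open>i\<close>, and this entry is then forgotten. Every tope of
  \<open>J\<close> arises from one of the two parts and every element of \<open>edges i J\<close>
  from both; the two cardinalities add up to those of union and intersection.\<close>

lemma card_topes_insert:
  assumes i: "i \<in> A" "i \<notin> J" and J: "J \<subseteq> A"
  shows "card (topes (insert i J)) \<ge> card (topes J) + card (edges i J)"
proof -
  have finJ: "finite J" using J fin finite_subset by blast
  define T where "T = topes (insert i J)"
  define T0 where "T0 = {S \<in> T. i \<notin> S}"
  define T1 where "T1 = {S \<in> T. i \<in> S}"
  define T1' where "T1' = (\<lambda>S. S - {i}) ` T1"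
  have finT: "finite T" unfolding T_def using finJ finite_topes by auto
  have edges: "edges i J \<subseteq> T0 \<inter> T1'"
  proof
    fix S assume S: "S \<in> edges i J"
    then have "i \<notin> S" using i by (auto simp: edges_def)
    then have "S \<in> T0" "insert i S \<in> T1" "S = insert i S - {i}"
      using edge_extends[OF i J S] by (auto simp: T0_def T1_def T_def)
    then show "S \<in> T0 \<inter> T1'" unfolding T1'_def by blast
  qed
  have "topes J \<subseteq> T0 \<union> T1'"
  proof
    fix S assume "S \<in> topes J"
    then obtain x where x: "S = {j\<in>J. x \<in> H j}" "\<forall>j\<in>J. x \<in> H j \<or> - x \<in> H j" by (auto simp: topes_def)
    consider "x \<in> H i" | "- x \<in> H i" | "x = 0" | t where "x \<noteq> 0" "sgn x = c i t" using cover[OF i(1), of x] by blast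
    then show "S \<in> T0 \<union> T1'"
    proof cases
      case 1
      then have "insert i S = {j\<in>insert i J. x \<in> H j}" "\<forall>j\<in>insert i J. x \<in> H j \<or> - x \<in> H j" using x by auto
      then have "insert i S \<in> T1" unfolding T1_def T_def topes_def by blast
      moreover have "S = insert i S - {i}" using x i by auto
      ultimately show ?thesis unfolding T1'_def by blast
    next
      case 2
      then have "x \<notin> H i" using disj[OF i(1), of x] by blast
      then have "S = {j\<in>insert i J. x \<in> H j}" "\<forall>j\<in>insert i J. x \<in> H j \<or> - x \<in> H j" using x 2 by auto
      then have "S \<in> T" unfolding T_def topes_def by blast
      then show ?thesis using x i by (auto simp: T0_def)
    next
      case 3
      \<comment> \<open>The origin lies on no side, so it has a sign vector only with respect to no
        curves at all, and this one is an edge.\<close>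
      then have "J = {}" using x zero_notin J by force
      then have "S \<in> edges i J" using x by (auto simp: edges_def)
      then show ?thesis using edges by blast
    next
      case 4
      have "c i t \<in> H j \<longleftrightarrow> x \<in> H j" "- c i t \<in> H j \<longleftrightarrow> - x \<in> H j" if "j \<in> A" for j
        using coneH[OF that, of x "inverse (norm x)"] coneH[OF that, of "-x" "inverse (norm x)"]
          coneH[OF that, of "c i t" "norm x"] coneH[OF that, of "- c i t" "norm x"] \<open>x \<noteq> 0\<close>
        unfolding 4(2)[symmetric] by (auto simp: sgn_div_norm)
      then have "S = {j\<in>J. c i t \<in> H j}" "\<forall>j\<in>J. c i t \<in> H j \<or> - c i t \<in> H j" using x J by auto
      then have "S \<in> edges i J" unfolding edges_def by blast
      then show ?thesis using edges by blast
    qed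
  qed
  have "card T = card T0 + card T1"
    unfolding T0_def T1_def using finT by (subst card_Un_disjoint[symmetric]) (auto intro: arg_cong[of _ _ card])
  also have "card T1 = card T1'"
    unfolding T1'_def by (rule card_image[symmetric]) (auto simp: inj_on_def T1_def)
  also have "card T0 + card T1' = card (T0 \<union> T1') + card (T0 \<inter> T1')"
    by (rule card_Un_Int) (use finT in \<open>auto simp: T0_def T1'_def T1_def\<close>)
  also have "\<dots> \<ge> card (topes J) + card (edges i J)"
    by (intro add_mono card_mono edges \<open>topes J \<subseteq> T0 \<union> T1'\<close>) (use finT in \<open>auto simp: T0_def T1'_def T1_def\<close>)
  finally show ?thesis by (simp add: T_def)
qed

text \<open>The parameters run over half a period, so each projective crossing point occurs once;
  the antipodal crossings lie in \<open>[1, 2)\<close>.\<close>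

definition crossings :: "'i \<Rightarrow> 'i set \<Rightarrow> real set" where
  "crossings i J = {t\<in>{0..<1}. \<exists>j\<in>J. c i t \<in> range (c j)}"

text \<open>A full period has length 2 and contains two antipodal copies of
  \<open>crossings i J\<close>, which form \<Omega>. The arcs are labelled by their left end points,
  \<open>D a\<close> being the sign vector just to the right of \<open>a\<close>. Different arcs
  have different sign vectors because each curve of \<open>J\<close> is crossed only twice in a
  period.\<close>

lemma card_edges:
  assumes i: "i \<in> A" "i \<notin> J" and J: "J \<subseteq> A" "J \<noteq> {}"
  shows "card (edges i J) = 2 * card (crossings i J)"
proof -
  have finJ: "finite J" using J fin finite_subset by blast
  note cr' = cr[OF i(1)]
  have jA: "j \<in> A" "i \<noteq> j" if "j \<in> J" for j using that i J by auto
  define \<Theta> where "\<Theta> = crossings i J"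
  have \<Theta>: "\<Theta> = {t\<in>{0..<1}. \<exists>j\<in>J. t - cr i j \<in> \<int>}"
    unfolding \<Theta>_def crossings_def using cr' jA by auto
  have frac_int: "frac x = frac y" if "x - y \<in> \<int>" for x y :: real
    using that by (metis Ints_cases add.commute diff_add_cancel frac_add_of_int_right frac_def frac_unique_iff)
  have "\<Theta> \<subseteq> (\<lambda>j. frac (cr i j)) ` J"
  proof
    fix t assume "t \<in> \<Theta>"
    then obtain j where j: "j \<in> J" "t - cr i j \<in> \<int>" "0 \<le> t" "t < 1" by (auto simp: \<Theta>)
    then have "t = frac (cr i j)" using frac_int[of t "cr i j"] frac_eq[of t] by auto
    then show "t \<in> (\<lambda>j. frac (cr i j)) ` J" using j by blast
  qed
  then have fin\<Theta>: "finite \<Theta>" using finJ finite_surj by blast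
  define D where "D = (\<lambda>t. {j\<in>J. even \<lfloor>t - cr i j\<rfloor>})"
  define \<Omega> where "\<Omega> = \<Theta> \<union> (\<lambda>t. t + 1) ` \<Theta>"
  have crit: "\<exists>j\<in>J. a - cr i j \<in> \<int>" if "a \<in> \<Omega>" for a
  proof -
    have "t + 1 - x = (t - x) + 1" for t x :: real by simp
    then have "t + 1 - x \<in> \<int>" if "t - x \<in> \<int>" for t x :: real using that Ints_1 Ints_add by metis
    then show ?thesis using that unfolding \<Omega>_def \<Theta> by blast
  qed
  have gen: "{j\<in>J. c i t \<in> H j} = D t" if "\<forall>j\<in>J. t - cr i j \<notin> \<int>" for t
    using that cr'(2) jA by (auto simp: D_def)
  have gen': "(\<forall>j\<in>J. c i t \<in> H j \<or> - c i t \<in> H j) \<longleftrightarrow> (\<forall>j\<in>J. t - cr i j \<notin> \<int>)" for t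
    using cr' jA by (metis (no_types, lifting))
  \<comment> \<open>A little to the right of \<open>a\<close>, all integer parts are still those at
    \<open>a\<close> and no crossing occurs; since \<open>J\<close> is finite, one such
    \<open>u\<close> serves all \<open>j\<close>.\<close>
  have "D a \<in> edges i J" for a
  proof -
    have "eventually (\<lambda>u. u - cr i j \<notin> \<int> \<and> \<lfloor>u - cr i j\<rfloor> = \<lfloor>a - cr i j\<rfloor>) (at_right a)" for j
      unfolding eventually_at_right_field
    proof (intro exI conjI allI impI)
      show "a < cr i j + of_int \<lfloor>a - cr i j\<rfloor> + 1" by linarith
      fix u assume u: "a < u" "u < cr i j + of_int \<lfloor>a - cr i j\<rfloor> + 1"
      then have l: "of_int \<lfloor>a - cr i j\<rfloor> < u - cr i j" "u - cr i j < of_int \<lfloor>a - cr i j\<rfloor> + 1" by linarith+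
      show fl: "\<lfloor>u - cr i j\<rfloor> = \<lfloor>a - cr i j\<rfloor>" using l by (intro floor_unique) auto
      show "u - cr i j \<notin> \<int>"
      proof
        assume "u - cr i j \<in> \<int>"
        then obtain m where "u - cr i j = of_int m" by (auto elim: Ints_cases)
        then show False using l(1) fl by auto
      qed
    qed
    then have "eventually (\<lambda>u. \<forall>j\<in>J. u - cr i j \<notin> \<int> \<and> \<lfloor>u - cr i j\<rfloor> = \<lfloor>a - cr i j\<rfloor>) (at_right a)"
      using finJ by (auto intro: eventually_ball_finite)
    then obtain u where u: "\<forall>j\<in>J. u - cr i j \<notin> \<int> \<and> \<lfloor>u - cr i j\<rfloor> = \<lfloor>a - cr i j\<rfloor>"
      using eventually_happens trivial_limit_at_right_real by blast
    then have "D a = {j\<in>J. c i u \<in> H j}" using gen[of u] by (auto simp: D_def)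
    then show ?thesis unfolding edges_def using gen'[of u] u by blast
  qed
  moreover have "S \<in> D ` \<Omega>" if "S \<in> edges i J" for S
  proof -
    obtain t where t: "S = D t" "\<forall>j\<in>J. t - cr i j \<notin> \<int>"
    proof -
      obtain t where t: "S = {j\<in>J. c i t \<in> H j}" "\<forall>j\<in>J. c i t \<in> H j \<or> - c i t \<in> H j"
        using \<open>S \<in> edges i J\<close> unfolding edges_def by blast
      have "\<forall>j\<in>J. t - cr i j \<notin> \<int>" using t(2) gen' by blast
      then show ?thesis using that[of t] t(1) gen[of t] by blast
    qed
    \<comment> \<open>The curve crossed last before \<open>t\<close>. Going back from
      \<open>t\<close> to that crossing \<open>a\<close> changes no integer part.\<close>
    obtain j0 where j0: "j0 \<in> J" "\<And>j. j \<in> J \<Longrightarrow> frac (t - cr i j0) \<le> frac (t - cr i j)"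
      using ex_is_arg_min_if_finite[OF finJ J(2), of "\<lambda>j. frac (t - cr i j)"]
      by (auto simp: is_arg_min_linorder)
    define a where "a = t - frac (t - cr i j0)"
    have "\<lfloor>a - cr i j\<rfloor> = \<lfloor>t - cr i j\<rfloor>" if "j \<in> J" for j
    proof (rule floor_unique)
      have "frac (t - cr i j0) \<le> t - cr i j - of_int \<lfloor>t - cr i j\<rfloor>" using j0(2)[OF that] by (simp add: frac_def)
      then show "of_int \<lfloor>t - cr i j\<rfloor> \<le> a - cr i j" by (simp add: a_def)
      show "a - cr i j < of_int \<lfloor>t - cr i j\<rfloor> + 1"
        using frac_ge_0[of "t - cr i j0"] floor_correct[of "t - cr i j"] unfolding a_def by linarith
    qed
    then have "D a = S" by (auto simp: D_def t)
    have "a - cr i j0 = of_int \<lfloor>t - cr i j0\<rfloor>" by (simp add: a_def frac_def)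
    then have a: "a - cr i j0 \<in> \<int>" by simp
    \<comment> \<open>Reduction modulo the period 2, which changes all integer parts by the same
      even number.\<close>
    define b where "b = a - 2 * of_int (\<lfloor>a\<rfloor> div 2)"
    have "b = frac a + of_int (\<lfloor>a\<rfloor> - 2 * (\<lfloor>a\<rfloor> div 2))" by (simp add: b_def frac_def)
    also have "\<lfloor>a\<rfloor> - 2 * (\<lfloor>a\<rfloor> div 2) = \<lfloor>a\<rfloor> mod 2" by (simp add: minus_mult_div_eq_mod)
    finally have b: "b = frac a + of_int (\<lfloor>a\<rfloor> mod 2)" .
    have "frac a - cr i j0 = (a - cr i j0) - of_int \<lfloor>a\<rfloor>" by (simp add: frac_def)
    then have "frac a - cr i j0 \<in> \<int>" using a by (metis Ints_diff Ints_of_int)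
    then have "frac a \<in> \<Theta>" using j0 by (auto simp: \<Theta> frac_lt_1)
    moreover have "\<lfloor>a\<rfloor> mod 2 = 0 \<or> \<lfloor>a\<rfloor> mod 2 = 1" by presburger
    ultimately have "b \<in> \<Omega>" using b by (auto simp: \<Omega>_def)
    moreover have "D b = D a"
    proof -
      have "b - x = a - x - of_int (2 * (\<lfloor>a\<rfloor> div 2))" for x by (simp add: b_def)
      then have "\<lfloor>b - x\<rfloor> = \<lfloor>a - x\<rfloor> - 2 * (\<lfloor>a\<rfloor> div 2)" for x by (metis floor_diff_of_int)
      then show ?thesis by (auto simp: D_def)
    qed
    ultimately show ?thesis using \<open>D a = S\<close> by blast
  qed
  ultimately have "edges i J = D ` \<Omega>" by blast
  moreover have "inj_on D \<Omega>"
  proof -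
    have ne: "D a \<noteq> D b" if ab: "a \<in> \<Omega>" "b \<in> \<Omega>" "a < b" for a b
    proof -
      have "0 \<le> a" "b < 2" using ab by (auto simp: \<Omega>_def \<Theta>)
      obtain j k where j: "j \<in> J" "a - cr i j \<in> \<int>" and k: "k \<in> J" "b - cr i k \<in> \<int>" using crit ab by blast
      obtain m where m: "a - cr i j = of_int m" using j by (auto elim: Ints_cases)
      obtain n where n: "b - cr i k = of_int n" using k by (auto elim: Ints_cases)
      show ?thesis
      \<comment> \<open>If \<open>b < a + 1\<close>, the curve \<open>k\<close> met at
        \<open>b\<close> changes its sign exactly once on the way, namely at \<open>b\<close>.
        Otherwise the curve \<open>j\<close> met at \<open>a\<close> is met again at
        \<open>a + 1\<close>, and not a second time, because \<open>b < a + 2\<close>.\<close>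
      proof (cases "b < a + 1")
        case True
        have "\<lfloor>b - cr i k\<rfloor> = n" "\<lfloor>a - cr i k\<rfloor> = n - 1"
          using n True ab(3) by (auto intro!: floor_unique)
        then have "k \<in> D b \<longleftrightarrow> k \<notin> D a" using k by (auto simp: D_def)
        then show ?thesis by blast
      next
        case False
        have "\<lfloor>a - cr i j\<rfloor> = m" "\<lfloor>b - cr i j\<rfloor> = m + 1"
          using m False \<open>0 \<le> a\<close> \<open>b < 2\<close> by (auto intro!: floor_unique)
        then have "j \<in> D b \<longleftrightarrow> j \<notin> D a" using j by (auto simp: D_def)
        then show ?thesis by blast
      qed
    qed
    then show ?thesis by (metis inj_onI linorder_neqE_linordered_idom)
  qed
  ultimately have "card (edges i J) = card \<Omega>" by (simp add: card_image)
  also have "\<dots> = card \<Theta> + card ((\<lambda>t. t + 1) ` \<Theta>)"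
    unfolding \<Omega>_def using fin\<Theta> by (intro card_Un_disjoint) (auto simp: \<Theta>)
  also have "card ((\<lambda>t. t + 1) ` \<Theta>) = card \<Theta>" by (intro card_image) (auto simp: inj_on_def)
  finally show ?thesis by (simp add: \<Theta>_def)
qed

end

section \<open>Walls of a tope\<close>

context pseudocircles
begin

lemma cover_unit:
  assumes "i \<in> A" "norm x = 1"
  shows "x \<in> H i \<or> - x \<in> H i \<longleftrightarrow> x \<notin> range (c i)"
proof -
  have "x \<noteq> 0" "sgn x = x" using assms(2) by (auto simp: sgn_div_norm)
  then show ?thesis using cover[OF assms(1), of x] by simp
qed

text \<open>By \<open>nc\<close>, two curves \<open>j\<close> and \<open>k\<close> cross
  \<open>c i\<close> at parameters that do not differ by an integer. Prescribing the side of
  \<open>c j\<close> confines the parameter to unit intervals repeating with period 2, and so does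
  \<open>c k\<close>; two such intervals with different ends overlap in less than a unit. Being this
  short is what makes an arc meet every other curve at most once.\<close>

lemma edge_in_short_arc:
  assumes i: "i \<in> A" and nc: "\<nexists>t. \<forall>j\<in>A. c i t \<in> range (c j)"
  shows "\<exists>a b. a < b \<and> b < a + 1 \<and>
    {c i t |t. \<forall>j\<in>A - {i}. if j \<in> S then c i t \<in> H j else - c i t \<in> H j} \<subseteq> c i ` {a..b}"
proof -
  obtain j where j: "j \<in> A" "j \<noteq> i" using nc i by blast
  have "c i (cr i j) \<in> range (c j)" using cr(1)[OF i j(1), of "cr i j"] j by auto
  then obtain k where k: "k \<in> A" "k \<noteq> i" "cr i j - cr i k \<notin> \<int>"
    using nc i cr(1)[OF i] by (metis rangeI)
  define s where "s = (\<lambda>l. if l \<in> S then cr i l else cr i l + 1)"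
  have s: "u - s l \<notin> \<int> \<and> even \<lfloor>u - s l\<rfloor>"
    if "l \<in> A" "l \<noteq> i" "if l \<in> S then c i u \<in> H l else - c i u \<in> H l" for u l
  proof (cases "l \<in> S")
    case True then show ?thesis using that cr(2)[OF i that(1)] by (simp add: s_def)
  next
    case False
    then have *: "u - cr i l \<notin> \<int> \<and> odd \<lfloor>u - cr i l\<rfloor>" using that cr(3)[OF i that(1)] by simp
    have e: "u - (cr i l + 1) = u - cr i l - 1" by simp
    have "u - cr i l - 1 \<notin> \<int>" using * Ints_add[OF _ Ints_1, of "u - cr i l - 1"] by auto
    then show ?thesis using * False by (simp add: s_def e)
  qed
  have "s j - s k \<notin> \<int>"
  proof
    assume "s j - s k \<in> \<int>"
    moreover have "(s j - cr i j) - (s k - cr i k) \<in> \<int>" by (simp add: s_def)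
    ultimately have "(s j - s k) - ((s j - cr i j) - (s k - cr i k)) \<in> \<int>" by (rule Ints_diff)
    then show False using k by (simp add: algebra_simps)
  qed
  \<comment> \<open>The shift by \<open>2 * m\<close> moves \<open>s k\<close> to within
    \<open>-1 \<le> x - y < 1\<close> of \<open>s j\<close>. The values -1 and 0 are then ruled out
    because \<open>x - y\<close> is not an integer.\<close>
  define m where "m = \<lfloor>(s j - s k + 1) / 2\<rfloor>"
  define x where "x = s j"
  define y where "y = s k + 2 * of_int m"
  have "x - y \<notin> \<int>"
  proof
    assume "x - y \<in> \<int>"
    then have "x - y + of_int (2 * m) \<in> \<int>" using Ints_add Ints_of_int by blast
    then show False using \<open>s j - s k \<notin> \<int>\<close> by (simp add: x_def y_def)
  qed
  then have "x - y \<noteq> of_int (-1)" "x - y \<noteq> of_int 0" using Ints_of_int by metis+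
  moreover have "of_int m \<le> (s j - s k + 1) / 2" "(s j - s k + 1) / 2 < of_int m + 1"
    unfolding m_def by linarith+
  then have "-1 \<le> x - y" "x - y < 1" unfolding x_def y_def by (simp_all add: field_simps)
  ultimately have xy: "-1 < x - y" "x - y < 1" "x \<noteq> y" by auto
  have "z \<in> c i ` {max x y..min x y + 1}"
    if z: "z \<in> {c i t |t. \<forall>j\<in>A - {i}. if j \<in> S then c i t \<in> H j else - c i t \<in> H j}" for z
  proof -
    obtain u where u: "z = c i u" "\<forall>j\<in>A - {i}. if j \<in> S then c i u \<in> H j else - c i u \<in> H j"
      using z by blast
    have uj: "u - x \<notin> \<int>" "even \<lfloor>u - x\<rfloor>" and uk: "u - s k \<notin> \<int>" "even \<lfloor>u - s k\<rfloor>"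
      using s[of j u] s[of k u] u j k by (auto simp: x_def)
    define n where "n = \<lfloor>u - x\<rfloor>"
    define v where "v = u - of_int n"
    have "z = c i v" using shift[OF i, of v n] u uj by (simp add: v_def n_def)
    moreover have "x \<le> v" "v < x + 1"
      using floor_correct[of "u - x"] unfolding n_def[symmetric] v_def by linarith+
    moreover have "v - y = u - s k - of_int (n + 2 * m)" by (simp add: v_def y_def)
    then have "\<lfloor>v - y\<rfloor> = \<lfloor>u - s k\<rfloor> - (n + 2 * m)" by (metis floor_diff_of_int)
    then have "even \<lfloor>v - y\<rfloor>" using uj uk by (simp add: n_def)
    \<comment> \<open>The only even number among -1, 0, 1 is 0, so \<open>v\<close> lies in the unit
      interval starting at \<open>y\<close> as well as in the one starting at
      \<open>x\<close>.\<close>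
    moreover have "-1 \<le> \<lfloor>v - y\<rfloor>" "\<lfloor>v - y\<rfloor> < 2"
      using xy \<open>x \<le> v\<close> \<open>v < x + 1\<close> by linarith+
    ultimately have "\<lfloor>v - y\<rfloor> = 0" by presburger
    then have "y \<le> v" "v < y + 1" by linarith+
    then show ?thesis using \<open>z = c i v\<close> \<open>x \<le> v\<close> \<open>v < x + 1\<close> by auto
  qed
  then have "{c i t |t. \<forall>j\<in>A - {i}. if j \<in> S then c i t \<in> H j else - c i t \<in> H j} \<subseteq> c i ` {max x y..min x y + 1}"
    by blast
  moreover have "max x y < min x y + 1" "min x y + 1 < max x y + 1" using xy by auto
  ultimately show ?thesis by blast
qed

text \<open>For a tope \<open>S\<close>, a combinatorial form of adjacency: some point of
  \<open>c i\<close> has the sign prescribed by \<open>S\<close> with respect to every other curve.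
  In this form incidences can be counted through \<open>edges\<close>.\<close>

definition walls :: "'i set \<Rightarrow> 'i set" where
  "walls S = {i\<in>A. S - {i} \<in> edges i (A - {i})}"

text \<open>Crossings of the same two curves differ by integers, and an arc of length below 1 has
  room for only one of them.\<close>

lemma arcs_meet_once:
  assumes i: "i \<in> A" and j: "j \<in> A" "i \<noteq> j" and ab: "b < a + 1"
  shows "\<exists>z. c i ` {a..b} \<inter> range (c j) \<subseteq> {z}"
proof -
  have "t = u" if "t \<in> {a..b}" "u \<in> {a..b}" "c i t \<in> range (c j)" "c i u \<in> range (c j)" for t u
  proof -
    have "(t - cr i j) - (u - cr i j) \<in> \<int>" using that Ints_diff cr(1)[OF i j] by blast
    then obtain k where k: "t - u = of_int k" by (auto elim: Ints_cases)
    then have "of_int k < (1::real)" "of_int k > (-1::real)" using that ab by auto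
    then have "k = 0" by linarith
    then show ?thesis using k by simp
  qed
  then have "\<exists>t. \<forall>u. u \<in> {a..b} \<and> c i u \<in> range (c j) \<longrightarrow> u = t" by metis
  then show ?thesis by blast
qed

lemma finite_crossing_points:
  assumes i: "i \<in> A" and j: "j \<in> A" "i \<noteq> j"
  shows "finite (range (c i) \<inter> range (c j))"
proof (rule finite_subset)
  show "range (c i) \<inter> range (c j) \<subseteq> {c i (cr i j), - c i (cr i j)}"
  proof
    fix x assume "x \<in> range (c i) \<inter> range (c j)"
    then obtain u where u: "x = c i u" "c i u \<in> range (c j)" by auto
    then obtain k where "u - cr i j = of_int k" using cr(1)[OF i j, of u] by (auto elim: Ints_cases)
    then have "u = cr i j + of_int k" by simp
    then show "x \<in> {c i (cr i j), - c i (cr i j)}" using shift[OF i, of "cr i j" k] u(1) by auto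
  qed
qed auto

text \<open>
  If a tope had only two walls, its image in a plane chart would be bounded by two arcs meeting in at
  most one point, together with finitely many vertices; such a set does not separate the plane.
\<close>

lemma card_walls:
  assumes nc: "\<And>i. i \<in> A \<Longrightarrow> \<nexists>t. \<forall>j\<in>A. c i t \<in> range (c j)" and A2: "card A \<ge> 2"
    and S: "S \<in> topes A"
  shows "card (walls S) \<ge> 3"
proof (rule ccontr)
  assume "\<not> 3 \<le> card (walls S)"
  then have W2: "card (walls S) \<le> 2" by simp
  have "walls S \<subseteq> A" by (auto simp: walls_def)
  \<comment> \<open>Fewer than two walls are padded to exactly two curves, so that one argument with
    two arcs covers all cases.\<close>
  then obtain B where B: "walls S \<subseteq> B" "B \<subseteq> A" "card B = 2"
    using exists_subset_between[of "walls S" 2 A] W2 A2 fin by blast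
  then obtain i j where ij: "B = {i, j}" "i \<noteq> j" by (meson card_2_iff)
  then have iA: "i \<in> A" "j \<in> A" using B by auto
  have W: "walls S \<subseteq> {i, j}" using B ij by simp
  define U where "U = {x. \<forall>k\<in>A. if k \<in> S then x \<in> H k else - x \<in> H k}"
  have oH: "open {x. if k \<in> S then x \<in> H k else - x \<in> H k}" if "k \<in> A" for k
  proof -
    have "{x. - x \<in> H k} = uminus ` H k" by (auto simp: mem_uminus_image)
    then show ?thesis using openH[OF that] by (cases "k \<in> S") (auto simp: open_negations)
  qed
  have U_eq: "U = (\<Inter>k\<in>A. {x. if k \<in> S then x \<in> H k else - x \<in> H k})" by (auto simp: U_def)
  have oU: "open U" unfolding U_eq using oH fin by (intro open_INT) auto
  obtain x0 where x0: "S = {k\<in>A. x0 \<in> H k}" "\<forall>k\<in>A. x0 \<in> H k \<or> - x0 \<in> H k"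
    using S by (auto simp: topes_def)
  have x0U: "x0 \<in> U" using x0 by (auto simp: U_def)
  \<comment> \<open>A third tope \<open>S'\<close>, besides \<open>S\<close> and its antipode
    \<open>A - S\<close>, provides the pole \<open>q\<close> of the chart. Then both
    \<open>p\<close>, which lies in the cell of \<open>S\<close>, and \<open>- p\<close>, which does
    not, have images in the plane.\<close>
  have "card (topes A) \<ge> 3"
  proof -
    have "A = insert i (A - {i})" using iA by auto
    then have "card (topes A) \<ge> card (topes (A - {i})) + card (edges i (A - {i}))"
      using card_topes_insert[of i "A - {i}"] iA by auto
    moreover have "card (topes (A - {i})) > 0"
    proof -
      have "{k\<in>A-{i}. x0 \<in> H k} \<in> topes (A - {i})" using x0 unfolding topes_def by blast
      then show ?thesis using finite_topes[of "A - {i}"] fin by (auto simp: card_gt_0_iff)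
    qed
    moreover have "card (edges i (A - {i})) = 2 * card (crossings i (A - {i}))"
      using card_edges[of i "A - {i}"] iA ij by auto
    moreover have "card (edges i (A - {i})) > 0"
    proof -
      \<comment> \<open>The crossings on \<open>c i\<close> are countably many, so some parameter
        avoids them all and yields an edge.\<close>
      have "uncountable (UNIV :: real set)" by (rule uncountable_UNIV_real)
      moreover have "countable (\<Union>k\<in>A - {i}. (\<lambda>n::int. cr i k + of_int n) ` UNIV)"
        using fin by (intro countable_UN countable_image) (auto intro: countable_finite)
      ultimately obtain t where "t \<notin> (\<Union>k\<in>A - {i}. (\<lambda>n::int. cr i k + of_int n) ` UNIV)"
        by (metis UNIV_eq_I)
      then have t: "t \<noteq> cr i k + of_int n" if "k \<in> A - {i}" for k n using that by blast
      have "c i t \<in> H k \<or> - c i t \<in> H k" if k: "k \<in> A - {i}" for k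
      proof -
        have "t - cr i k \<notin> \<int>"
        proof
          assume "t - cr i k \<in> \<int>"
          then obtain n where "t - cr i k = of_int n" by (auto elim: Ints_cases)
          then show False using t[OF k, of n] by simp
        qed
        then show ?thesis using c_cover[OF iA(1), of k t] cr(1)[OF iA(1), of k t] k by blast
      qed
      then have "\<forall>k\<in>A - {i}. c i t \<in> H k \<or> - c i t \<in> H k" by blast
      then have "{k\<in>A-{i}. c i t \<in> H k} \<in> edges i (A - {i})" unfolding edges_def by blast
      then show ?thesis using finite_edges[of "A - {i}" i] fin by (auto simp: card_gt_0_iff)
    qed
    ultimately show ?thesis by presburger
  qed
  moreover have "card {S, A - S} \<le> 2" by (simp add: card_insert_if)
  ultimately have "\<not> topes A \<subseteq> {S, A - S}" using card_mono[of "{S, A - S}" "topes A"] by force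
  then obtain S' where "S' \<in> topes A" "S' \<noteq> S" "S' \<noteq> A - S" by blast
  then obtain q0 where q0: "S' = {k\<in>A. q0 \<in> H k}" "\<forall>k\<in>A. q0 \<in> H k \<or> - q0 \<in> H k"
    by (auto simp: topes_def)
  have nz: "x \<noteq> 0" if "\<forall>k\<in>A. x \<in> H k \<or> - x \<in> H k" for x using that zero_notin iA by force
  have sgnH: "sgn x \<in> H k \<longleftrightarrow> x \<in> H k" if "k \<in> A" "x \<noteq> 0" for x k
    using coneH[OF that(1), of x "inverse (norm x)"] coneH[OF that(1), of "sgn x" "norm x"] that(2)
    by (auto simp: sgn_div_norm)
  define q where "q = sgn q0"
  have q0z: "q0 \<noteq> 0" using nz q0 by blast
  have q: "norm q = 1" using q0z by (simp add: q_def norm_sgn)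
  have qH: "q \<in> H k \<longleftrightarrow> k \<in> S'" "- q \<in> H k \<longleftrightarrow> k \<notin> S'" if "k \<in> A" for k
    using sgnH[OF that, of q0] sgnH[OF that, of "- q0"] q0 q0z disj[OF that, of q0] that
    by (auto simp: q_def sgn_minus)
  have qc: "q \<notin> range (c k)" if "k \<in> A" for k
    using cover_unit[OF that q] qH[OF that] by blast
  define p where "p = sgn x0"
  have x0z: "x0 \<noteq> 0" using nz x0 by blast
  have p: "norm p = 1" using x0z by (simp add: p_def norm_sgn)
  have pH: "p \<in> H k \<longleftrightarrow> k \<in> S" "- p \<in> H k \<longleftrightarrow> k \<notin> S" if "k \<in> A" for k
    using sgnH[OF that, of x0] sgnH[OF that, of "- x0"] x0 x0z disj[OF that, of x0] that
    by (auto simp: p_def sgn_minus)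
  have SA: "S \<subseteq> A" "S' \<subseteq> A" using x0 q0 by auto
  have "p \<noteq> q" using pH(1) qH(1) \<open>S' \<noteq> S\<close> SA by blast
  moreover have "- p \<noteq> q"
  proof
    assume "- p = q"
    then have "k \<in> S' \<longleftrightarrow> k \<notin> S" if "k \<in> A" for k using pH(2)[OF that] qH(1)[OF that] by simp
    then show False using \<open>S' \<noteq> A - S\<close> SA by blast
  qed
  ultimately have pq: "p \<noteq> q" "- p \<noteq> q" by auto
  obtain f f' where hom: "homeomorphism (sphere 0 1 - {q}) (UNIV::complex set) f f'"
    using sphere_chart q by blast
  have ff': "f (f' z) = z" and f'1: "norm (f' z) = 1" and f'q: "f' z \<noteq> q" for z
    using hom by (auto simp: homeomorphism_def set_eq_iff)
  have f'f: "f' (f x) = x" if "norm x = 1" "x \<noteq> q" for x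
    using hom that by (auto simp: homeomorphism_def)
  have cf: "continuous_on (sphere 0 1 - {q}) f" and cf': "continuous_on T f'" for T
    using hom continuous_on_subset by (auto simp: homeomorphism_def)
  define U' where "U' = f' -` U"
  have oU': "open U'" unfolding U'_def using oU cf' by (intro open_vimage) auto
  have arc: "\<exists>a b. a < b \<and> b < a + 1 \<and>
      {c k t |t. \<forall>j\<in>A - {k}. if j \<in> S then c k t \<in> H j else - c k t \<in> H j} \<subseteq> c k ` {a..b}" if "k \<in> A" for k
    using edge_in_short_arc[OF that nc[OF that]] .
  obtain a b where ab: "a < b" "b < a + 1"
    "{c i t |t. \<forall>j\<in>A - {i}. if j \<in> S then c i t \<in> H j else - c i t \<in> H j} \<subseteq> c i ` {a..b}"
    using arc[OF iA(1)] by blast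
  obtain a' b' where ab': "a' < b'" "b' < a' + 1"
    "{c j t |t. \<forall>k\<in>A - {j}. if k \<in> S then c j t \<in> H k else - c j t \<in> H k} \<subseteq> c j ` {a'..b'}"
    using arc[OF iA(2)] by blast
  have arcs: "compact (f ` c k ` {a..b})" "connected (- f ` c k ` {a..b})"
    if k: "k \<in> A" and ab: "a < b" "b < a + 1" for a b k
  proof -
    define \<gamma> where "\<gamma> = (\<lambda>x. f (c k (a + x * (b - a))))"
    have im: "path_image \<gamma> = f ` c k ` {a..b}"
    proof -
      have "(\<lambda>x. a + x * (b - a)) ` {0..1} = {a..b}"
        using image_affinity_atLeastAtMost[of "b - a" a 0 1] ab by (simp add: mult.commute add.commute)
      then have "f ` c k ` {a..b} = f ` c k ` (\<lambda>x. a + x * (b - a)) ` {0..1}" by simp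
      then show ?thesis unfolding path_image_def \<gamma>_def image_image by simp
    qed
    have "c k t \<in> sphere 0 1 - {q}" for t using norm_c[OF k] qc[OF k] by auto
    then have "path \<gamma>"
      unfolding path_def \<gamma>_def
      by (intro continuous_on_compose2[OF cf] continuous_on_compose2[OF cont[OF k]] continuous_intros) auto
    moreover have "inj_on \<gamma> {0..1}"
    proof (rule inj_onI)
      fix x y :: real assume xy: "x \<in> {0..1}" "y \<in> {0..1}" "\<gamma> x = \<gamma> y"
      then have "c k (a + x * (b - a)) = c k (a + y * (b - a))"
        using f'f norm_c qc k unfolding \<gamma>_def by (metis rangeI)
      then obtain n where n: "a + y * (b - a) = a + x * (b - a) + 2 * of_int n" using inj k by blast
      have eq: "(y - x) * (b - a) = 2 * of_int n" using n by (simp add: algebra_simps)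
      have "\<bar>(y - x) * (b - a)\<bar> \<le> 1 * 1"
        unfolding abs_mult using xy ab by (intro mult_mono) auto
      then have "\<bar>2 * real_of_int n\<bar> \<le> 1" unfolding eq by simp
      then have "n = 0" by linarith
      then show "x = y" using eq ab by simp
    qed
    ultimately have "arc \<gamma>" by (simp add: arc_def)
    then show "compact (f ` c k ` {a..b})" "connected (- f ` c k ` {a..b})"
      using compact_arc_image[of \<gamma>] connected_arc_complement[of \<gamma>] im by auto
  qed
  define P where "P = f ` c i ` {a..b}"
  define Q where "Q = f ` c j ` {a'..b'}"
  have PQ: "compact P" "connected (-P)" "compact Q" "connected (-Q)"
    unfolding P_def Q_def using arcs[OF iA(1) ab(1,2)] arcs[OF iA(2) ab'(1,2)] by auto
  \<comment> \<open>Janiszewski's theorem asks for a connected intersection. Here it is empty or one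
    point, since the arc on \<open>c i\<close> is shorter than 1.\<close>
  have "connected (P \<inter> Q)"
  proof -
    obtain z where z: "c i ` {a..b} \<inter> range (c j) \<subseteq> {z}" using arcs_meet_once[OF iA ij(2) ab(2)] by blast
    have "P \<inter> Q \<subseteq> {f z}"
    proof
      fix w assume "w \<in> P \<inter> Q"
      then obtain t u where tu: "w = f (c i t)" "w = f (c j u)" "t \<in> {a..b}"
        unfolding P_def Q_def by blast
      then have "c i t = c j u" using f'f norm_c qc iA by (metis rangeI)
      then have "c i t \<in> c i ` {a..b} \<inter> range (c j)" using tu(3) by blast
      then have "c i t = z" using z by blast
      then show "w \<in> {f z}" using tu(1) by simp
    qed
    then have "P \<inter> Q = {} \<or> P \<inter> Q = {f z}" by auto
    then show ?thesis by auto
  qed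
  have cPQ: "connected (- (P \<union> Q))"
    unfolding connected_iff_connected_component
  proof (intro ballI)
    fix x y assume "x \<in> - (P \<union> Q)" "y \<in> - (P \<union> Q)"
    then have xy: "x \<in> -P" "y \<in> -P" "x \<in> -Q" "y \<in> -Q" by auto
    show "connected_component (- (P \<union> Q)) x y"
      using Janiszewski[OF PQ(1) compact_imp_closed[OF PQ(3)] \<open>connected (P \<inter> Q)\<close>, of x y]
        PQ(2,4)[unfolded connected_iff_connected_component] xy by blast
  qed
  \<comment> \<open>Removing the finitely many vertices keeps an open connected planar set
    connected, and it ensures that the frontier point found below lies on one curve only.\<close>
  define V where "V = f ` (\<Union>k\<in>A. \<Union>l\<in>A - {k}. range (c k) \<inter> range (c l))"
  have "finite V" unfolding V_def using fin finite_crossing_points by (intro finite_imageI finite_UN_I) auto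
  have "open (- (P \<union> Q))" using PQ by (intro open_Compl closed_Un compact_imp_closed)
  then have con: "connected (- (P \<union> Q) - V)"
    using connected_open_diff_countable[of "- (P \<union> Q)" V] cPQ \<open>finite V\<close> by (simp add: countable_finite)
  have offP: "f x \<notin> P \<union> Q \<union> V" if x: "norm x = 1" "x \<noteq> q" "\<forall>k\<in>A. x \<in> H k \<or> - x \<in> H k" for x
  proof -
    have "x \<notin> range (c k)" if "k \<in> A" for k using cover_unit[OF that x(1)] x(3) that by blast
    then have "f x \<noteq> f y" if "k \<in> A" "y \<in> range (c k)" for y k
      using f'f[OF x(1,2)] f'f[of y] norm_c[OF that(1)] qc[OF that(1)] that by (metis rangeE)
    then have ne: "f x \<noteq> f (c k t)" if "k \<in> A" for k t using that by blast
    have "f x \<notin> P" "f x \<notin> Q" using ne[OF iA(1)] ne[OF iA(2)] unfolding P_def Q_def by blast+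
    moreover have "f x \<notin> V" using ne unfolding V_def by blast
    ultimately show ?thesis by simp
  qed
  have pS: "\<forall>k\<in>A. p \<in> H k \<or> - p \<in> H k" using pH by blast
  have "f p \<in> - (P \<union> Q) - V" using offP[OF p pq(1) pS] by auto
  moreover have "f p \<in> U'" using pH f'f[OF p pq(1)] by (auto simp: U'_def U_def)
  moreover have "f (- p) \<in> - (P \<union> Q) - V" using offP[of "- p"] p pq(2) pS by auto
  moreover have "f (- p) \<notin> U'" using f'f[of "- p"] p pq(2) pH iA by (auto simp: U'_def U_def)
  ultimately have "(- (P \<union> Q) - V) \<inter> frontier U' \<noteq> {}"
    using connected_Int_frontier[OF con, of U'] by blast
  then obtain z where z: "z \<in> frontier U'" "z \<notin> P" "z \<notin> Q" "z \<notin> V" by blast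
  define x where "x = f' z"
  have zc: "z \<in> closure U'" "z \<notin> U'" using z(1) oU' by (auto simp: frontier_def interior_open)
  have "x \<in> f' ` closure U'" using zc by (simp add: x_def)
  also have "\<dots> \<subseteq> closure U"
  proof (rule image_closure_subset[OF cf'])
    show "f' ` U' \<subseteq> closure U" using closure_subset[of U] by (auto simp: U'_def)
  qed auto
  finally have xU: "x \<in> closure U" .
  have "x \<notin> U" using zc by (simp add: x_def U'_def)
  have x1: "norm x = 1" "x \<noteq> q" "f x = z" using f'1 f'q ff' by (auto simp: x_def)
  \<comment> \<open>A limit of points of \<open>U\<close> cannot lie strictly on the wrong side of a
    curve. As \<open>x\<close> is not in \<open>U\<close>, it lies on some \<open>c k\<close>, and
    by the choice of \<open>V\<close> on no other curve.\<close>
  have opp: "(if k \<in> S then - x \<notin> H k else x \<notin> H k)" if k: "k \<in> A" for k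
  proof (rule ccontr)
    assume *: "\<not> ?thesis"
    define G where "G = {x. if k \<in> S then - x \<in> H k else x \<in> H k}"
    have "{x. - x \<in> H k} = uminus ` H k" by (auto simp: mem_uminus_image)
    then have "open G" using openH[OF k] unfolding G_def by (cases "k \<in> S") (auto simp: open_negations)
    moreover have "x \<in> G" using * by (auto simp: G_def)
    ultimately have "G \<inter> U \<noteq> {}" using xU open_Int_closure_eq_empty[of G U] by blast
    then obtain y where "y \<in> G" "y \<in> U" by blast
    then show False using disj[OF k, of y] k by (auto simp: G_def U_def split: if_splits)
  qed
  obtain k where k: "k \<in> A" "\<not> (if k \<in> S then x \<in> H k else - x \<in> H k)" using \<open>x \<notin> U\<close> by (auto simp: U_def)
  then have "x \<in> range (c k)" using opp[OF k(1)] cover_unit[OF k(1) x1(1)] by (auto split: if_splits)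
  have *: "if l \<in> S then x \<in> H l else - x \<in> H l" if l: "l \<in> A - {k}" for l
  proof -
    have "x \<notin> range (c l)" using \<open>x \<in> range (c k)\<close> z(4) l k x1(3) unfolding V_def by blast
    then show ?thesis using opp[of l] cover_unit[of l x] x1(1) l by (auto split: if_splits)
  qed
  obtain t where t: "x = c k t" using \<open>x \<in> range (c k)\<close> by blast
  have "l \<in> S \<longleftrightarrow> c k t \<in> H l" if "l \<in> A - {k}" for l
    using *[OF that] disj[of l "c k t"] that unfolding t by (auto split: if_splits)
  then have "S - {k} = {l\<in>A - {k}. c k t \<in> H l}" using SA by blast
  moreover have "\<forall>l\<in>A - {k}. c k t \<in> H l \<or> - c k t \<in> H l" using * unfolding t by metis
  ultimately have "S - {k} \<in> edges k (A - {k})" unfolding edges_def by blast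
  \<comment> \<open>At \<open>x\<close> all curves except \<open>c k\<close> have the sign given by
    \<open>S\<close>, so \<open>k\<close> is a wall and therefore \<open>i\<close> or
    \<open>j\<close>. Then \<open>x\<close> lies on one of the two arcs, although \<open>z\<close>
    was taken off both.\<close>
  then have "k \<in> walls S" using k by (simp add: walls_def)
  then have "k = i \<or> k = j" using W by blast
  then show False
  proof
    assume [simp]: "k = i"
    have "x \<in> c i ` {a..b}" using * t by (intro subsetD[OF ab(3)]) auto
    then show False using z(2) x1(3) by (auto simp: P_def)
  next
    assume [simp]: "k = j"
    have "x \<in> c j ` {a'..b'}" using * t by (intro subsetD[OF ab'(3)]) auto
    then show False using z(3) x1(3) by (auto simp: Q_def)
  qed
qed

section \<open>Double counting and Melchior's inequality\<close>

lemma three_topes_le_edges: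
  assumes nc: "\<And>i. i \<in> A \<Longrightarrow> \<nexists>t. \<forall>j\<in>A. c i t \<in> range (c j)" and A2: "card A \<ge> 2"
  shows "3 * card (topes A) \<le> 2 * (\<Sum>i\<in>A. card (edges i (A - {i})))"
proof -
  have finT: "finite (topes A)" using fin finite_topes by blast
  have "3 * card (topes A) \<le> (\<Sum>S\<in>topes A. card (walls S))"
    using sum_mono[of "topes A" "\<lambda>_. 3" "\<lambda>S. card (walls S)"] card_walls[OF nc A2] by simp
  also have "\<dots> = (\<Sum>S\<in>topes A. \<Sum>i\<in>A. if S - {i} \<in> edges i (A - {i}) then 1 else 0)"
    by (intro sum.cong) (use fin in \<open>auto simp: walls_def sum.If_cases Int_def\<close>)
  also have "\<dots> = (\<Sum>i\<in>A. \<Sum>S\<in>topes A. if S - {i} \<in> edges i (A - {i}) then 1 else 0)" by (rule sum.swap)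
  also have "\<dots> = (\<Sum>i\<in>A. card {S\<in>topes A. S - {i} \<in> edges i (A - {i})})"
    by (intro sum.cong) (use finT in \<open>auto simp: sum.If_cases Int_def\<close>)
  also have "\<dots> \<le> (\<Sum>i\<in>A. 2 * card (edges i (A - {i})))"
  proof (rule sum_mono)
    fix i assume "i \<in> A"
    let ?E = "edges i (A - {i})"
    have finE: "finite ?E" using fin by (intro finite_edges) auto
    \<comment> \<open>An edge of \<open>c i\<close> fixes all entries but the one at
      \<open>i\<close>, so it borders at most two topes.\<close>
    have "{S\<in>topes A. S - {i} \<in> ?E} \<subseteq> ?E \<union> insert i ` ?E"
    proof
      fix S assume "S \<in> {S\<in>topes A. S - {i} \<in> ?E}"
      then have E: "S - {i} \<in> ?E" by simp
      have "S = S - {i} \<or> S = insert i (S - {i})" by blast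
      then show "S \<in> ?E \<union> insert i ` ?E" using E by (metis UnI1 UnI2 imageI)
    qed
    then have "card {S\<in>topes A. S - {i} \<in> ?E} \<le> card (?E \<union> insert i ` ?E)"
      using finE by (intro card_mono) auto
    also have "\<dots> \<le> card ?E + card (insert i ` ?E)" by (rule card_Un_le)
    also have "\<dots> \<le> 2 * card ?E" using card_image_le[OF finE, of "insert i"] by simp
    finally show "card {S\<in>topes A. S - {i} \<in> ?E} \<le> 2 * card ?E" .
  qed
  finally show ?thesis by (simp add: sum_distrib_left)
qed

text \<open>Here \<open>L i\<close> plays the role of the projective curve covered by \<open>c i\<close>.\<close>

lemma card_topes_ge:
  fixes P :: "'p set"
  assumes P: "finite P"
    and cross: "\<And>i J. i \<in> A \<Longrightarrow> J \<subseteq> A \<Longrightarrow> i \<notin> J \<Longrightarrow>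
        card (crossings i J) = card {v\<in>P. v \<in> L i \<and> (\<exists>j\<in>J. v \<in> L j)}"
    and J: "finite J" "J \<noteq> {}" "J \<subseteq> A"
  shows "card (topes J) \<ge> 2 + 2 * (\<Sum>v\<in>P. card {j\<in>J. v \<in> L j} - 1)"
  using J
proof (induction J rule: finite_ne_induct)
  case (singleton i)
  \<comment> \<open>Inserting the first curve adds its one uncut edge to the single tope of the
    empty arrangement: a curve has two sides.\<close>
  have "{} \<in> edges i {}" by (auto simp: edges_def)
  then have "card (edges i {}) > 0" using finite_edges[of "{}" i] by (auto simp: card_gt_0_iff)
  then have "card (topes {i}) \<ge> 2"
    using card_topes_insert[of i "{}"] singleton by (simp add: topes_empty)
  moreover have "card {j\<in>{i}. v \<in> L j} - 1 = 0" for v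
    using card_mono[of "{i}" "{j\<in>{i}. v \<in> L j}"] by auto
  ultimately show ?case by simp
next
  case (insert i J)
  \<comment> \<open>Subtraction on \<open>nat\<close> is truncated, so a point on no curve and a
    point on one curve both contribute 0; the contribution grows from the second curve on.\<close>
  have "card {j\<in>insert i J. v \<in> L j} - 1
      = (card {j\<in>J. v \<in> L j} - 1) + (if v \<in> L i \<and> (\<exists>j\<in>J. v \<in> L j) then 1 else 0)" for v
  proof (cases "v \<in> L i")
    case True
    then have "{j\<in>insert i J. v \<in> L j} = insert i {j\<in>J. v \<in> L j}" by auto
    then have "card {j\<in>insert i J. v \<in> L j} = Suc (card {j\<in>J. v \<in> L j})"
      using insert by simp
    moreover have "card {j\<in>J. v \<in> L j} > 0 \<longleftrightarrow> (\<exists>j\<in>J. v \<in> L j)"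
      using insert by (auto simp: card_gt_0_iff)
    ultimately show ?thesis using True by auto
  next
    case False
    then have "{j\<in>insert i J. v \<in> L j} = {j\<in>J. v \<in> L j}" by auto
    then show ?thesis using False by simp
  qed
  then have "(\<Sum>v\<in>P. card {j\<in>insert i J. v \<in> L j} - 1)
      = (\<Sum>v\<in>P. card {j\<in>J. v \<in> L j} - 1) + card {v\<in>P. v \<in> L i \<and> (\<exists>j\<in>J. v \<in> L j)}"
    using P by (simp add: sum.distrib sum.If_cases Int_def)
  moreover have "card (edges i J) = 2 * card {v\<in>P. v \<in> L i \<and> (\<exists>j\<in>J. v \<in> L j)}"
  proof -
    have i: "i \<in> A" "J \<subseteq> A" "i \<notin> J" "J \<noteq> {}" using insert by simp_all
    show ?thesis using card_edges[OF i(1,3,2,4)] cross[OF i(1-3)] by simp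
  qed
  moreover have "card (topes (insert i J)) \<ge> card (topes J) + card (edges i J)"
    using insert by (intro card_topes_insert) simp_all
  moreover have "card (topes J) \<ge> 2 + 2 * (\<Sum>v\<in>P. card {j\<in>J. v \<in> L j} - 1)"
    using insert by simp
  ultimately show ?case by linarith
qed

text \<open>Each vertex on \<open>L i\<close> gives two antipodal crossings on \<open>c i\<close>,
  so the edges number \<open>2 \<Sum>w\<close> in total. With \<open>T\<close> the number of topes,
  \<open>2 + 2 \<Sum>(w - 1) \<le> T\<close> and \<open>3 T \<le> 4 \<Sum>w\<close>; eliminating
  \<open>T\<close> gives the claim.\<close>

theorem Melchior:
  fixes P :: "'p set"
  assumes P: "finite P" "\<And>v. v \<in> P \<Longrightarrow> card {j\<in>A. v \<in> L j} \<ge> 2"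
    and cross: "\<And>i J. i \<in> A \<Longrightarrow> J \<subseteq> A \<Longrightarrow> i \<notin> J \<Longrightarrow>
        card (crossings i J) = card {v\<in>P. v \<in> L i \<and> (\<exists>j\<in>J. v \<in> L j)}"
    and nc: "\<And>i. i \<in> A \<Longrightarrow> \<nexists>t. \<forall>j\<in>A. c i t \<in> range (c j)" and A2: "card A \<ge> 2"
  shows "(\<Sum>v\<in>P. 3 - int (card {j\<in>A. v \<in> L j})) \<ge> 3"
proof -
  let ?w = "\<lambda>v. card {j\<in>A. v \<in> L j}"
  have "A \<noteq> {}" using A2 by auto
  have "card (edges i (A - {i})) = 2 * card {v\<in>P. v \<in> L i}" if "i \<in> A" for i
  proof -
    have "A - {i} \<noteq> {}" 
    proof
      assume "A - {i} = {}"
      then have "A \<subseteq> {i}" by blast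
      then have "card A \<le> 1" using card_mono[of "{i}" A] by simp
      then show False using A2 by simp
    qed
    then have "card (edges i (A - {i})) = 2 * card (crossings i (A - {i}))"
      using that by (intro card_edges) auto
    also have "card (crossings i (A - {i})) = card {v\<in>P. v \<in> L i \<and> (\<exists>j\<in>A - {i}. v \<in> L j)}"
      using that by (intro cross) auto
    also have "{v\<in>P. v \<in> L i \<and> (\<exists>j\<in>A - {i}. v \<in> L j)} = {v\<in>P. v \<in> L i}"
    proof -
      have "\<exists>j\<in>A - {i}. v \<in> L j" if "v \<in> P" "v \<in> L i" for v
      proof (rule ccontr)
        assume "\<not> ?thesis"
        then have "{j\<in>A. v \<in> L j} \<subseteq> {i}" by auto
        then have "?w v \<le> 1" using card_mono[of "{i}" "{j\<in>A. v \<in> L j}"] by auto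
        then show False using P(2)[OF that(1)] by simp
      qed
      then show ?thesis by auto
    qed
    finally show ?thesis .
  qed
  then have "(\<Sum>i\<in>A. card (edges i (A - {i}))) = 2 * (\<Sum>i\<in>A. card {v\<in>P. v \<in> L i})"
    by (simp add: sum_distrib_left)
  also have "(\<Sum>i\<in>A. card {v\<in>P. v \<in> L i}) = (\<Sum>i\<in>A. \<Sum>v\<in>P. if v \<in> L i then 1 else 0)"
    using P by (simp add: sum.If_cases Int_def)
  also have "\<dots> = (\<Sum>v\<in>P. \<Sum>i\<in>A. if v \<in> L i then 1 else 0)" by (rule sum.swap)
  also have "\<dots> = (\<Sum>v\<in>P. ?w v)" using fin by (simp add: sum.If_cases Int_def)
  finally have "3 * card (topes A) \<le> 4 * (\<Sum>v\<in>P. ?w v)"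
    using three_topes_le_edges[OF nc A2] by simp
  moreover have "card (topes A) \<ge> 2 + 2 * (\<Sum>v\<in>P. ?w v - 1)"
    by (rule card_topes_ge[OF P(1) cross fin \<open>A \<noteq> {}\<close>]) auto
  ultimately have "3 + 3 * (\<Sum>v\<in>P. ?w v - 1) \<le> 2 * (\<Sum>v\<in>P. ?w v)" by linarith
  then have "int (3 + 3 * (\<Sum>v\<in>P. ?w v - 1)) \<le> int (2 * (\<Sum>v\<in>P. ?w v))" by (simp only: of_nat_le_iff)
  moreover have "int (\<Sum>v\<in>P. ?w v - 1) = (\<Sum>v\<in>P. int (?w v) - 1)"
    unfolding of_nat_sum by (intro sum.cong refl) (use P(2) in \<open>fastforce simp: of_nat_diff\<close>)
  ultimately have "3 + 3 * (\<Sum>v\<in>P. int (?w v) - 1) \<le> 2 * (\<Sum>v\<in>P. int (?w v))" by simp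
  then show ?thesis by (simp add: sum_subtractf algebra_simps)
qed

end

section \<open>Lifting a pseudoline arrangement to the sphere\<close>

lemma eq_minus_self_iff: "x = - x \<longleftrightarrow> x = 0" for x :: "'a::real_vector"
proof
  assume "x = - x"
  then have "x + x = 0" by (simp add: eq_neg_iff_add_eq_0)
  then show "x = 0" by (simp add: scaleR_2[symmetric])
qed simp

lemma proj_pt_scale:
  assumes "r \<noteq> 0"
  shows "proj_pt (r *\<^sub>R x) = proj_pt x"
proof
  show "proj_pt (r *\<^sub>R x) \<subseteq> proj_pt x" by (simp add: span_minimal span_scale span_base)
  have "inverse r *\<^sub>R (r *\<^sub>R x) \<in> proj_pt (r *\<^sub>R x)" by (intro span_scale span_base) simp
  then show "proj_pt x \<subseteq> proj_pt (r *\<^sub>R x)" using assms by (simp add: span_minimal)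
qed

lemma proj_pt_sgn: "proj_pt (sgn x) = proj_pt x"
  by (cases "x = 0") (auto simp: sgn_div_norm proj_pt_scale)

lemma proj_pt_eq_iff:
  assumes "x \<noteq> 0" "y \<noteq> 0"
  shows "proj_pt x = proj_pt y \<longleftrightarrow> sgn x = sgn y \<or> sgn x = - sgn y"
proof
  assume "proj_pt x = proj_pt y"
  then have "x \<in> proj_pt y" using span_base[of x "{x}"] by simp
  then obtain r where r: "x = r *\<^sub>R y" by (auto simp: span_singleton)
  then have "r \<noteq> 0" using assms by auto
  then show "sgn x = sgn y \<or> sgn x = - sgn y" unfolding r sgn_scaleR by (auto simp: sgn_if)
next
  assume "sgn x = sgn y \<or> sgn x = - sgn y"
  moreover have "proj_pt (- sgn y) = proj_pt (sgn y)" using proj_pt_scale[of "-1" "sgn y"] by simp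
  ultimately have "proj_pt (sgn x) = proj_pt (sgn y)" by metis
  then show "proj_pt x = proj_pt y" by (simp add: proj_pt_sgn)
qed

lemma proj_pt_RP2: "x \<noteq> 0 \<Longrightarrow> proj_pt x \<in> RP2"
  by (simp add: RP2_def)

lemma closed_under_scale_closure:
  fixes H :: "'a::real_normed_vector set"
  assumes "\<And>x. x \<in> H \<Longrightarrow> r *\<^sub>R x \<in> H" "x \<in> closure H"
  shows "r *\<^sub>R x \<in> closure H"
proof -
  have "(\<lambda>x. r *\<^sub>R x) ` closure H = closure ((\<lambda>x. r *\<^sub>R x) ` H)" by (rule closure_scaleR)
  also have "\<dots> \<subseteq> closure H" using assms(1) by (intro closure_mono) auto
  finally show ?thesis using assms(2) by blast
qed

lemma cone_sgn:
  fixes x y :: "'a::real_normed_vector"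
  assumes "\<And>z r. z \<in> H \<Longrightarrow> r > 0 \<Longrightarrow> r *\<^sub>R z \<in> H" "y \<in> H" "sgn x = sgn y" "x \<noteq> 0"
  shows "x \<in> H"
proof -
  have "y \<noteq> 0" using assms(3,4) by (metis sgn_zero_iff)
  have "x = norm x *\<^sub>R sgn x" using assms(4) by (simp add: sgn_div_norm)
  also have "\<dots> = (norm x / norm y) *\<^sub>R y" unfolding assms(3) by (simp add: sgn_div_norm divide_inverse)
  also have "\<dots> \<in> H" using assms(2,4) \<open>y \<noteq> 0\<close> by (intro assms(1)) auto
  finally show ?thesis .
qed

section \<open>Closed parametrizations and their lifts to the sphere\<close>

context
  fixes g C assumes g: "simple_closed_param g C"
begin

lemma param_nz: "g t \<noteq> 0"
  using g by (simp add: simple_closed_param_def)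

lemma param_range: "v \<in> C \<longleftrightarrow> (\<exists>t. v = proj_pt (g t))"
  using g by (auto simp: simple_closed_param_def)

lemma param_deriv: "(g has_vector_derivative velocity g t) (at t)"
proof -
  have "(velocity ^^ 0) g differentiable (at t)" using g unfolding simple_closed_param_def smooth_map_def by blast
  then show ?thesis by (simp add: vector_derivative_works)
qed

lemma param_cont_deriv: "continuous_on UNIV (velocity g)"
proof -
  have "(velocity ^^ 1) g differentiable (at t)" for t
    using g unfolding simple_closed_param_def smooth_map_def by blast
  then show ?thesis
    by (intro continuous_at_imp_continuous_on ballI differentiable_imp_continuous_within) simp
qed

lemma param_cont: "continuous_on S g"
  using param_deriv by (meson continuous_at_imp_continuous_on has_vector_derivative_continuous)

lemma param_sgn_cont: "continuous_on S (\<lambda>t. sgn (g t))"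
  by (auto simp: sgn_div_norm param_nz intro!: continuous_intros param_cont)

lemma param_proj_eq: "proj_pt (g s) = proj_pt (g t) \<longleftrightarrow> s - t \<in> \<int>"
proof -
  have step: "proj_pt (g (t + 1)) = proj_pt (g t)" for t using g by (simp add: simple_closed_param_def)
  have int: "proj_pt (g (t + of_int k)) = proj_pt (g t)" for t k
    using periodic_of_int[of "\<lambda>t. proj_pt (g t)" 1, OF step] by simp
  have "inj_on (\<lambda>t. proj_pt (g t)) {0..<1}" using g by (simp add: simple_closed_param_def)
  show ?thesis
  proof
    assume eq: "proj_pt (g s) = proj_pt (g t)"
    have fr: "proj_pt (g (frac u)) = proj_pt (g u)" for u
      using int[of "frac u" "\<lfloor>u\<rfloor>"] by (simp add: frac_def)
    have "frac s = frac t"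
      by (rule inj_onD[OF \<open>inj_on _ _\<close>]) (auto simp: fr eq frac_lt_1)
    then have "s - t = of_int (\<lfloor>s\<rfloor> - \<lfloor>t\<rfloor>)" by (simp add: frac_def)
    then show "s - t \<in> \<int>" by (metis Ints_of_int)
  next
    assume "s - t \<in> \<int>"
    then obtain k where "s - t = of_int k" by (auto elim: Ints_cases)
    then have "s = t + of_int k" by simp
    then show "proj_pt (g s) = proj_pt (g t)" using int by simp
  qed
qed

lemma param_sgn_eq: "sgn (g s) = sgn (g t) \<or> sgn (g s) = - sgn (g t) \<longleftrightarrow> s - t \<in> \<int>"
  using param_proj_eq[of s t] proj_pt_eq_iff[OF param_nz param_nz] by simp

text \<open>The inner product of \<open>sgn (g (t + 1))\<close> and \<open>sgn (g t)\<close> is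
  continuous with values 1 and -1, so its sign is constant. The lift closes up after one turn in the
  first case and joins antipodes in the second.\<close>

lemma param_sign: "(\<forall>t. sgn (g (t + 1)) = sgn (g t)) \<or> (\<forall>t. sgn (g (t + 1)) = - sgn (g t))"
proof -
  define \<phi> where "\<phi> = (\<lambda>t. sgn (g (t + 1)) \<bullet> sgn (g t))"
  have n1: "sgn (g t) \<bullet> sgn (g t) = 1" for t
    using param_nz[of t] by (simp add: dot_square_norm norm_sgn)
  have alt: "sgn (g (t + 1)) = sgn (g t) \<or> sgn (g (t + 1)) = - sgn (g t)" for t
    using param_sgn_eq[of "t + 1" t] by simp
  have "continuous_on UNIV \<phi>" unfolding \<phi>_def
    by (intro continuous_intros param_sgn_cont continuous_on_compose2[OF param_sgn_cont[of UNIV]]) auto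
  then have "connected (range \<phi>)" by (intro connected_continuous_image) auto
  moreover have "range \<phi> \<subseteq> {0<..} \<union> {..<0}"
  proof -
    have "\<phi> t \<noteq> 0" for t using alt[of t] n1[of t] by (auto simp: \<phi>_def)
    then show ?thesis by (auto simp: neq_iff)
  qed
  ultimately have "{0<..} \<inter> range \<phi> = {} \<or> {..<0} \<inter> range \<phi> = {}"
    by (intro connectedD) auto
  then have "(\<forall>t. \<phi> t < 0) \<or> (\<forall>t. \<phi> t > 0)" using \<open>range \<phi> \<subseteq> {0<..} \<union> {..<0}\<close> by blast
  moreover have "\<phi> t = 1" if "sgn (g (t + 1)) = sgn (g t)" for t using that n1 by (simp add: \<phi>_def)
  moreover have "\<phi> t = -1" if "sgn (g (t + 1)) = - sgn (g t)" for t using that n1 by (simp add: \<phi>_def)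
  ultimately show ?thesis using alt by (metis less_numeral_extra(1) neg_less_0_iff_less order_less_asym)
qed

end

text \<open>Common preparation for refuting the first alternative of \<open>param_sign\<close> and
  for constructing the sides in the second; \<open>T\<close> is the period of the lift of
  \<open>g\<close>. The factor \<sigma> selects the lift of \<open>h\<close> that meets the lift of
  \<open>g\<close> at \<open>a\<close> itself instead of at the antipode.\<close>

lemma crossing_pair:
  fixes T :: real
  assumes g: "simple_closed_param g C" and h: "simple_closed_param h D"
    and CD: "C \<inter> D = {p}" and tr: "transversal_at C D p"
    and T: "T = 1 \<and> (\<forall>t. sgn (g (t + 1)) = sgn (g t)) \<or> T = 2 \<and> (\<forall>t. sgn (g (t + 1)) = - sgn (g t))"
  obtains G1 G2 a b d \<sigma> where "open G1" "open G2" "connected G1" "connected G2" "G1 \<inter> G2 = {}"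
    "G1 \<union> G2 = {x. x \<noteq> 0 \<and> sgn x \<notin> range (\<lambda>t. sgn (g t))}"
    "\<And>x r. x \<in> G1 \<Longrightarrow> r > 0 \<Longrightarrow> r *\<^sub>R x \<in> G1" "\<And>x r. x \<in> G2 \<Longrightarrow> r > 0 \<Longrightarrow> r *\<^sub>R x \<in> G2"
    "\<And>t. sgn (g t) \<in> closure G1" "\<And>t. sgn (g t) \<in> closure G2"
    "\<sigma> = 1 \<or> \<sigma> = -1" "sgn (\<sigma> *\<^sub>R h b) = sgn (g a)"
    "\<And>s t. proj_pt (g s) = proj_pt (h t) \<Longrightarrow> s - a \<in> \<int> \<and> t - b \<in> \<int>"
    "d > 0" "\<And>t. b < t \<Longrightarrow> t < b + d \<Longrightarrow> \<sigma> *\<^sub>R h t \<in> G1" "\<And>t. b - d < t \<Longrightarrow> t < b \<Longrightarrow> \<sigma> *\<^sub>R h t \<in> G2"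
proof -
  note gnz = param_nz[OF g] and hnz = param_nz[OF h]
  let ?c = "\<lambda>t. sgn (g t)"
  have "p \<in> C" "p \<in> D" using CD by auto
  then obtain a b where a: "p = proj_pt (g a)" and b: "p = proj_pt (h b)"
    using param_range[OF g, of p] param_range[OF h, of p] by blast
  have only: "s - a \<in> \<int> \<and> t - b \<in> \<int>" if "proj_pt (g s) = proj_pt (h t)" for s t
  proof -
    have "proj_pt (g s) \<in> C" "proj_pt (h t) \<in> D" using param_range[OF g] param_range[OF h] by blast+
    then have "proj_pt (g s) = p" "proj_pt (h t) = p" using that CD by (metis IntI singletonD)+
    then show ?thesis using param_proj_eq[OF g] param_proj_eq[OF h] a b by metis
  qed
  have "T > 0" using T by auto
  have per: "?c (t + T) = ?c t" for t
  proof (cases "T = 1")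
    case False
    then have "T = 2" "\<And>t. ?c (t + 1) = - ?c t" using T by auto
    moreover have "t + 2 = (t + 1) + 1" by simp
    ultimately show ?thesis by (metis minus_minus)
  qed (use T in auto)
  have ne: "?c s \<noteq> ?c t" if "s < t" "t < s + T" for s t
  proof
    assume eq: "?c s = ?c t"
    then have "t - s \<in> \<int>" using param_sgn_eq[OF g, of t s] by simp
    then obtain k where k: "t - s = of_int k" by (auto elim: Ints_cases)
    have "of_int k > (0::real)" "of_int k < (2::real)" using k that T by auto
    then have "k = 1" by linarith
    then have t: "t = s + 1" using k by simp
    then have "T = 2" using that T by auto
    then have "?c t = - ?c s" using T t by auto
    then have "?c s = - ?c s" using eq by metis
    then show False using gnz[of s] unfolding eq_minus_self_iff by (simp add: sgn_zero_iff)
  qed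
  have inj: "inj_on ?c {0..<T}"
  proof (rule inj_onI)
    fix s t assume st: "s \<in> {0..<T}" "t \<in> {0..<T}" "?c s = ?c t"
    show "s = t" using ne[of s t] ne[of t s] st by (cases s t rule: linorder_cases) auto
  qed
  have half: "(1/2::real) \<notin> \<int>"
  proof
    assume "(1/2::real) \<in> \<int>"
    then obtain k :: int where "1/2 = real_of_int k" by (auto elim: Ints_cases)
    then have "1 = real_of_int (2 * k)" by simp
    then have "1 = 2 * k" by (metis of_int_eq_1_iff)
    then show False by presburger
  qed
  \<comment> \<open>The pole needed by \<open>Jordan_cones\<close> is taken on the other curve,
    halfway between two consecutive passages through the common point.\<close>
  have q: "sgn (h (b + 1/2)) \<notin> range ?c"
  proof
    assume "sgn (h (b + 1/2)) \<in> range ?c"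
    then obtain s where "sgn (h (b + 1/2)) = ?c s" by blast
    then have "proj_pt (g s) = proj_pt (h (b + 1/2))" using proj_pt_eq_iff[OF gnz hnz] by auto
    then show False using only half by fastforce
  qed
  obtain H1 H2 where H: "open H1" "open H2" "connected H1" "connected H2" "H1 \<inter> H2 = {}"
    "H1 \<union> H2 = {x. x \<noteq> 0 \<and> sgn x \<notin> range ?c}"
    "\<And>x r. x \<in> H1 \<Longrightarrow> r > 0 \<Longrightarrow> r *\<^sub>R x \<in> H1" "\<And>x r. x \<in> H2 \<Longrightarrow> r > 0 \<Longrightarrow> r *\<^sub>R x \<in> H2"
    "\<And>t. ?c t \<in> closure H1" "\<And>t. ?c t \<in> closure H2"
    using Jordan_cones[OF param_sgn_cont[OF g] \<open>T > 0\<close> _ per inj _ q] gnz hnz by (auto simp: norm_sgn)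
  have "sgn (h b) = ?c a \<or> sgn (h b) = - ?c a"
    using proj_pt_eq_iff[OF hnz gnz] a b by simp
  then obtain \<sigma> :: real where \<sigma>: "\<sigma> = 1 \<or> \<sigma> = -1" "sgn (\<sigma> *\<^sub>R h b) = ?c a"
    by (metis minus_minus scaleR_minus1_left scaleR_one sgn_minus)
  define k where "k = norm (h b) / norm (g a)"
  have "k > 0" using gnz hnz by (simp add: k_def)
  have hb: "\<sigma> *\<^sub>R h b = k *\<^sub>R g a"
  proof -
    have "\<sigma> *\<^sub>R h b = norm (\<sigma> *\<^sub>R h b) *\<^sub>R sgn (\<sigma> *\<^sub>R h b)"
      using hnz \<sigma>(1) by (auto simp: sgn_div_norm)
    also have "\<dots> = norm (h b) *\<^sub>R ?c a" using \<sigma> by auto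
    finally show ?thesis by (simp add: sgn_div_norm k_def divide_inverse)
  qed
  have cl: "g a \<in> closure H1" "g a \<in> closure H2"
    using closed_under_scale_closure[of H1 "norm (g a)", OF H(7) H(9)[of a]]
      closed_under_scale_closure[of H2 "norm (g a)", OF H(8) H(10)[of a]] gnz
    by (simp_all add: sgn_div_norm)
  have "span {g a, velocity g a, h b, velocity h b} = UNIV"
    using tr g h a b unfolding transversal_at_def by metis
  moreover have "{g a, velocity g a, h b, velocity h b} \<subseteq> span {g a, velocity g a, \<sigma> *\<^sub>R velocity h b}"
  proof -
    have "h b = \<sigma> *\<^sub>R (k *\<^sub>R g a)" using hb[symmetric] \<sigma>(1) by auto
    moreover have "velocity h b = \<sigma> *\<^sub>R (\<sigma> *\<^sub>R velocity h b)" using \<sigma>(1) by auto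
    moreover have "\<sigma> *\<^sub>R (k *\<^sub>R g a) \<in> span {g a, velocity g a, \<sigma> *\<^sub>R velocity h b}"
      by (intro span_scale span_base) auto
    moreover have "\<sigma> *\<^sub>R (\<sigma> *\<^sub>R velocity h b) \<in> span {g a, velocity g a, \<sigma> *\<^sub>R velocity h b}"
      by (rule span_scale, rule span_base) auto
    ultimately show ?thesis by (auto intro: span_base)
  qed
  ultimately have sp: "span {g a, velocity g a, \<sigma> *\<^sub>R velocity h b} = UNIV"
    by (metis span_minimal subspace_span top.extremum_uniqueI)
  obtain G1 G2 d where G: "{G1, G2} = {H1, H2}" "d > 0"
    "\<And>t. b < t \<Longrightarrow> t < b + d \<Longrightarrow> \<sigma> *\<^sub>R h t \<in> G1" "\<And>t. b - d < t \<Longrightarrow> t < b \<Longrightarrow> \<sigma> *\<^sub>R h t \<in> G2"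
  proof (rule crossing[where h = "\<lambda>t. \<sigma> *\<^sub>R h t" and h' = "\<sigma> *\<^sub>R velocity h b" and b = b,
        OF H(7,8) H(1,2) H(5,6) cl gnz \<open>T > 0\<close> per _ param_deriv[OF g] param_cont_deriv[OF g] _ hb \<open>k > 0\<close> sp])
    show "((\<lambda>t. \<sigma> *\<^sub>R h t) has_vector_derivative \<sigma> *\<^sub>R velocity h b) (at b)"
      using param_deriv[OF h, of b] by (auto intro!: derivative_eq_intros)
    show "?c t \<noteq> ?c a" if "a < t" "t < a + T" for t using ne[OF that] by simp
  qed (use that in blast)+
  from G(1) consider "G1 = H1" "G2 = H2" | "G1 = H2" "G2 = H1" by (auto simp: doubleton_eq_iff)
  then show ?thesis
  proof cases
    case 1
    show ?thesis by (rule that[OF _ _ _ _ _ _ _ _ _ _ \<sigma> only G(2-4)]) (use H 1 in auto)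
  next
    case 2
    show ?thesis by (rule that[OF _ _ _ _ _ _ _ _ _ _ \<sigma> only G(2-4)]) (use H 2 in auto)
  qed
qed

section \<open>One-sidedness and antipodal sides\<close>

lemma connected_in_one:
  assumes "connected S" "open U" "open V" "U \<inter> V = {}" "S \<subseteq> U \<union> V" "x \<in> S" "x \<in> U"
  shows "S \<subseteq> U"
  using connectedD[of S U V] assms by blast

text \<open>
  Otherwise \<open>g\<close> would lift to a Jordan curve disjoint from its antipode, and the closed curve \<open>h\<close>
  would cross it exactly once.
\<close>

lemma pseudoline_antipodal:
  assumes g: "simple_closed_param g C" and h: "simple_closed_param h D"
    and CD: "C \<inter> D = {p}" and tr: "transversal_at C D p"
  shows "sgn (g (t + 1)) = - sgn (g t)"
proof (rule ccontr)
  assume "\<not> ?thesis"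
  then have gp: "sgn (g (t + 1)) = sgn (g t)" for t using param_sign[OF g] by blast
  let ?c = "\<lambda>t. sgn (g t)"
  obtain G1 G2 a b d \<sigma> where G: "open G1" "open G2" "G1 \<inter> G2 = {}"
    "G1 \<union> G2 = {x. x \<noteq> 0 \<and> sgn x \<notin> range ?c}" "\<And>x r. x \<in> G2 \<Longrightarrow> r > 0 \<Longrightarrow> r *\<^sub>R x \<in> G2"
    and \<sigma>: "\<sigma> = 1 \<or> \<sigma> = -1" "sgn (\<sigma> *\<^sub>R h b) = ?c a"
    and only: "\<And>s t. proj_pt (g s) = proj_pt (h t) \<Longrightarrow> s - a \<in> \<int> \<and> t - b \<in> \<int>"
    and d: "d > 0" "\<And>t. b < t \<Longrightarrow> t < b + d \<Longrightarrow> \<sigma> *\<^sub>R h t \<in> G1" "\<And>t. b - d < t \<Longrightarrow> t < b \<Longrightarrow> \<sigma> *\<^sub>R h t \<in> G2"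
    by (rule crossing_pair[OF g h CD tr, of 1]) (use gp in auto)
  \<comment> \<open>The period of the lift of \<open>h\<close>, for which both alternatives are
    still possible.\<close>
  obtain T :: real where T: "T = 1 \<and> (\<forall>t. sgn (h (t + 1)) = sgn (h t)) \<or> T = 2 \<and> (\<forall>t. sgn (h (t + 1)) = - sgn (h t))"
    using param_sign[OF h] by blast
  have hT: "sgn (h (t + T)) = sgn (h t)" for t
  proof (cases "T = 1")
    case False
    then have "T = 2" "\<And>t. sgn (h (t + 1)) = - sgn (h t)" using T by auto
    moreover have "t + 2 = (t + 1) + 1" by simp
    ultimately show ?thesis by (metis minus_minus)
  qed (use T in auto)
  have \<sigma>h: "\<sigma> *\<^sub>R h t \<noteq> 0" for t using \<sigma> param_nz[OF h] by auto
  \<comment> \<open>Within one period of \<open>h\<close> the only candidate for another hit is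
    \<open>b + 1\<close>, in the case \<open>T = 2\<close>. There \<open>h\<close> passes through
    the antipode of \<open>?c a\<close>, which is not on the lift of \<open>g\<close>, as that lift
    has period 1.\<close>
  have in_G: "\<sigma> *\<^sub>R h t \<in> G1 \<union> G2" if t: "b < t" "t < b + T" for t
  proof (rule ccontr)
    assume "\<sigma> *\<^sub>R h t \<notin> G1 \<union> G2"
    then have "sgn (\<sigma> *\<^sub>R h t) \<in> range ?c" using \<sigma>h[of t] unfolding G(4) by blast
    then obtain s where s: "sgn (\<sigma> *\<^sub>R h t) = ?c s" by blast
    have "proj_pt (g s) = proj_pt (h t)"
    proof -
      have "proj_pt (\<sigma> *\<^sub>R h t) = proj_pt (g s)"
        unfolding proj_pt_eq_iff[OF \<sigma>h param_nz[OF g]] using s by blast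
      moreover have "\<sigma> \<noteq> 0" using \<sigma>(1) by auto
      ultimately show ?thesis by (metis proj_pt_scale)
    qed
    then have sa: "s - a \<in> \<int>" and tb: "t - b \<in> \<int>" using only by auto
    obtain k where k: "t - b = of_int k" using tb by (auto elim: Ints_cases)
    have "of_int k > (0::real)" "of_int k < (2::real)" using k t T by auto
    then have "k = 1" by linarith
    then have t1: "t = b + 1" using k by simp
    then have "T = 2" using t T by auto
    then have "sgn (\<sigma> *\<^sub>R h t) = - sgn (\<sigma> *\<^sub>R h b)" using T t1 by (auto simp: sgn_scaleR)
    then have "?c s = - ?c a" using s \<sigma>(2) by simp
    obtain n where n: "s - a = of_int n" using sa by (auto elim: Ints_cases)
    have "?c (a + of_int n) = ?c a" using periodic_of_int[of ?c 1, OF gp] by simp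
    then have "?c s = ?c a" using n by (simp add: algebra_simps)
    then have "?c a = - ?c a" using \<open>?c s = - ?c a\<close> by metis
    then show False using param_nz[OF g, of a] unfolding eq_minus_self_iff by (simp add: sgn_zero_iff)
  qed
  have "T \<ge> 1" using T by auto
  define e where "e = min d 1 / 2"
  have e: "0 < e" "e < d" "e < T" using d(1) \<open>T \<ge> 1\<close> by (auto simp: e_def)
  \<comment> \<open>So \<open>h\<close>, having left the curve into \<open>G1\<close>, stays there
    until it returns at \<open>b + T\<close>; but by periodicity it arrives through
    \<open>G2\<close>.\<close>
  have "(\<lambda>t. \<sigma> *\<^sub>R h t) ` {b<..<b+T} \<subseteq> G1"
  proof (rule connected_in_one[OF _ G(1-3)])
    show "connected ((\<lambda>t. \<sigma> *\<^sub>R h t) ` {b<..<b+T})"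
      by (intro connected_continuous_image continuous_intros param_cont[OF h]) auto
    show "(\<lambda>t. \<sigma> *\<^sub>R h t) ` {b<..<b+T} \<subseteq> G1 \<union> G2"
      unfolding image_subset_iff using in_G by (metis greaterThanLessThan_iff)
    show "\<sigma> *\<^sub>R h (b + e) \<in> G1" using d(2) e by auto
  qed (use e in auto)
  then have "\<sigma> *\<^sub>R h (b + T - e) \<in> G1" using e by (simp add: image_subset_iff)
  moreover have "\<sigma> *\<^sub>R h (b + T - e) \<in> G2"
  proof -
    have "sgn (h (b - e + T)) = sgn (h (b - e))" by (rule hT)
    then have eq: "sgn (\<sigma> *\<^sub>R h (b + T - e)) = sgn (\<sigma> *\<^sub>R h (b - e))" by (simp add: sgn_scaleR algebra_simps)
    have "\<sigma> *\<^sub>R h (b - e) \<in> G2" using d(3) e by simp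
    then show ?thesis using cone_sgn[of G2, OF G(5) _ eq \<sigma>h] by blast
  qed
  ultimately show False using G(3) by blast
qed

text \<open>The antipodal map preserves the lift of \<open>g\<close>, hence permutes its two sides.
  It exchanges them: \<open>h\<close> is in \<open>G2\<close> all the way from \<open>b - 1\<close>
  to \<open>b\<close> and in \<open>G1\<close> right after \<open>b\<close>, while the directions of
  \<open>h\<close> just after \<open>b - 1\<close> and just after \<open>b\<close> are
  antipodal.\<close>

lemma pseudoline_side:
  assumes g: "simple_closed_param g C" and h: "simple_closed_param h D"
    and CD: "C \<inter> D = {p}" and tr: "transversal_at C D p"
    and ga: "\<And>t. sgn (g (t + 1)) = - sgn (g t)" and ha: "\<And>t. sgn (h (t + 1)) = - sgn (h t)"
  shows "\<exists>H. open H \<and> (\<forall>x\<in>H. \<forall>r>0. r *\<^sub>R x \<in> H) \<and> (\<forall>x\<in>H. - x \<notin> H) \<and>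
    (\<forall>x. x \<noteq> 0 \<longrightarrow> (x \<in> H \<or> - x \<in> H \<longleftrightarrow> sgn x \<notin> range (\<lambda>t. sgn (g t)))) \<and>
    (\<forall>t. sgn (g t) \<in> closure H)"
proof -
  let ?c = "\<lambda>t. sgn (g t)"
  obtain G1 G2 a b d \<sigma> where G: "open G1" "open G2" "connected G1" "connected G2" "G1 \<inter> G2 = {}"
    "G1 \<union> G2 = {x. x \<noteq> 0 \<and> sgn x \<notin> range ?c}"
    "\<And>x r. x \<in> G1 \<Longrightarrow> r > 0 \<Longrightarrow> r *\<^sub>R x \<in> G1" "\<And>x r. x \<in> G2 \<Longrightarrow> r > 0 \<Longrightarrow> r *\<^sub>R x \<in> G2"
    "\<And>t. ?c t \<in> closure G1" "\<And>t. ?c t \<in> closure G2"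
    and \<sigma>: "\<sigma> = 1 \<or> \<sigma> = -1" "sgn (\<sigma> *\<^sub>R h b) = ?c a"
    and only: "\<And>s t. proj_pt (g s) = proj_pt (h t) \<Longrightarrow> s - a \<in> \<int> \<and> t - b \<in> \<int>"
    and d: "d > 0" "\<And>t. b < t \<Longrightarrow> t < b + d \<Longrightarrow> \<sigma> *\<^sub>R h t \<in> G1" "\<And>t. b - d < t \<Longrightarrow> t < b \<Longrightarrow> \<sigma> *\<^sub>R h t \<in> G2"
    by (rule crossing_pair[OF g h CD tr, of 2]) (use ga in auto)
  have \<sigma>h: "\<sigma> *\<^sub>R h t \<noteq> 0" for t using \<sigma> param_nz[OF h] by auto
  have in_G: "\<sigma> *\<^sub>R h t \<in> G1 \<union> G2" if t: "b - 1 < t" "t < b" for t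
  proof (rule ccontr)
    assume "\<sigma> *\<^sub>R h t \<notin> G1 \<union> G2"
    then have "sgn (\<sigma> *\<^sub>R h t) \<in> range ?c" using \<sigma>h[of t] unfolding G(6) by blast
    then obtain s where s: "sgn (\<sigma> *\<^sub>R h t) = ?c s" by blast
    have "proj_pt (g s) = proj_pt (h t)"
    proof -
      have "proj_pt (\<sigma> *\<^sub>R h t) = proj_pt (g s)"
        unfolding proj_pt_eq_iff[OF \<sigma>h param_nz[OF g]] using s by blast
      moreover have "\<sigma> \<noteq> 0" using \<sigma>(1) by auto
      ultimately show ?thesis by (metis proj_pt_scale)
    qed
    then obtain k where k: "t - b = of_int k" using only by (metis Ints_cases)
    have "real_of_int k < real_of_int 0" "real_of_int (-1) < real_of_int k" using k t by auto
    then have "k < 0" "-1 < k" by (simp_all only: of_int_less_iff)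
    then show False by simp
  qed
  define e where "e = min d 1 / 2"
  have e: "0 < e" "e < d" "e < 1" using d(1) by (auto simp: e_def)
  have "(\<lambda>t. \<sigma> *\<^sub>R h t) ` {b-1<..<b} \<subseteq> G2"
  proof (rule connected_in_one[OF _ G(2,1)])
    show "connected ((\<lambda>t. \<sigma> *\<^sub>R h t) ` {b-1<..<b})"
      by (intro connected_continuous_image continuous_intros param_cont[OF h]) auto
    show "(\<lambda>t. \<sigma> *\<^sub>R h t) ` {b-1<..<b} \<subseteq> G2 \<union> G1"
      unfolding image_subset_iff using in_G by (metis greaterThanLessThan_iff sup_commute)
    show "\<sigma> *\<^sub>R h (b - e) \<in> G2" using d(3) e by auto
  qed (use e G(5) in auto)
  then have y2: "\<sigma> *\<^sub>R h (b - (1 - e)) \<in> G2" using e by (simp add: image_subset_iff)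
  define y where "y = \<sigma> *\<^sub>R h (b + e)"
  have y1: "y \<in> G1" using d(2) e by (auto simp: y_def)
  have "sgn (h (b - (1 - e) + 1)) = - sgn (h (b - (1 - e)))" by (rule ha)
  then have eq: "sgn (- y) = sgn (\<sigma> *\<^sub>R h (b - (1 - e)))" by (simp add: y_def sgn_scaleR sgn_minus algebra_simps)
  have "- y \<noteq> 0" using \<sigma>h by (simp add: y_def)
  then have my: "- y \<in> G2" using cone_sgn[of G2, OF G(8) y2 eq] by blast
  have sym: "- v \<in> G1 \<union> G2" if "v \<in> G1 \<union> G2" for v
  proof -
    have "sgn (- v) \<noteq> ?c t" for t
    proof
      assume "sgn (- v) = ?c t"
      then have "sgn v = ?c (t + 1)" using ga[of t] by (metis minus_minus sgn_minus)
      then show False using that G(6) by blast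
    qed
    moreover have "- v \<noteq> 0" using that G(6) by auto
    ultimately show ?thesis unfolding G(6) by auto
  qed
  have s1: "uminus ` G1 \<subseteq> G2"
  proof (rule connected_in_one[OF _ G(2,1)])
    show "connected (uminus ` G1)" using G(3) by (rule connected_continuous_image[rotated]) (intro continuous_intros)
    show "uminus ` G1 \<subseteq> G2 \<union> G1" using sym by blast
    show "- y \<in> uminus ` G1" using y1 by blast
  qed (use G my in auto)
  have s2: "uminus ` G2 \<subseteq> G1"
  proof (rule connected_in_one[OF _ G(1,2)])
    show "connected (uminus ` G2)" using G(4) by (rule connected_continuous_image[rotated]) (intro continuous_intros)
    show "uminus ` G2 \<subseteq> G1 \<union> G2" using sym by blast
    show "y \<in> uminus ` G2" using my by (simp add: mem_uminus_image)
  qed (use G y1 in auto)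
  have G2: "x \<in> G2 \<longleftrightarrow> - x \<in> G1" for x
    using s1 s2 by (metis imageI minus_minus subsetD)
  show ?thesis
  proof (intro exI[of _ G1] conjI ballI allI impI)
    show "- x \<notin> G1" if "x \<in> G1" for x using that G2 G(5) by blast
    show "x \<in> G1 \<or> - x \<in> G1 \<longleftrightarrow> sgn x \<notin> range ?c" if "x \<noteq> 0" for x
      using that G(6) G2 by blast
  qed (use G in auto)
qed

lemma Ints_in_unit: "s \<in> {0..<1::real} \<Longrightarrow> t \<in> {0..<1} \<Longrightarrow> s - t \<in> \<int> \<Longrightarrow> s = t"
proof -
  assume st: "s \<in> {0..<1}" "t \<in> {0..<1}" "s - t \<in> \<int>"
  then obtain k where k: "s - t = of_int k" by (auto elim: Ints_cases)
  then have "of_int k < (1::real)" "of_int k > (-1::real)" using st by auto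
  then have "k = 0" by linarith
  then show ?thesis using k by simp
qed

text \<open>Each curve needs one partner, which the bound on \<open>card A\<close> supplies: the
  crossing with it yields both antiperiodicity and a side.\<close>

theorem arrangement_pseudocircles:
  assumes A: "pseudoline_arrangement A"
  obtains c H where "pseudocircles A c H"
    "\<And>C v. C \<in> A \<Longrightarrow> v \<in> C \<longleftrightarrow> (\<exists>t. v = proj_pt (c C t))"
    "\<And>C s t. C \<in> A \<Longrightarrow> proj_pt (c C s) = proj_pt (c C t) \<longleftrightarrow> s - t \<in> \<int>"
proof -
  have fin: "finite A" and A3: "card A \<ge> 3"
    and pair: "\<And>C D. C \<in> A \<Longrightarrow> D \<in> A \<Longrightarrow> C \<noteq> D \<Longrightarrow> \<exists>p. C \<inter> D = {p} \<and> transversal_at C D p"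
    and "\<forall>C\<in>A. \<exists>g. simple_closed_param g C"
    using A unfolding pseudoline_arrangement_def smooth_simple_closed_curve_def by blast+
  then obtain g where g: "\<And>C. C \<in> A \<Longrightarrow> simple_closed_param (g C) C" by metis
  define c where "c = (\<lambda>C t. sgn (g C t))"
  have other: "\<exists>D\<in>A. D \<noteq> C" for C
  proof (rule ccontr)
    assume "\<not> ?thesis"
    then have "A \<subseteq> {C}" by blast
    then show False using card_mono[of "{C}" A] A3 by simp
  qed
  have anti: "c C (t + 1) = - c C t" if C: "C \<in> A" for C t
  proof -
    obtain D p where "D \<in> A" "C \<inter> D = {p}" "transversal_at C D p" using other[of C] pair C by metis
    then show ?thesis unfolding c_def using pseudoline_antipodal[OF g[OF C] g] by blast
  qed
  define side where "side = (\<lambda>C H. open H \<and> (\<forall>x\<in>H. \<forall>r>0. r *\<^sub>R x \<in> H) \<and> (\<forall>x\<in>H. - x \<notin> H) \<and>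
    (\<forall>x. x \<noteq> 0 \<longrightarrow> (x \<in> H \<or> - x \<in> H \<longleftrightarrow> sgn x \<notin> range (c C))) \<and> (\<forall>t. c C t \<in> closure H))"
  have "\<exists>H. side C H" if C: "C \<in> A" for C
  proof -
    obtain D p where D: "D \<in> A" "C \<inter> D = {p}" "transversal_at C D p" using other[of C] pair C by metis
    show ?thesis unfolding side_def
      using pseudoline_side[OF g[OF C] g[OF D(1)] D(2,3) anti[OF C, unfolded c_def] anti[OF D(1), unfolded c_def]]
      unfolding c_def .
  qed
  then obtain H where H: "\<And>C. C \<in> A \<Longrightarrow> side C (H C)" by metis
  have nz: "g C t \<noteq> 0" if "C \<in> A" for C t using param_nz[OF g[OF that]] .
  have proj: "proj_pt (c C t) = proj_pt (g C t)" for C t by (simp add: c_def proj_pt_sgn)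
  have rng: "v \<in> C \<longleftrightarrow> (\<exists>t. v = proj_pt (c C t))" if "C \<in> A" for C v
    using param_range[OF g[OF that], of v] by (simp only: proj)
  have peq: "proj_pt (c C s) = proj_pt (c C t) \<longleftrightarrow> s - t \<in> \<int>" if "C \<in> A" for C s t
    using param_proj_eq[OF g[OF that]] by (simp add: proj)
  have pp: "proj_pt (c C s) = proj_pt (c D t) \<longleftrightarrow> c C s = c D t \<or> c C s = - c D t" if "C \<in> A" "D \<in> A" for C D s t
    unfolding c_def proj_pt_sgn using proj_pt_eq_iff[OF nz[OF that(1)] nz[OF that(2)]] .
  have "pseudocircles A c H"
  proof
    show "finite A" by fact
  next
    fix C D assume C: "C \<in> A" and D: "D \<in> A" "C \<noteq> D"
    obtain p where p: "C \<inter> D = {p}" using pair[OF C D] by blast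
    have "p \<in> C" "p \<in> D" using p by auto
    then obtain t b where t: "p = proj_pt (c C t)" and b: "p = proj_pt (c D b)"
      using rng[OF C] rng[OF D(1)] by metis
    have "c C u \<in> range (c D) \<longleftrightarrow> u - t \<in> \<int>" for u
    proof
      assume "c C u \<in> range (c D)"
      then have "proj_pt (c C u) \<in> D" using rng[OF D(1)] by (metis imageE)
      moreover have "proj_pt (c C u) \<in> C" using rng[OF C] by auto
      ultimately have "proj_pt (c C u) = p" using p by blast
      then show "u - t \<in> \<int>" using peq[OF C] t by metis
    next
      assume "u - t \<in> \<int>"
      then have "proj_pt (c C u) = proj_pt (c D b)" using peq[OF C] t b by metis
      then have "c C u = c D b \<or> c C u = - c D b" using pp[OF C D(1)] by blast
      \<comment> \<open>\<open>range (c D)\<close> is symmetric under negation and so contains both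
        lifts of every point of \<open>D\<close>; equality in the projective plane is therefore
        enough.\<close>
      then show "c C u \<in> range (c D)" using anti[OF D(1), of b] by (metis rangeI)
    qed
    then show "\<exists>t. \<forall>u. c C u \<in> range (c D) \<longleftrightarrow> u - t \<in> \<int>" by blast
  next
    fix C t u assume C: "C \<in> A" and eq: "c C t = c C u"
    have "u - t \<in> \<int>" using peq[OF C, of u t] eq by simp
    then obtain k where k: "u - t = of_int k" by (auto elim: Ints_cases)
    have "c C (t + of_int k) = (if even k then c C t else - c C t)"
      by (rule antiperiodic_of_int[of "c C", OF anti[OF C]])
    moreover have "u = t + of_int k" using k by simp
    ultimately have cu: "c C u = (if even k then c C t else - c C t)" by simp
    have "c C t \<noteq> 0" using nz[OF C] by (auto simp: c_def sgn_zero_iff)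
    then have "even k" using cu eq eq_minus_self_iff by metis
    then obtain m where "k = 2 * m" by blast
    then have "u = t + 2 * of_int m" using k by simp
    then show "\<exists>k::int. u = t + 2 * of_int k" by blast
  next
    fix C assume C: "C \<in> A"
    show "continuous_on UNIV (c C)" unfolding c_def by (rule param_sgn_cont[OF g[OF C]])
    show "norm (c C t) = 1" for t using nz[OF C] by (simp add: c_def norm_sgn)
  qed (use H anti in \<open>auto simp: side_def\<close>)
  then show ?thesis using that rng peq by blast
qed

theorem Melchior_pseudolines:
  assumes A: "pseudoline_arrangement A"
  shows "finite {v \<in> RP2. weight A v \<ge> 2}"
    and "(\<Sum>v | v \<in> RP2 \<and> weight A v \<ge> 2. 3 - int (weight A v)) \<ge> 3"
proof -
  obtain c H where "pseudocircles A c H" and rng: "\<And>C v. C \<in> A \<Longrightarrow> v \<in> C \<longleftrightarrow> (\<exists>t. v = proj_pt (c C t))"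
    and peq: "\<And>C s t. C \<in> A \<Longrightarrow> proj_pt (c C s) = proj_pt (c C t) \<longleftrightarrow> s - t \<in> \<int>"
    using arrangement_pseudocircles[OF A] by blast
  then interpret pseudocircles A c H by simp
  have A3: "card A \<ge> 3" and nc: "\<not> (\<exists>p. \<forall>C\<in>A. p \<in> C)"
    using A by (simp_all add: pseudoline_arrangement_def)
  have pair: "\<exists>p. C \<inter> D = {p}" if "C \<in> A" "D \<in> A" "C \<noteq> D" for C D
    using A that unfolding pseudoline_arrangement_def by meson
  define P where "P = {v \<in> RP2. weight A v \<ge> 2}"
  have w: "weight A v = card {C \<in> A. v \<in> C}" for v by (simp add: weight_def lines_through_def)
  have w2: "weight A v \<ge> 2" if "C \<in> A" "D \<in> A" "C \<noteq> D" "v \<in> C" "v \<in> D" for C D v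
  proof -
    have "card {C, D} \<le> card {C \<in> A. v \<in> C}" using fin that by (intro card_mono) auto
    then show ?thesis using that by (simp add: w)
  qed
  have RP: "v \<in> RP2" if "C \<in> A" "v \<in> C" for C v
    using rng[OF that(1), of v] that(2) proj_pt_RP2 c_nz[OF that(1)] by metis
  have "P \<subseteq> (\<Union>C\<in>A. \<Union>D\<in>A - {C}. C \<inter> D)"
  proof
    fix v assume "v \<in> P"
    then have v: "card {C \<in> A. v \<in> C} \<ge> 2" by (simp add: P_def w)
    then have "\<not> (\<forall>x\<in>{C \<in> A. v \<in> C}. \<forall>y\<in>{C \<in> A. v \<in> C}. x = y)"
      using card_le_Suc0_iff_eq[of "{C \<in> A. v \<in> C}"] fin by auto
    then show "v \<in> (\<Union>C\<in>A. \<Union>D\<in>A - {C}. C \<inter> D)" by blast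
  qed
  moreover have "finite (\<Union>C\<in>A. \<Union>D\<in>A - {C}. C \<inter> D)"
  proof (intro finite_UN_I finite_Diff fin)
    fix C D assume "C \<in> A" "D \<in> A - {C}"
    then obtain p where "C \<inter> D = {p}" using pair[of C D] by blast
    then show "finite (C \<inter> D)" by simp
  qed
  ultimately have finP: "finite P" using finite_subset by blast
  then show "finite {v \<in> RP2. weight A v \<ge> 2}" by (simp add: P_def)
  have "(\<Sum>v\<in>P. 3 - int (card {C\<in>A. v \<in> C})) \<ge> 3"
  proof (rule Melchior[where L = "\<lambda>C. C", OF finP])
    show "card {C\<in>A. v \<in> C} \<ge> 2" if "v \<in> P" for v using that by (simp add: P_def w)
    show "card A \<ge> 2" using A3 by simp
    show "\<nexists>t. \<forall>D\<in>A. c C t \<in> range (c D)" if C: "C \<in> A" for C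
    proof
      assume "\<exists>t. \<forall>D\<in>A. c C t \<in> range (c D)"
      then obtain t where t: "\<And>D. D \<in> A \<Longrightarrow> c C t \<in> range (c D)" by blast
      have "proj_pt (c C t) \<in> D" if "D \<in> A" for D using t[OF that] rng[OF that] by (metis imageE)
      then show False using nc by blast
    qed
    fix C J assume C: "C \<in> A" and J: "J \<subseteq> A" "C \<notin> J"
    \<comment> \<open>The projective curve has period 1 and is injective on \<open>[0, 1)\<close>,
      so crossing parameters correspond to vertices. This is the condition on crossings in
      \<open>Melchior\<close>, with each curve as its own \<open>L\<close>.\<close>
    have "bij_betw (\<lambda>t. proj_pt (c C t)) (crossings C J) {v \<in> P. v \<in> C \<and> (\<exists>D\<in>J. v \<in> D)}"
      unfolding bij_betw_def
    proof
      show "inj_on (\<lambda>t. proj_pt (c C t)) (crossings C J)"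
      proof (rule inj_onI)
        fix s t assume "s \<in> crossings C J" "t \<in> crossings C J" "proj_pt (c C s) = proj_pt (c C t)"
        then show "s = t" using peq[OF C] by (intro Ints_in_unit) (auto simp: crossings_def)
      qed
      show "(\<lambda>t. proj_pt (c C t)) ` crossings C J = {v \<in> P. v \<in> C \<and> (\<exists>D\<in>J. v \<in> D)}"
      proof (intro equalityI subsetI)
        fix v assume "v \<in> (\<lambda>t. proj_pt (c C t)) ` crossings C J"
        then obtain t D where t: "v = proj_pt (c C t)" "D \<in> J" "c C t \<in> range (c D)" by (auto simp: crossings_def)
        have "v \<in> C" using rng[OF C] t(1) by blast
        moreover have "v \<in> D" using rng[of D v] t J by (metis imageE subsetD)
        ultimately show "v \<in> {v \<in> P. v \<in> C \<and> (\<exists>D\<in>J. v \<in> D)}"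
          using t(2) w2[of C D v] RP[OF C] C J by (auto simp: P_def)
      next
        fix v assume v: "v \<in> {v \<in> P. v \<in> C \<and> (\<exists>D\<in>J. v \<in> D)}"
        then obtain t where t: "v = proj_pt (c C t)" using rng[OF C] by blast
        have "proj_pt (c C (frac t)) = proj_pt (c C t)" unfolding peq[OF C] by (simp add: frac_def)
        then have t': "v = proj_pt (c C (frac t))" using t by simp
        obtain D where D: "D \<in> J" "v \<in> D" using v by blast
        then have "D \<in> A" using J by blast
        then obtain u where u: "v = proj_pt (c D u)" using rng D by blast
        have "sgn (c C (frac t)) = sgn (c D u) \<or> sgn (c C (frac t)) = - sgn (c D u)"
          using proj_pt_eq_iff[OF c_nz[OF C] c_nz[OF \<open>D \<in> A\<close>]] t' u by metis
        then have "c C (frac t) \<in> range (c D)"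
          using sgn_c[OF C] sgn_c[OF \<open>D \<in> A\<close>] anti[OF \<open>D \<in> A\<close>, of u] by (metis rangeI)
        then have "frac t \<in> crossings C J" using D by (auto simp: crossings_def frac_lt_1)
        then show "v \<in> (\<lambda>t. proj_pt (c C t)) ` crossings C J" using t' by blast
      qed
    qed
    then show "card (crossings C J) = card {v \<in> P. v \<in> C \<and> (\<exists>D\<in>J. v \<in> D)}" by (rule bij_betw_same_card)
  qed
  then show "(\<Sum>v | v \<in> RP2 \<and> weight A v \<ge> 2. 3 - int (weight A v)) \<ge> 3" by (simp add: P_def w)
qed

section \<open>The characteristic polynomial\<close>

definition vertices :: "(real^3) set set set \<Rightarrow> (real^3) set set" where
  "vertices A = {v \<in> RP2. weight A v \<ge> 2}"

context
  fixes A assumes A: "pseudoline_arrangement A"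
begin

lemma finite_vertices: "finite (vertices A)"
  using Melchior_pseudolines(1)[OF A] by (simp add: vertices_def)

lemma Melchior_vertices: "(\<Sum>v\<in>vertices A. 3 - int (weight A v)) \<ge> 3"
  using Melchior_pseudolines(2)[OF A] by (simp add: vertices_def)

lemma arrangement_finite: "finite A"
  using A by (simp add: pseudoline_arrangement_def)

lemma lines_through_subset: "lines_through A v \<subseteq> A"
  by (auto simp: lines_through_def)

lemma finite_lines_through: "finite (lines_through A v)"
  using lines_through_subset arrangement_finite finite_subset by blast

lemma common_point: "C \<in> A \<Longrightarrow> D \<in> A \<Longrightarrow> C \<noteq> D \<Longrightarrow> \<exists>p. C \<inter> D = {p}"
  using A unfolding pseudoline_arrangement_def by meson

lemma point_in_RP2:
  assumes "C \<in> A" "v \<in> C"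
  shows "v \<in> RP2"
proof -
  obtain g where g: "simple_closed_param g C"
    using A assms unfolding pseudoline_arrangement_def smooth_simple_closed_curve_def by meson
  then show ?thesis using param_range[OF g, of v] assms param_nz[OF g] proj_pt_RP2 by metis
qed

lemma two_lines:
  assumes "v \<in> vertices A"
  obtains C D where "C \<in> A" "D \<in> A" "C \<noteq> D" "v \<in> C" "v \<in> D"
proof -
  have "card (lines_through A v) \<ge> 2" using assms by (simp add: vertices_def weight_def)
  then have "\<not> (\<forall>x\<in>lines_through A v. \<forall>y\<in>lines_through A v. x = y)"
    using card_le_Suc0_iff_eq[OF finite_lines_through, of v] by auto
  then show ?thesis using that by (auto simp: lines_through_def)
qed

lemma vertexI:
  assumes "C \<in> A" "D \<in> A" "C \<noteq> D" "v \<in> C" "v \<in> D"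
  shows "v \<in> vertices A"
proof -
  have "card {C, D} \<le> card (lines_through A v)"
    using assms by (intro card_mono finite_lines_through) (auto simp: lines_through_def)
  then show ?thesis using assms point_in_RP2 by (auto simp: vertices_def weight_def)
qed

text \<open>Two of the curves through \<open>v\<close> already determine \<open>v\<close>. In the
  lattice this makes distinct elements of rank 2 incomparable, so below one of them there are only
  the empty set and singletons.\<close>

lemma lines_through_mono_eq:
  assumes "v \<in> vertices A" "lines_through A v \<subseteq> lines_through A w"
  shows "v = w"
proof -
  obtain C D where CD: "C \<in> A" "D \<in> A" "C \<noteq> D" "v \<in> C" "v \<in> D" using two_lines[OF assms(1)] .
  then have "w \<in> C" "w \<in> D" using assms(2) by (auto simp: lines_through_def)
  then show ?thesis using common_point[OF CD(1-3)] CD by auto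
qed

lemma inj_lines_through: "inj_on (lines_through A) (vertices A)"
  by (rule inj_onI) (metis lines_through_mono_eq order_refl)

lemma lines_through_ne: "lines_through A v \<noteq> A"
  using A unfolding pseudoline_arrangement_def lines_through_def by blast

lemma lattice_eq: "intersection_lattice A =
    insert {} (insert A ((\<lambda>C. {C}) ` A \<union> lines_through A ` vertices A))"
  by (auto simp: intersection_lattice_def vertices_def)

section \<open>Moebius function and characteristic polynomial\<close>

lemma moebius_rec:
  assumes "finite Y" "{} \<noteq> Y"
  shows "poset_moebius L {} Y = - (\<Sum>Z\<in>{Z\<in>L. Z \<subset> Y}. poset_moebius L {} Z)"
  using assms by (subst poset_moebius.simps) auto

abbreviation "\<mu> \<equiv> poset_moebius (intersection_lattice A) {}"

lemma moebius_empty: "\<mu> {} = 1"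
  by (simp add: poset_moebius.simps)

lemma card_lines_through: "v \<in> vertices A \<Longrightarrow> card (lines_through A v) \<ge> 2"
  by (simp add: vertices_def weight_def)

lemma card_A: "card A \<ge> 3"
  using A by (simp add: pseudoline_arrangement_def)

lemma moebius_singleton:
  assumes "C \<in> A"
  shows "\<mu> {C} = - 1"
proof -
  have "{Z \<in> intersection_lattice A. Z \<subset> {C}} = {{}}"
    by (auto simp: lattice_eq)
  then show ?thesis by (subst moebius_rec) (simp_all add: moebius_empty)
qed

text \<open>Below this element are the empty set, contributing 1, and \<open>weight A v\<close>
  singletons, contributing -1 each; the value is minus their sum.\<close>

lemma moebius_vertex:
  assumes v: "v \<in> vertices A"
  shows "\<mu> (lines_through A v) = int (weight A v) - 1"
proof -
  let ?l = "lines_through A v"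
  have "?l \<noteq> {}" using card_lines_through[OF v] by auto
  have "card {C} \<noteq> card ?l" for C :: "(real^3) set set" using card_lines_through[OF v] by simp
  then have ns: "{C} \<noteq> ?l" for C by metis
  have eq: "{Z \<in> intersection_lattice A. Z \<subset> ?l} = insert {} ((\<lambda>C. {C}) ` ?l)"
  proof (intro equalityI subsetI)
    fix Z assume Z: "Z \<in> {Z \<in> intersection_lattice A. Z \<subset> ?l}"
    have "Z \<noteq> A" using Z lines_through_subset[of v] by auto
    moreover have "Z \<notin> lines_through A ` vertices A" using Z lines_through_mono_eq by blast
    ultimately consider "Z = {}" | C where "Z = {C}" using Z by (auto simp: lattice_eq)
    then show "Z \<in> insert {} ((\<lambda>C. {C}) ` ?l)" using Z by cases auto
  next
    fix Z assume "Z \<in> insert {} ((\<lambda>C. {C}) ` ?l)"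
    then show "Z \<in> {Z \<in> intersection_lattice A. Z \<subset> ?l}"
      using \<open>?l \<noteq> {}\<close> ns lines_through_subset[of v] by (auto simp: lattice_eq)
  qed
  have "\<mu> ?l = - (\<Sum>Z\<in>insert {} ((\<lambda>C. {C}) ` ?l). \<mu> Z)"
    unfolding eq[symmetric] using finite_lines_through \<open>?l \<noteq> {}\<close> by (intro moebius_rec) auto
  also have "(\<Sum>Z\<in>insert {} ((\<lambda>C. {C}) ` ?l). \<mu> Z) = 1 + (\<Sum>Z\<in>(\<lambda>C. {C}) ` ?l. \<mu> Z)"
    using finite_lines_through by (subst sum.insert) (auto simp: moebius_empty)
  also have "(\<Sum>Z\<in>(\<lambda>C. {C}) ` ?l. \<mu> Z) = (\<Sum>C\<in>?l. \<mu> {C})"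
    by (subst sum.reindex) auto
  also have "\<dots> = (\<Sum>C\<in>?l. - 1)"
    using lines_through_subset[of v] by (intro sum.cong) (auto simp: moebius_singleton)
  finally show ?thesis by (simp add: weight_def)
qed

lemma sum_proper_lattice:
  "(\<Sum>Z\<in>insert {} ((\<lambda>C. {C}) ` A \<union> lines_through A ` vertices A). f Z)
   = f {} + (\<Sum>C\<in>A. f {C}) + (\<Sum>v\<in>vertices A. f (lines_through A v))" for f :: "_ \<Rightarrow> 'b::comm_monoid_add"
proof -
  have c2: "card X \<ge> 2" if "X \<in> lines_through A ` vertices A" for X
    using that card_lines_through by blast
  have d: "(\<lambda>C. {C}) ` A \<inter> lines_through A ` vertices A = {}"
  proof -
    have "{C} \<notin> lines_through A ` vertices A" for C using c2[of "{C}"] by auto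
    then show ?thesis by blast
  qed
  have e: "{} \<notin> (\<lambda>C. {C}) ` A \<union> lines_through A ` vertices A"
    using c2[of "{}"] by auto
  have "(\<Sum>Z\<in>insert {} ((\<lambda>C. {C}) ` A \<union> lines_through A ` vertices A). f Z)
      = f {} + ((\<Sum>Z\<in>(\<lambda>C. {C}) ` A. f Z) + (\<Sum>Z\<in>lines_through A ` vertices A. f Z))"
  proof -
    have fin: "finite ((\<lambda>C. {C}) ` A)" "finite (lines_through A ` vertices A)"
      using arrangement_finite finite_vertices by simp_all
    show ?thesis
      unfolding sum.insert[OF finite_UnI[OF fin] e] sum.union_disjoint[OF fin d] ..
  qed
  also have "(\<Sum>Z\<in>(\<lambda>C. {C}) ` A. f Z) = (\<Sum>C\<in>A. f {C})" by (subst sum.reindex) auto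
  also have "(\<Sum>Z\<in>lines_through A ` vertices A. f Z) = (\<Sum>v\<in>vertices A. f (lines_through A v))"
    using inj_lines_through by (subst sum.reindex) auto
  finally show ?thesis by (simp add: add.assoc)
qed

text \<open>The sum of the Moebius values in rank 2, hence the linear coefficient of the
  characteristic polynomial.\<close>

definition b2 :: int where "b2 = (\<Sum>v\<in>vertices A. int (weight A v) - 1)"

lemma moebius_top: "\<mu> A = - (1 - int (card A) + b2)"
proof -
  have "A \<noteq> {}" using card_A by auto
  have nA: "{C} \<noteq> A" for C using card_A by auto
  have eq: "{Z \<in> intersection_lattice A. Z \<subset> A} = insert {} ((\<lambda>C. {C}) ` A \<union> lines_through A ` vertices A)"
  proof (intro equalityI subsetI)
    fix Z assume "Z \<in> {Z \<in> intersection_lattice A. Z \<subset> A}"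
    then show "Z \<in> insert {} ((\<lambda>C. {C}) ` A \<union> lines_through A ` vertices A)"
      unfolding lattice_eq by blast
  next
    fix Z assume Z: "Z \<in> insert {} ((\<lambda>C. {C}) ` A \<union> lines_through A ` vertices A)"
    then have "Z \<subseteq> A" using lines_through_subset by blast
    moreover have "Z \<noteq> A" using Z \<open>A \<noteq> {}\<close> nA lines_through_ne by blast
    ultimately show "Z \<in> {Z \<in> intersection_lattice A. Z \<subset> A}"
      using Z unfolding lattice_eq by blast
  qed
  have "\<mu> A = - (\<Sum>Z\<in>insert {} ((\<lambda>C. {C}) ` A \<union> lines_through A ` vertices A). \<mu> Z)"
    unfolding eq[symmetric] using arrangement_finite \<open>A \<noteq> {}\<close> by (intro moebius_rec) auto
  then show ?thesis
    unfolding sum_proper_lattice by (simp add: moebius_empty moebius_singleton moebius_vertex b2_def)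
qed

lemma characteristic_poly_eq:
  "characteristic_poly A = [:- (1 - int (card A) + b2), b2, - int (card A), 1:]"
proof -
  have "A \<noteq> {}" using card_A by auto
  have nA: "{C} \<noteq> A" for C using card_A by auto
  have notin: "A \<notin> insert {} ((\<lambda>C. {C}) ` A \<union> lines_through A ` vertices A)"
    using \<open>A \<noteq> {}\<close> nA lines_through_ne by blast
  have rk: "lattice_rank A {} = 0" "\<And>C. lattice_rank A {C} = 1" "lattice_rank A A = 3"
    using \<open>A \<noteq> {}\<close> nA by (auto simp: lattice_rank_def is_singleton_def)
  have rkv: "lattice_rank A (lines_through A v) = 2" if "v \<in> vertices A" for v
    using card_lines_through[OF that] lines_through_ne[of v]
    by (auto simp: lattice_rank_def is_singleton_def)
  have "characteristic_poly A = (\<Sum>X\<in>insert A (insert {} ((\<lambda>C. {C}) ` A \<union> lines_through A ` vertices A)).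
      monom (\<mu> X) (3 - lattice_rank A X))"
    by (simp add: characteristic_poly_def lattice_eq insert_commute)
  also have "\<dots> = monom (\<mu> A) 0 + (monom 1 3 + (\<Sum>C\<in>A. monom (\<mu> {C}) 2)
      + (\<Sum>v\<in>vertices A. monom (\<mu> (lines_through A v)) 1))"
  proof (subst sum.insert[OF _ notin])
    show "finite (insert {} ((\<lambda>C. {C}) ` A \<union> lines_through A ` vertices A))"
      using arrangement_finite finite_vertices by simp
  qed (simp add: sum_proper_lattice rk rkv moebius_empty)
  also have "(\<Sum>C\<in>A. monom (\<mu> {C}) 2) = monom (- int (card A)) 2"
  proof -
    have "(\<Sum>C\<in>A. monom (\<mu> {C}) 2) = monom (\<Sum>C\<in>A. - 1) 2"
      unfolding monom_sum by (intro sum.cong) (simp_all add: moebius_singleton)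
    then show ?thesis by simp
  qed
  also have "(\<Sum>v\<in>vertices A. monom (\<mu> (lines_through A v)) 1) = monom b2 1"
    by (simp add: moebius_vertex b2_def monom_sum)
  finally show ?thesis
    by (simp add: moebius_top monom_altdef numeral_eq_Suc monom_Suc monom_0)
qed

text \<open>The characteristic polynomial is \<open>(t - 1) * (t\<^sup>2 - (n - 1) * t + (b2 - n + 1))\<close>.\<close>

lemma real_roots_bound:
  assumes "only_real_roots (characteristic_poly A)"
  shows "4 * b2 \<le> (int (card A))\<^sup>2 + 2 * int (card A) - 3"
proof (rule ccontr)
  assume neg: "\<not> ?thesis"
  define n where "n = real (card A)"
  define b where "b = real_of_int b2"
  define D where "D = 4 * b - (n\<^sup>2 + 2 * n - 3)"
  have "D > 0"
  proof -
    have "real_of_int (4 * b2) > real_of_int ((int (card A))\<^sup>2 + 2 * int (card A) - 3)"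
      using neg by (simp only: of_int_less_iff not_le)
    then show ?thesis by (simp add: D_def b_def n_def)
  qed
  \<comment> \<open>A root of the quadratic factor, whose discriminant is \<open>- D\<close>; for
    \<open>D > 0\<close> it is not real.\<close>
  define z where "z = Complex ((n - 1) / 2) (sqrt D / 2)"
  have "z\<^sup>2 - (n - 1) * z + (b - n + 1) = 0"
    using \<open>D > 0\<close> by (simp add: complex_eq_iff z_def power2_eq_square field_simps D_def)
  moreover have "poly (map_poly of_int (characteristic_poly A)) z
      = (z - 1) * (z\<^sup>2 - (n - 1) * z + (b - n + 1))"
    by (simp add: characteristic_poly_eq map_poly_pCons n_def b_def algebra_simps power2_eq_square)
  ultimately have "z \<in> \<real>" using assms by (simp add: only_real_roots_def)
  then show False using \<open>D > 0\<close> by (simp add: complex_is_Real_iff z_def)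
qed

section \<open>Pairs of curves and the estimate for double points\<close>

lemma sum_pairs: "(\<Sum>v\<in>vertices A. int (weight A v) * (int (weight A v) - 1)) = int (card A) * (int (card A) - 1)"
proof -
  have fA: "finite A" by (rule arrangement_finite)
  \<comment> \<open>Ordered pairs of distinct curves are sorted by the one vertex they share; at a
    vertex of weight \<open>w\<close> there are \<open>w (w - 1)\<close> of them.\<close>
  have "(\<Sum>C\<in>A. \<Sum>D\<in>A - {C}. \<Sum>v\<in>vertices A. if v \<in> C \<and> v \<in> D then 1 else 0)
      = (\<Sum>C\<in>A. \<Sum>D\<in>A - {C}. (1::int))"
  proof (intro sum.cong refl)
    fix C D assume CD: "C \<in> A" "D \<in> A - {C}"
    then obtain p where p: "C \<inter> D = {p}" using common_point[of C D] by auto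
    then have "p \<in> vertices A" using CD by (intro vertexI[of C D p]) auto
    moreover have "{v \<in> vertices A. v \<in> C \<and> v \<in> D} = vertices A \<inter> (C \<inter> D)" by blast
    ultimately have "{v \<in> vertices A. v \<in> C \<and> v \<in> D} = {p}" unfolding p by blast
    moreover have "(\<Sum>v\<in>vertices A. if v \<in> C \<and> v \<in> D then 1 else 0) = int (card {v \<in> vertices A. v \<in> C \<and> v \<in> D})"
      using finite_vertices by (simp add: sum.If_cases Int_def)
    ultimately show "(\<Sum>v\<in>vertices A. if v \<in> C \<and> v \<in> D then 1 else 0) = (1::int)" by simp
  qed
  also have "\<dots> = int (card A) * (int (card A) - 1)"
  proof -
    have "int (card A - 1) = int (card A) - 1" using card_A by simp
    then show ?thesis using fA by (simp add: card_Diff_singleton)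
  qed
  also have "(\<Sum>C\<in>A. \<Sum>D\<in>A - {C}. \<Sum>v\<in>vertices A. if v \<in> C \<and> v \<in> D then 1 else (0::int))
     = (\<Sum>v\<in>vertices A. \<Sum>C\<in>A. \<Sum>D\<in>A - {C}. if v \<in> C \<and> v \<in> D then 1 else 0)"
  proof -
    have "(\<Sum>C\<in>A. \<Sum>D\<in>A - {C}. \<Sum>v\<in>vertices A. if v \<in> C \<and> v \<in> D then 1 else (0::int))
       = (\<Sum>C\<in>A. \<Sum>v\<in>vertices A. \<Sum>D\<in>A - {C}. if v \<in> C \<and> v \<in> D then 1 else 0)"
      by (intro sum.cong refl sum.swap)
    also have "\<dots> = (\<Sum>v\<in>vertices A. \<Sum>C\<in>A. \<Sum>D\<in>A - {C}. if v \<in> C \<and> v \<in> D then 1 else 0)"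
      by (rule sum.swap)
    finally show ?thesis .
  qed
  also have "\<dots> = (\<Sum>v\<in>vertices A. int (weight A v) * (int (weight A v) - 1))"
  proof (intro sum.cong refl)
    fix v assume v: "v \<in> vertices A"
    let ?l = "lines_through A v"
    have "(\<Sum>C\<in>A. \<Sum>D\<in>A - {C}. if v \<in> C \<and> v \<in> D then 1 else 0) = (\<Sum>C\<in>A. if v \<in> C then int (card (?l - {C})) else 0)"
    proof (intro sum.cong refl)
      fix C assume "C \<in> A"
      have "(A - {C}) \<inter> {D. v \<in> D} = ?l - {C}" by (auto simp: lines_through_def)
      then show "(\<Sum>D\<in>A - {C}. if v \<in> C \<and> v \<in> D then 1 else 0) = (if v \<in> C then int (card (?l - {C})) else 0)"
        using fA by (simp add: sum.If_cases)
    qed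
    also have "\<dots> = (\<Sum>C\<in>?l. int (card (?l - {C})))"
    proof -
      have "A \<inter> {C. v \<in> C} = ?l" by (auto simp: lines_through_def)
      then show ?thesis by (simp only: sum.If_cases[OF fA] sum.neutral_const add_0_right)
    qed
    also have "\<dots> = (\<Sum>C\<in>?l. int (weight A v) - 1)"
      using card_lines_through[OF v] finite_lines_through
      by (intro sum.cong) (auto simp: weight_def of_nat_diff card_Diff_singleton)
    finally show "(\<Sum>C\<in>A. \<Sum>D\<in>A - {C}. if v \<in> C \<and> v \<in> D then 1 else 0) = int (weight A v) * (int (weight A v) - 1)"
      by (simp add: weight_def)
  qed
  finally show ?thesis by simp
qed

text \<open>\<open>Max\<close> needs a finite set, here bounded by \<open>card A\<close>. That
  \<open>num_points\<close> is positive at this weight needs finiteness too, as \<open>card\<close>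
  of an infinite set is 0; points of the same weight as a vertex are again vertices.\<close>

lemma weight_le_multiplicity:
  assumes "v \<in> vertices A"
  shows "weight A v \<le> arrangement_multiplicity A"
proof -
  have "{j. num_points A j > 0} \<subseteq> {..card A}"
  proof
    fix j assume "j \<in> {j. num_points A j > 0}"
    then have "{v \<in> RP2. weight A v = j} \<noteq> {}" by (auto simp: num_points_def card_gt_0_iff)
    then obtain u where "weight A u = j" by blast
    then show "j \<in> {..card A}"
      using card_mono[OF arrangement_finite lines_through_subset[of u]] by (simp add: weight_def)
  qed
  then have "finite {j. num_points A j > 0}" using finite_subset by blast
  moreover have "{u \<in> RP2. weight A u = weight A v} \<subseteq> vertices A" using assms by (auto simp: vertices_def)
  then have "finite {u \<in> RP2. weight A u = weight A v}" using finite_vertices finite_subset by blast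
  then have "num_points A (weight A v) > 0"
    using assms by (auto simp: num_points_def card_gt_0_iff vertices_def)
  ultimately show ?thesis unfolding arrangement_multiplicity_def by (intro Max_ge) auto
qed

lemma num_points_2: "int (num_points A 2) = (\<Sum>v\<in>vertices A. if weight A v = 2 then 1 else 0)"
proof -
  have "{v \<in> RP2. weight A v = 2} = {v \<in> vertices A. weight A v = 2}" by (auto simp: vertices_def)
  then show ?thesis using finite_vertices by (simp add: num_points_def sum.If_cases Int_def)
qed

text \<open>A double point contributes 1 to the sum in Melchior's inequality and every other vertex
  at most 0. This settles the case of multiplicity 2.\<close>

lemma num_points_2_ge_3: "int (num_points A 2) \<ge> 3"
proof -
  have "(\<Sum>v\<in>vertices A. 3 - int (weight A v)) \<le> (\<Sum>v\<in>vertices A. if weight A v = 2 then 1 else 0)"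
    by (rule sum_mono) (auto simp: vertices_def)
  then show ?thesis using Melchior_vertices num_points_2 by simp
qed

text \<open>Equality holds for \<open>w = 2\<close>; otherwise the right side exceeds the left by
  \<open>(m - w) * (w - 3)\<close>. The multiplier \<open>m - 1\<close> is chosen to produce this
  product, and \<open>m - 2\<close> then corrects the value at \<open>w = 2\<close>.\<close>

lemma vertex_weight_bound:
  fixes w m t :: int
  assumes "2 \<le> w" "w \<le> m"
  shows "w * (w - 1) - 3 * (w - 1) \<le> (m - 2) * (if w = 2 then 1 else 0) - (m - 1) * (3 - w)"
proof (cases "w = 2")
  case False
  then have "0 \<le> (m - w) * (w - 3)" using assms by (intro mult_nonneg_nonneg) auto
  then show ?thesis using False by (simp add: algebra_simps)
qed simp

text \<open>Four times the summed vertex bound is combined with three times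
  \<open>real_roots_bound\<close>. The left side becomes
  \<open>4 n (n - 1) - 3 (n\<^sup>2 + 2 n - 3) = (n - 5)\<^sup>2 - 16\<close>, the right side
  \<open>4 (m - 2) t - 12 (m - 1) = (4 m - 8) (t - 3) - 12\<close>.\<close>

lemma double_points_bound:
  assumes "only_real_roots (characteristic_poly A)"
  shows "(int (card A) - 5)\<^sup>2 - 4 \<le> (4 * int (arrangement_multiplicity A) - 8) * (int (num_points A 2) - 3)"
proof -
  let ?n = "int (card A)" and ?m = "int (arrangement_multiplicity A)" and ?t = "int (num_points A 2)"
  let ?w = "\<lambda>v. int (weight A v)"
  have w: "2 \<le> ?w v" "?w v \<le> ?m" if "v \<in> vertices A" for v
    using weight_le_multiplicity[OF that] that by (auto simp: vertices_def)
  have "vertices A \<noteq> {}" using Melchior_vertices by auto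
  then have "?m \<ge> 2" using w by fastforce
  have "?n * (?n - 1) - 3 * b2 = (\<Sum>v\<in>vertices A. ?w v * (?w v - 1) - 3 * (?w v - 1))"
    by (simp add: b2_def sum_pairs[symmetric] sum_subtractf[symmetric] sum_distrib_left del: sum_subtractf)
  also have "\<dots> \<le> (\<Sum>v\<in>vertices A. (?m - 2) * (if weight A v = 2 then 1 else 0) - (?m - 1) * (3 - ?w v))"
  proof (rule sum_mono)
    fix v assume "v \<in> vertices A"
    from vertex_weight_bound[OF w[OF this]]
    show "?w v * (?w v - 1) - 3 * (?w v - 1)
        \<le> (?m - 2) * (if weight A v = 2 then 1 else 0) - (?m - 1) * (3 - ?w v)"
      by (simp only: of_nat_eq_iff[of _ 2, symmetric, where 'a = int] of_nat_numeral)
  qed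
  also have "\<dots> = (?m - 2) * ?t - (?m - 1) * (\<Sum>v\<in>vertices A. 3 - ?w v)"
    unfolding num_points_2 sum_distrib_left sum_subtractf[symmetric] ..
  also have "\<dots> \<le> (?m - 2) * ?t - (?m - 1) * 3"
    using Melchior_vertices \<open>?m \<ge> 2\<close> by (intro diff_left_mono mult_left_mono) auto
  finally have "4 * (?n * (?n - 1)) - 12 * b2 \<le> 4 * ((?m - 2) * ?t - (?m - 1) * 3)" by simp
  then show ?thesis using real_roots_bound[OF assms] by (simp add: algebra_simps power2_eq_square)
qed

end

theorem theorem4p7:
  fixes A :: "(real^3) set set set" and n :: nat
  assumes "pseudoline_arrangement A"
    and "card A = n" and "n \<ge> 4"
    and "only_real_roots (characteristic_poly A)"
  shows "real (num_points A 2) \<ge>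
           3 + ((real n - 5)\<^sup>2 - 4) / (4 * real (arrangement_multiplicity A) - 8)"
proof (cases "arrangement_multiplicity A > 2")
  case True
  have "real_of_int ((int (card A) - 5)\<^sup>2 - 4) \<le>
      real_of_int ((4 * int (arrangement_multiplicity A) - 8) * (int (num_points A 2) - 3))"
    using double_points_bound[OF assms(1,4)] by (simp only: of_int_le_iff)
  then have "(real n - 5)\<^sup>2 - 4 \<le> (4 * real (arrangement_multiplicity A) - 8) * (real (num_points A 2) - 3)"
    using assms(2) by simp
  then have "((real n - 5)\<^sup>2 - 4) / (4 * real (arrangement_multiplicity A) - 8) \<le> real (num_points A 2) - 3"
    using True by (simp add: pos_divide_le_eq mult.commute)
  then show ?thesis by simp
next
  case False
  have "vertices A \<noteq> {}" using Melchior_vertices[OF assms(1)] by auto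
  then obtain v where "v \<in> vertices A" by blast
  \<comment> \<open>The denominator is 0 here and division by 0 yields 0, so the claim reduces to at
    least three double points.\<close>
  then have "arrangement_multiplicity A = 2"
    using False weight_le_multiplicity[OF assms(1), of v] by (simp add: vertices_def)
  then show ?thesis using num_points_2_ge_3[OF assms(1)] by simp
qed

end
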